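(* Let $W$ be an irreducible Coxeter group acting on $V$, with reflection arrangement $\mathcal A$, quotient map $p\colon V\to V/W$ and $K=JJ^t$. Let $M^\ell_\ell$ be the $(\ell,\ell)$ entry of the adjugate matrix of $K$ (the minor of $K$ obtained by deleting its last row and last column), and let $D'=\{M^\ell_\ell=0\}\subset V/W$. Then $\mathcal A+p^{-1}(D')$ is a free divisor in $V$.
   Context: $W\subset\mathrm{GL}(V)$, $V=V_{\mathbb R}\otimes_{\mathbb R}\mathbb{C}$, $\dim V=\ell$, is a finite irreducible group generated by reflections defined over $\mathbb{R}$; $\mathcal A$ is the union of its reflecting hyperplanes. Let $x_1,\dots,x_\ell$ be coordinates orthonormal for a $W$-invariant Euclidean inner product on $V_{\mathbb R}$, $S=\mathbb{C}[V]$, and $R=S^W=\mathbb{C}[p_1,\dots,p_\ell]$ with $p_i$ homogeneous basic invariants ordered by increasing degree. $J=(\partial_{x_j}(p_i))$, so that $\det J$ is a reduced equation of $\mathcal A$, and $K=JJ^t$, which has entries in $R$. For a reduced divisor $E=\{f=0\}$ in $V$, $\mathrm{Der}(-\log E)=\{\delta\in\mathrm{Der}_S\mid\delta(f)\in Sf\}$, and $E$ is a free divisor if this is a free $S$-module. $\mathcal A+p^{-1}(D')$ is the divisor with equation $\det(J)\cdot(M^\ell_\ell\circ p)$; being a free divisor includes that it is reduced. *)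

theory Defs
  imports
    "HOL-Analysis.Determinants"
    "HOL-Algebra.Generated_Groups"
    "HOL-Computational_Algebra.Squarefree"
    "HOL-Library.Function_Algebras"
    "HOL-Library.Poly_Mapping"
    "HOL.Complex"
begin

section \<open>Polynomials in \<open>\<ell> = CARD('n)\<close> variables over the complex numbers\<close>

text \<open>Exponent vectors are elements of \<open>'n \<Rightarrow>\<^sub>0 nat\<close>. The same type serves as \<open>S = C[V]\<close>, with
  variables \<open>x\<^sub>j\<close>, and as the coordinate ring \<open>C[y\<^sub>1, ..., y\<^sub>\<ell>]\<close> of \<open>V/W\<close>.\<close>

type_synonym 'n cpoly = "('n \<Rightarrow>\<^sub>0 nat) \<Rightarrow>\<^sub>0 complex"

definition Const :: "complex \<Rightarrow> 'n cpoly" where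
  "Const c = Poly_Mapping.single 0 c"

definition Var :: "'n \<Rightarrow> 'n cpoly" where
  "Var j = Poly_Mapping.single (Poly_Mapping.single j 1) 1"

text \<open>\<open>poly_subst g f = f(g\<^sub>1, ..., g\<^sub>\<ell>)\<close>\<close>

definition poly_subst :: "('n::finite \<Rightarrow> 'n cpoly) \<Rightarrow> 'n cpoly \<Rightarrow> 'n cpoly" where
  "poly_subst g f =
     (\<Sum>m\<in>Poly_Mapping.keys f.
        Const (Poly_Mapping.lookup f m) * (\<Prod>i\<in>UNIV. g i ^ Poly_Mapping.lookup m i))"

text \<open>If the exponent of \<open>x\<^sub>j\<close> in \<open>m\<close> is zero, the truncated difference of exponents is harmless,
  because the coefficient is zero.\<close>

definition pdiff :: "'n \<Rightarrow> 'n cpoly \<Rightarrow> 'n cpoly" where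
  "pdiff j f =
     (\<Sum>m\<in>Poly_Mapping.keys f.
        Poly_Mapping.single (m - Poly_Mapping.single j 1)
          (of_nat (Poly_Mapping.lookup m j) * Poly_Mapping.lookup f m))"

definition homogeneous :: "nat \<Rightarrow> 'n::finite cpoly \<Rightarrow> bool" where
  "homogeneous d f \<longleftrightarrow>
     (\<forall>m\<in>Poly_Mapping.keys f. (\<Sum>i\<in>UNIV. Poly_Mapping.lookup m i) = d)"


section \<open>Reflection groups and their invariants\<close>

text \<open>A group defined over the reals is given by its real matrices in the coordinates
  \<open>x\<^sub>1, ..., x\<^sub>\<ell>\<close>.\<close>

definition GL :: "(real^'n::finite^'n) monoid" where
  "GL = \<lparr>carrier = {A. invertible A}, mult = (**), one = mat 1\<rparr>"

definition is_reflection :: "real^'n::finite^'n \<Rightarrow> bool" where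
  "is_reflection s \<longleftrightarrow> invertible s \<and> Suc (dim {v. s *v v = v}) = CARD('n)"

text \<open>Irreducibility is required of the action on the real form only; this is implied by
  irreducibility of the action on the complexification.\<close>

definition irreducible_action :: "(real^'n::finite^'n) set \<Rightarrow> bool" where
  "irreducible_action W \<longleftrightarrow>
     (\<forall>U. subspace U \<and> (\<forall>w\<in>W. \<forall>u\<in>U. w *v u \<in> U) \<longrightarrow> U = {0} \<or> U = UNIV)"

definition irreducible_reflection_group :: "(real^'n::finite^'n) set \<Rightarrow> bool" where
  "irreducible_reflection_group W \<longleftrightarrow>
     finite W \<and> subgroup W GL \<and> W = generate GL {s \<in> W. is_reflection s} \<and> irreducible_action W"

definition invariant_ring :: "(real^'n::finite^'n) set \<Rightarrow> 'n cpoly set" where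
  "invariant_ring W =
     {f. \<forall>w\<in>W. poly_subst (\<lambda>i. \<Sum>j\<in>UNIV. Const (complex_of_real (w $ i $ j)) * Var j) f = f}"

text \<open>\<open>p\<^sub>1, ..., p\<^sub>\<ell>\<close> are algebraically independent, and \<open>S\<^sup>W = C[p\<^sub>1, ..., p\<^sub>\<ell>]\<close>, with \<open>p\<^sub>i\<close>
  homogeneous of degree \<open>d i\<close>.\<close>

definition basic_invariants ::
  "(real^'n::finite^'n) set \<Rightarrow> ('n \<Rightarrow> nat) \<Rightarrow> ('n \<Rightarrow> 'n cpoly) \<Rightarrow> bool" where
  "basic_invariants W d p \<longleftrightarrow>
     (\<forall>i. homogeneous (d i) (p i)) \<and> inj (poly_subst p) \<and> range (poly_subst p) = invariant_ring W"


section \<open>The matrices \<open>J\<close> and \<open>K\<close>\<close>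

definition jacobian :: "('n::finite \<Rightarrow> 'n cpoly) \<Rightarrow> 'n cpoly^'n^'n" where
  "jacobian p = (\<chi> i j. pdiff j (p i))"

text \<open>For \<open>f \<in> S\<^sup>W\<close>, \<open>descend p f\<close> is the polynomial function \<open>g\<close> on \<open>V/W\<close>, in the coordinates
  \<open>p\<^sub>1, ..., p\<^sub>\<ell>\<close>, with \<open>f = g \<circ> p\<close>.\<close>

definition descend :: "('n::finite \<Rightarrow> 'n cpoly) \<Rightarrow> 'n cpoly \<Rightarrow> 'n cpoly" where
  "descend p f = (THE g. poly_subst p g = f)"

definition K_matrix :: "('n::finite \<Rightarrow> 'n cpoly) \<Rightarrow> 'n cpoly^'n^'n" where
  "K_matrix p = (\<chi> i j. descend p ((jacobian p ** transpose (jacobian p)) $ i $ j))"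

text \<open>Matrix types do not allow the deletion of row \<open>i\<close> and column \<open>j\<close>. Replacing them by zeros, with
  a 1 in their common position, gives the minor multiplied by the sign \<open>(-1)\<^bsup>i+j\<^esup>\<close>.\<close>

definition cofactor :: "'a::comm_ring_1^'n::finite^'n \<Rightarrow> 'n \<Rightarrow> 'n \<Rightarrow> 'a" where
  "cofactor A i j =
     det (\<chi> k l. if k = i \<and> l = j then 1 else if k = i \<or> l = j then 0 else A $ k $ l)"

definition adjugate :: "'a::comm_ring_1^'n::finite^'n \<Rightarrow> 'a^'n^'n" where
  "adjugate A = (\<chi> i j. cofactor A j i)"

lemma cofactor_row:
  "cofactor A i j = det (\<chi> k. if k = i then axis j 1 else A $ k)"
proof -
  have "(\<Prod>k\<in>UNIV. (\<chi> k l. if k = i \<and> l = j then 1 else if k = i \<or> l = j then 0 else A $ k $ l) $ k $ q k)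
      = (\<Prod>k\<in>UNIV. (\<chi> k. if k = i then axis j 1 else A $ k) $ k $ q k)"
    (is "prod ?f _ = prod ?g _") if q: "q permutes UNIV" for q
  proof (cases "q i = j")
    case True
    have "q k \<noteq> j" if "k \<noteq> i" for k
      using that True permutes_inj[OF q] by (auto simp: inj_eq)
    then show ?thesis
      using True by (intro prod.cong) (auto simp: axis_def)
  next
    case False
    have "?f i = 0" and g: "?g i = 0"
      using False by (auto simp: axis_def)
    then have "prod ?f UNIV = 0"
      by (intro prod_zero[OF finite bexI[OF _ UNIV_I]])
    moreover from g have "prod ?g UNIV = 0"
      by (rule prod_zero[OF finite bexI[OF _ UNIV_I]])
    ultimately show ?thesis by (rule trans[OF _ sym])
  qed
  then show ?thesis
    unfolding cofactor_def det_def by (intro sum.cong) simp_all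
qed

lemma matrix_mul_adjugate: "A ** adjugate A = mat (det A)"
proof -
  have "(A ** adjugate A) $ i $ j = mat (det A) $ i $ j" for i j
  proof -
    have "(A ** adjugate A) $ i $ j
        = (\<Sum>k\<in>UNIV. A $ i $ k * det (\<chi> m. if m = j then axis k 1 else A $ m))"
      by (simp add: matrix_matrix_mult_def adjugate_def cofactor_row)
    also have "\<dots> = (\<Sum>k\<in>UNIV. det (\<chi> m. if m = j then A $ i $ k *s axis k 1 else A $ m))"
      by (simp add: det_row_mul)
    also have "\<dots> = det (\<chi> m. if m = j then (\<Sum>k\<in>UNIV. A $ i $ k *s axis k 1) else A $ m)"
      by (simp add: det_linear_row_sum)
    also have "(\<Sum>k\<in>UNIV. A $ i $ k *s axis k 1) = A $ i"
      by (simp add: vec_eq_iff axis_def if_distrib cong: if_cong)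
    also have "det (\<chi> m. if m = j then A $ i else A $ m) = mat (det A) $ i $ j"
    proof (cases "i = j")
      case True
      then have "(\<chi> m. if m = j then A $ i else A $ m) = A"
        by (simp add: vec_eq_iff)
      with True show ?thesis by (simp add: mat_def)
    next
      case False
      then have "det (\<chi> m. if m = j then A $ i else A $ m) = 0"
        by (intro det_identical_rows[of i j]) (auto simp: row_def)
      with False show ?thesis by (simp add: mat_def)
    qed
    finally show ?thesis .
  qed
  then show ?thesis by (simp add: vec_eq_iff)
qed

text \<open>The diagonal entries of the adjugate are the principal minors, written here as Leibniz sums
  over the remaining index set.\<close>

lemma adjugate_diagonal:
  "adjugate A $ i $ i =
     (\<Sum>q | q permutes (UNIV - {i}). of_int (sign q) * (\<Prod>k\<in>UNIV - {i}. A $ k $ q k))"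
proof -
  let ?B = "\<chi> k l. if k = i \<and> l = i then 1 else if k = i \<or> l = i then 0 else A $ k $ l"
  let ?t = "\<lambda>q. of_int (sign q) * (\<Prod>k\<in>UNIV. ?B $ k $ q k)"
  have "adjugate A $ i $ i = sum ?t {q. q permutes UNIV}"
    by (simp add: adjugate_def cofactor_def det_def)
  also have "\<dots> = sum ?t {q. q permutes (UNIV - {i})}"
  proof (rule sum.mono_neutral_right)
    show "finite {q. q permutes (UNIV :: 'b set)}"
      by (simp add: finite_permutations)
    show "{q. q permutes (UNIV - {i})} \<subseteq> {q. q permutes UNIV}"
      by (auto intro: permutes_subset)
    show "\<forall>q\<in>{q. q permutes UNIV} - {q. q permutes (UNIV - {i})}. ?t q = 0"
    proof
      fix q assume "q \<in> {q. q permutes UNIV} - {q. q permutes (UNIV - {i})}"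
      then have "q i \<noteq> i" by (auto simp: permutes_def)
      then have "?B $ i $ q i = 0" by simp
      then have "(\<Prod>k\<in>UNIV. ?B $ k $ q k) = 0"
        by (rule prod_zero[OF finite bexI[OF _ UNIV_I]])
      then show "?t q = 0" by simp
    qed
  qed
  also have "\<dots> = (\<Sum>q | q permutes (UNIV - {i}). of_int (sign q) * (\<Prod>k\<in>UNIV - {i}. A $ k $ q k))"
  proof (rule sum.cong[OF refl])
    fix q assume "q \<in> {q. q permutes (UNIV - {i})}"
    then have q: "q permutes (UNIV - {i})" by simp
    then have qi: "q i = i" by (auto simp: permutes_def)
    have "q k \<noteq> i" if "k \<noteq> i" for k
      using that qi permutes_inj[OF q] by (metis injD)
    then have "(\<Prod>k\<in>UNIV - {i}. ?B $ k $ q k) = (\<Prod>k\<in>UNIV - {i}. A $ k $ q k)"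
      by (intro prod.cong) auto
    moreover have "(\<Prod>k\<in>UNIV. ?B $ k $ q k) = ?B $ i $ q i * (\<Prod>k\<in>UNIV - {i}. ?B $ k $ q k)"
      by (rule prod.remove) auto
    ultimately show "?t q = of_int (sign q) * (\<Prod>k\<in>UNIV - {i}. A $ k $ q k)"
      using qi by simp
  qed
  finally show ?thesis .
qed


section \<open>Logarithmic derivations and free divisors\<close>

definition Der :: "('n cpoly \<Rightarrow> 'n cpoly) set" where
  "Der = {\<delta>. (\<forall>f g. \<delta> (f + g) = \<delta> f + \<delta> g) \<and> (\<forall>c f. \<delta> (Const c * f) = Const c * \<delta> f) \<and>
             (\<forall>f g. \<delta> (f * g) = f * \<delta> g + g * \<delta> f)}"

definition log_Der :: "'n cpoly \<Rightarrow> ('n cpoly \<Rightarrow> 'n cpoly) set" where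
  "log_Der f = {\<delta> \<in> Der. f dvd \<delta> f}"

text \<open>The \<open>S\<close>-module of all maps \<open>S \<rightarrow> S\<close>, of which \<^term>\<open>Der\<close> and \<^term>\<open>log_Der f\<close> are submodules\<close>

definition der_scale :: "'n cpoly \<Rightarrow> ('n cpoly \<Rightarrow> 'n cpoly) \<Rightarrow> 'n cpoly \<Rightarrow> 'n cpoly" where
  "der_scale a \<delta> = (\<lambda>f. a * \<delta> f)"

global_interpretation der: Modules.module der_scale
  defines der_span = der.span and der_dependent = der.dependent
  by standard (auto simp: der_scale_def fun_eq_iff algebra_simps)

text \<open>The divisor \<open>{f = 0}\<close> is reduced and \<open>Der(-log)\<close> has a basis. Note that 0 is not squarefree.\<close>

definition free_divisor :: "'n cpoly \<Rightarrow> bool" where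
  "free_divisor f \<longleftrightarrow>
     squarefree f \<and> (\<exists>B. \<not> der_dependent B \<and> der_span B = log_Der f)"

end

theory Submission
  imports Defs "HOL-Computational_Algebra.Fundamental_Theorem_Algebra" "HOL-Analysis.Topology_Euclidean_Space"
begin

text \<open>Write \<open>J\<close> for the Jacobian matrix, \<open>K = J J\<^sup>T\<close>, \<open>M = adj K\<close> and \<open>m = M\<^sub>l\<^sub>l\<close>. Interpolation of jets along
  orbits gives invariants with prescribed jets, so \<open>det J\<close> is the product of the root forms and
  equivariant vector fields are combinations of the gradients of the \<open>p\<^sub>i\<close> with invariant coefficients.
  In particular \<open>Hess(p\<^sub>k) grad p\<^sub>i = \<Sum>\<^sub>j c\<^sub>k\<^sub>i\<^sub>j grad p\<^sub>j\<close>, and with \<open>N\<^sub>k\<^sub>i = c\<^sub>k\<^sub>i\<^sub>l\<close> differentiation of the adjugate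
  yields \<open>(grad p\<^sub>k) m = 2 (tr c\<^sub>k) m - 2 (N\<^sup>T M)\<^sub>k\<^sub>l\<close>. The matrix \<open>N\<close> has constant determinant by weights, and the
  constant is computed at a regular vector at which all \<open>p\<^sub>i\<close> with \<open>i \<noteq> l\<close> vanish. There \<open>N\<close> is a multiple of
  \<open>diag(d\<^sub>k - 1) K\<close>, hence invertible. As the rows of \<open>K\<close> other than the last one annihilate the last column of
  \<open>M\<close>, the rows of \<open>K (N\<^sup>T)\<^sup>-\<^sup>1\<close> combine the gradients to fields that are logarithmic for \<open>det J\<close> and \<open>m\<close>;
  together with the Euler field they satisfy Saito's criterion.\<close>

section \<open>Polynomials, substitution and evaluation\<close>

text \<open>Nothing is known about the factors of m, so it is never factored. Its reducedness is
  used in the form that m divides b as soon as it divides b times each partial derivative of m.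
  Modulo m, the derivative of m along grad p_k is -2 (N^T M)_kl, and as det N is a nonzero constant,
  these entries generate an ideal containing (det J)^2. Hence singular zeros of m lie on the
  mirrors, and it remains to see that no root form divides m. This is tested on the field det J
  d/dp_l, whose bilinear square is m. The regular vector z lies over the l-th axis of V/W and has
  three uses: comparing invariants at z and \<omega> z, for a primitive d_l-th root of unity
  \<omega>, gives 2 \<Sum> (d_i - 1) = \<ell> d_l and thus weight zero for det N; it evaluates det
  N; and it shows that (det J)^2 contains a pure power of p_l. By Schur's lemma the quadratic
  invariant is a multiple of the squared length, so the Euler field is, up to a constant, the
  gradient of a basic invariant. The trivial group, which is irreducible only on a line, has a
  linear basic invariant and is treated apart.\<close>

abbreviation lookup where "lookup \<equiv> Poly_Mapping.lookup"
abbreviation single where "single \<equiv> Poly_Mapping.single"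
abbreviation keys where "keys \<equiv> Poly_Mapping.keys"

lemma poly_mapping_sum_singles:
  fixes f :: "'a \<Rightarrow>\<^sub>0 'b::comm_monoid_add"
  shows "(\<Sum>m\<in>keys f. single m (lookup f m)) = f"
proof (rule poly_mapping_eqI)
  fix k
  have "(\<Sum>m\<in>keys f. lookup (single m (lookup f m)) k)
      = (\<Sum>m\<in>keys f. if m = k then lookup f k else 0)"
    by (intro sum.cong) (auto simp: lookup_single when_def)
  then show "lookup (\<Sum>m\<in>keys f. single m (lookup f m)) k
      = lookup f k"
    by (auto simp: lookup_sum in_keys_iff)
qed

lemma poly_mapping_induct_single [case_names zero single add]:
  fixes f :: "'a \<Rightarrow>\<^sub>0 'b::comm_monoid_add"
  assumes "P 0" "\<And>m c. P (single m c)" "\<And>f g. P f \<Longrightarrow> P g \<Longrightarrow> P (f + g)"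
  shows "P f"
proof -
  have "P (\<Sum>m\<in>A. single m (lookup f m))" if "finite A" for A
    using that by induction (auto intro: assms)
  then show ?thesis
    using poly_mapping_sum_singles[of f] by (metis finite_keys)
qed

lemma Const_add: "Const (a + b) = Const a + Const b"
  and Const_mult: "Const (a * b) = Const a * Const b"
  and Const_0 [simp]: "Const 0 = 0"
  and Const_1 [simp]: "Const 1 = 1"
  and Const_uminus: "Const (- a) = - Const a"
  and Const_diff: "Const (a - b) = Const a - Const b"
  by (simp_all add: Const_def single_add mult_single single_uminus single_diff)

lemma Const_inject [simp]: "Const a = Const b \<longleftrightarrow> a = b"
  by (auto simp: Const_def dest: injD[OF inj_single])

lemma Const_eq_0 [simp]: "Const a = 0 \<longleftrightarrow> a = 0"
  using Const_inject[of a 0] by simp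

lemma Const_power: "Const (a ^ n) = Const a ^ n"
  by (induction n) (simp_all add: Const_mult)

lemma Const_sum: "Const (sum f A) = (\<Sum>i\<in>A. Const (f i))"
  by (induction A rule: infinite_finite_induct) (simp_all add: Const_add)

lemma Const_prod: "Const (prod f A) = (\<Prod>i\<in>A. Const (f i))"
  by (induction A rule: infinite_finite_induct) (simp_all add: Const_mult)

lemma Const_of_nat: "Const (of_nat k) = of_nat k"
  by (induction k) (simp_all add: Const_add)

lemma Const_dvd_one: "c \<noteq> 0 \<Longrightarrow> Const c dvd 1"
  by (rule dvdI[of _ _ "Const (inverse c)"]) (simp flip: Const_mult)

lemma poly_subst_single:
  "poly_subst g (single m c) = Const c * (\<Prod>i\<in>UNIV. g i ^ lookup m i)"
  by (simp add: poly_subst_def)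

lemma poly_subst_add: "poly_subst g (f1 + f2) = poly_subst g f1 + poly_subst g f2"
  unfolding poly_subst_def by (rule setsum_keys_plus_distrib) (simp_all add: Const_add algebra_simps)

lemma poly_subst_0 [simp]: "poly_subst g 0 = 0"
  by (simp add: poly_subst_def)

lemma poly_subst_mult: "poly_subst g (f1 * f2) = poly_subst g f1 * poly_subst g f2"
proof (induction f1 rule: poly_mapping_induct_single)
  case (single m c)
  show ?case
  proof (induction f2 rule: poly_mapping_induct_single)
    case (single n d)
    show ?case
      by (simp add: mult_single poly_subst_single Const_mult lookup_add power_add prod.distrib algebra_simps)
  qed (simp_all add: poly_subst_add algebra_simps)
qed (simp_all add: poly_subst_add algebra_simps)

lemma poly_subst_Const [simp]: "poly_subst g (Const c) = Const c"
  by (simp add: Const_def poly_subst_single)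

lemma poly_subst_1 [simp]: "poly_subst g 1 = 1"
  using poly_subst_Const[of g 1] by simp

lemma poly_subst_Var [simp]: "poly_subst g (Var j) = g j"
proof -
  have "(\<Prod>i\<in>UNIV. g i ^ lookup (single j 1) i) = (\<Prod>i\<in>UNIV. if i = j then g j else 1)"
    by (intro prod.cong) (auto simp: lookup_single when_def)
  then show ?thesis
    by (simp add: Var_def poly_subst_single)
qed

lemma poly_subst_uminus: "poly_subst g (- f) = - poly_subst g f"
  by (metis add_eq_0_iff poly_subst_0 poly_subst_add)

lemma poly_subst_diff: "poly_subst g (f1 - f2) = poly_subst g f1 - poly_subst g f2"
  by (metis diff_add_cancel poly_subst_add add_diff_cancel)

lemma poly_subst_power: "poly_subst g (f ^ n) = poly_subst g f ^ n"
  by (induction n) (simp_all add: poly_subst_mult)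

lemma poly_subst_sum: "poly_subst g (sum f A) = (\<Sum>i\<in>A. poly_subst g (f i))"
  by (induction A rule: infinite_finite_induct) (simp_all add: poly_subst_add)

lemma poly_subst_prod: "poly_subst g (prod f A) = (\<Prod>i\<in>A. poly_subst g (f i))"
  by (induction A rule: infinite_finite_induct) (simp_all add: poly_subst_mult)

lemma poly_subst_of_int: "poly_subst g (of_int k) = of_int k"
proof -
  have "poly_subst g (of_nat n) = of_nat n" for n
    by (induction n) (simp_all add: poly_subst_add)
  then show ?thesis
    by (cases k) (simp_all add: poly_subst_uminus poly_subst_diff poly_subst_add)
qed

lemmas poly_subst_simps = poly_subst_add poly_subst_mult poly_subst_uminus poly_subst_diff
  poly_subst_power poly_subst_sum poly_subst_prod poly_subst_of_int

lemma single_eq_monomial: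
  fixes m :: "'n::finite \<Rightarrow>\<^sub>0 nat"
  shows "single m c = Const c * (\<Prod>i\<in>UNIV. Var i ^ lookup m i)"
proof -
  have pow: "Var i ^ k = single (single i k) (1::complex)" for i :: 'n and k
    by (induction k) (simp_all add: Var_def mult_single single_add[symmetric])
  have "(\<Prod>i\<in>A. Var i ^ lookup m i)
      = single (\<Sum>i\<in>A. single i (lookup m i)) (1::complex)" if "finite A" for A
    using that by induction (simp_all add: pow mult_single)
  moreover have "(\<Sum>i\<in>UNIV. single i (lookup m i)) = m"
  proof (rule poly_mapping_eqI)
    fix k
    have "(\<Sum>i\<in>UNIV. lookup (single i (lookup m i)) k)
        = (\<Sum>i\<in>UNIV. if i = k then lookup m k else 0)"
      by (intro sum.cong) (auto simp: lookup_single when_def)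
    then show "lookup (\<Sum>i\<in>UNIV. single i (lookup m i)) k = lookup m k"
      by (simp add: lookup_sum)
  qed
  ultimately show ?thesis
    by (simp add: Const_def mult_single)
qed

text \<open>Constants and variables generate the ring, so identities between homomorphisms or
  derivations need to be checked on them only.\<close>

lemma cpoly_induct [case_names Const Var add mult]:
  fixes f :: "'n::finite cpoly"
  assumes C: "\<And>c. P (Const c)" and V: "\<And>j. P (Var j)"
    and A: "\<And>f g. P f \<Longrightarrow> P g \<Longrightarrow> P (f + g)" and M: "\<And>f g. P f \<Longrightarrow> P g \<Longrightarrow> P (f * g)"
  shows "P f"
proof (induction f rule: poly_mapping_induct_single)
  case zero
  show ?case using C[of 0] by simp
next
  case (single m c)
  have pow: "P (Var i ^ k)" for i k
    by (induction k) (use C[of 1] in \<open>auto intro: V M\<close>)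
  have "P (\<Prod>i\<in>B. Var i ^ lookup m i)" if "finite B" for B
    using that by induction (use C[of 1] in \<open>auto intro: M pow\<close>)
  then show ?case
    by (simp add: single_eq_monomial C M)
qed (rule A)

section \<open>Evaluation of polynomials at points\<close>

definition pev :: "'n::finite cpoly \<Rightarrow> complex^'n \<Rightarrow> complex" where
  "pev f x = (\<Sum>m\<in>keys f. lookup f m * (\<Prod>i\<in>UNIV. (x $ i) ^ lookup m i))"

lemma poly_subst_Const_point: "poly_subst (\<lambda>i. Const (x $ i)) f = Const (pev f x)"
  by (simp add: poly_subst_def pev_def Const_sum Const_mult Const_prod Const_power)

text \<open>Evaluation at \<open>x\<close> is the substitution of the constants
  \<open>Const (x $ i)\<close>, and \<open>Const\<close> is injective, so the rules are inherited
  from \<open>poly_subst\<close>.\<close>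

lemma fixes f g :: "'n::finite cpoly"
  shows pev_add: "pev (f + g) x = pev f x + pev g x"
  and pev_mult: "pev (f * g) x = pev f x * pev g x"
  and pev_0 [simp]: "pev 0 x = 0"
  and pev_1 [simp]: "pev 1 x = 1"
  and pev_Const [simp]: "pev (Const c) x = c"
  and pev_Var [simp]: "pev (Var j) x = x $ j"
  and pev_uminus: "pev (- f) x = - pev f x"
  and pev_diff: "pev (f - g) x = pev f x - pev g x"
  and pev_power: "pev (f ^ n) x = pev f x ^ n"
  and pev_of_int: "pev (of_int k) x = of_int k"
proof -
  note [simp del] = Const_inject
  have inj: "Const a = (Const b :: 'n cpoly) \<Longrightarrow> a = b" for a b
    by (simp add: Const_inject)
  have of_int: "Const (of_int k) = of_int k" for k
    by (simp add: Const_def)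
  note * = poly_subst_Const_point[symmetric] poly_subst_simps Const_add Const_mult Const_uminus
    Const_diff Const_power of_int
  show "pev (f + g) x = pev f x + pev g x" by (rule inj) (simp add: *)
  show "pev (f * g) x = pev f x * pev g x" by (rule inj) (simp add: *)
  show "pev 0 x = 0" by (rule inj) (simp add: *)
  show "pev 1 x = 1" by (rule inj) (simp add: *)
  show "pev (Const c) x = c" by (rule inj) (simp add: *)
  show "pev (Var j) x = x $ j" by (rule inj) (simp add: *)
  show "pev (- f) x = - pev f x" by (rule inj) (simp add: *)
  show "pev (f - g) x = pev f x - pev g x" by (rule inj) (simp add: *)
  show "pev (f ^ n) x = pev f x ^ n" by (rule inj) (simp add: *)
  show "pev (of_int k) x = of_int k" by (rule inj) (simp add: *)
qed

lemma pev_sum: "pev (sum f A) x = (\<Sum>i\<in>A. pev (f i) x)"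
  by (induction A rule: infinite_finite_induct) (simp_all add: pev_add)

lemma pev_prod: "pev (prod f A) x = (\<Prod>i\<in>A. pev (f i) x)"
  by (induction A rule: infinite_finite_induct) (simp_all add: pev_mult)

lemma pev_of_nat: "pev (of_nat k) x = of_nat k"
  using pev_of_int[of "int k"] by simp

lemmas pev_simps = pev_add pev_mult pev_uminus pev_diff pev_power pev_sum pev_prod pev_of_int pev_of_nat

lemma pev_poly_subst: "pev (poly_subst g f) x = pev f (\<chi> i. pev (g i) x)"
  by (induction f rule: cpoly_induct) (simp_all add: poly_subst_simps pev_simps)

lemma poly_subst_Var_id [simp]: "poly_subst Var f = f"
  by (induction f rule: cpoly_induct) (simp_all add: poly_subst_simps)

text \<open>For \<open>g = Var\<close> and \<open>h\<close> a projection onto a hyperplane, this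
  says that a polynomial is congruent to its restriction modulo the linear form.\<close>

lemma dvd_poly_subst_diff:
  assumes "\<And>i. q dvd g i - h i"
  shows "q dvd poly_subst g f - poly_subst h f"
proof (induction f rule: cpoly_induct)
  case (add f1 f2)
  have "poly_subst g (f1 + f2) - poly_subst h (f1 + f2)
      = (poly_subst g f1 - poly_subst h f1) + (poly_subst g f2 - poly_subst h f2)"
    by (simp add: poly_subst_simps)
  then show ?case using add by simp
next
  case (mult f1 f2)
  have "poly_subst g (f1 * f2) - poly_subst h (f1 * f2)
      = (poly_subst g f1 - poly_subst h f1) * poly_subst g f2 + (poly_subst g f2 - poly_subst h f2) * poly_subst h f1"
    by (simp add: poly_subst_simps algebra_simps)
  then show ?case using mult by simp
qed (use assms in simp_all)

section \<open>Partial derivatives and zeros\<close>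

lemma pdiff_single:
  "pdiff j (single m c) = single (m - single j 1) (of_nat (lookup m j) * c)"
  by (simp add: pdiff_def)

lemma pdiff_add: "pdiff j (f + g) = pdiff j f + pdiff j g"
  unfolding pdiff_def by (rule setsum_keys_plus_distrib) (simp_all add: single_add algebra_simps)

lemma pdiff_0 [simp]: "pdiff j 0 = 0"
  by (simp add: pdiff_def)

lemma pdiff_mult_single:
  fixes m n :: "'n \<Rightarrow>\<^sub>0 nat"
  shows "pdiff j (single m c * single n d)
    = single m c * pdiff j (single n d) + single n d * pdiff j (single m c)"
proof -
  let ?e = "single j (1::nat)"
  have "(m - ?e) + n = m + n - ?e" if "lookup m j \<noteq> 0" for m n :: "'n \<Rightarrow>\<^sub>0 nat"
    by (rule poly_mapping_eqI) (use that in \<open>auto simp: lookup_add lookup_minus lookup_single when_def\<close>)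
  then have *: "single (m - ?e + n) (of_nat (lookup m j) * c)
      = single (m + n - ?e) (of_nat (lookup m j) * c)"
    for m n :: "'n \<Rightarrow>\<^sub>0 nat" and c :: complex
    by (cases "lookup m j = 0") auto
  show ?thesis
    using *[of m n "c * d"] *[of n m "c * d"]
    by (simp add: mult_single pdiff_single lookup_add algebra_simps single_add)
qed

lemma pdiff_mult:
  fixes f g :: "'n cpoly"
  shows "pdiff j (f * g) = f * pdiff j g + g * pdiff j f"
proof (induction f rule: poly_mapping_induct_single)
  case (single m c)
  show ?case
  proof (induction g rule: poly_mapping_induct_single)
    case (single n d)
    show ?case by (rule pdiff_mult_single)
  qed (simp_all add: pdiff_add algebra_simps)
qed (simp_all add: pdiff_add algebra_simps)

lemma pdiff_Const [simp]: "pdiff j (Const c) = 0"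
  by (simp add: Const_def pdiff_single)

lemma pdiff_Var: "pdiff j (Var i) = (if i = j then 1 else 0)"
  by (auto simp: Var_def pdiff_single lookup_single single_one)

lemma pdiff_uminus: "pdiff j (- f) = - pdiff j f"
  by (metis add_eq_0_iff pdiff_0 pdiff_add)

lemma pdiff_diff: "pdiff j (f - g) = pdiff j f - pdiff j g"
  by (metis diff_add_cancel pdiff_add add_diff_cancel)

lemma pdiff_sum: "pdiff j (sum f A) = (\<Sum>i\<in>A. pdiff j (f i))"
  by (induction A rule: infinite_finite_induct) (simp_all add: pdiff_add)

lemma pdiff_1 [simp]: "pdiff j 1 = 0"
  using pdiff_Const[of j 1] by simp

lemmas pdiff_simps = pdiff_add pdiff_mult pdiff_uminus pdiff_diff pdiff_sum pdiff_Var

lemma pdiff_poly_subst: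
  "pdiff j (poly_subst g f) = (\<Sum>i\<in>UNIV. poly_subst g (pdiff i f) * pdiff j (g i))"
proof (induction f rule: cpoly_induct)
  case (Var k)
  have "(\<Sum>i\<in>UNIV. poly_subst g (pdiff i (Var k)) * pdiff j (g i)) = (\<Sum>i\<in>UNIV. if i = k then pdiff j (g k) else 0)"
    by (intro sum.cong) (auto simp: pdiff_Var)
  then show ?case by simp
qed (simp_all add: poly_subst_simps pdiff_simps sum.distrib sum_distrib_left algebra_simps)

lemma pdiff_commute:
  fixes f :: "'n::finite cpoly"
  shows "pdiff i (pdiff j f) = pdiff j (pdiff i f)"
  by (induction f rule: cpoly_induct) (simp_all add: pdiff_simps algebra_simps if_distrib)

lemma has_field_derivative_pev_line:
  "((\<lambda>t. pev f (x + t *s y)) has_field_derivative (\<Sum>j\<in>UNIV. pev (pdiff j f) (x + t *s y) * y $ j)) (at t)"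
proof (induction f rule: cpoly_induct)
  case (Var k)
  have "(\<Sum>j\<in>UNIV. pev (pdiff j (Var k)) (x + t *s y) * y $ j) = (\<Sum>j\<in>UNIV. if j = k then y $ k else 0)"
    by (intro sum.cong) (auto simp: pdiff_Var)
  then show ?case by (auto intro!: derivative_eq_intros)
next
  case (add f g)
  from DERIV_add[OF this] show ?case
    by (simp add: pev_simps pdiff_simps sum.distrib algebra_simps)
next
  case (mult f g)
  from DERIV_mult[OF this] show ?case
    by (simp add: pev_simps pdiff_simps sum.distrib sum_distrib_left sum_distrib_right algebra_simps)
qed simp

text \<open>Restriction to lines makes the fundamental theorem of algebra and the finiteness of the
  set of roots available in several variables.\<close>

lemma pev_line_poly: "\<exists>P. \<forall>t. pev f (x + t *s y) = poly P t"
proof (induction f rule: cpoly_induct)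
  case (Const c)
  show ?case by (rule exI[of _ "[:c:]"]) simp
next
  case (Var j)
  show ?case by (rule exI[of _ "[:x $ j, y $ j:]"]) simp
next
  case (add f g)
  then obtain P Q where "\<forall>t. pev f (x + t *s y) = poly P t" "\<forall>t. pev g (x + t *s y) = poly Q t" by blast
  then show ?case by (intro exI[of _ "P + Q"]) (simp add: pev_simps)
next
  case (mult f g)
  then obtain P Q where "\<forall>t. pev f (x + t *s y) = poly P t" "\<forall>t. pev g (x + t *s y) = poly Q t" by blast
  then show ?case by (intro exI[of _ "P * Q"]) (simp add: pev_simps)
qed

lemma pev_root_on_line:
  assumes "pev f x \<noteq> pev f y"
  obtains t where "pev f (x + t *s (y - x)) = 0"
proof -
  obtain P where P: "\<And>t. pev f (x + t *s (y - x)) = poly P t"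
    using pev_line_poly by metis
  have "poly P 0 \<noteq> poly P 1"
    using assms P[of 0] P[of 1] by simp
  then have "\<not> constant (poly P)"
    unfolding constant_def by blast
  then obtain t where "poly P t = 0"
    using fundamental_theorem_of_algebra by blast
  with P that show ?thesis by metis
qed

lemma pev_line_0:
  assumes "\<And>t. t \<noteq> 0 \<Longrightarrow> pev f (x + t *s y) = 0"
  shows "pev f x = 0"
proof -
  obtain P where P: "\<And>t. pev f (x + t *s y) = poly P t"
    using pev_line_poly by metis
  have "P = 0"
  proof (rule ccontr)
    assume "P \<noteq> 0"
    then have "finite {t. poly P t = 0}" by (rule poly_roots_finite)
    moreover have "UNIV - {0} \<subseteq> {t. poly P t = 0}" using assms P by auto
    ultimately have "finite (UNIV :: complex set)" by (metis finite_Diff_insert finite_subset finite.emptyI finite_Diff2 finite_insert)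
    then show False using infinite_UNIV_char_0 by blast
  qed
  then show ?thesis using P[of 0] by simp
qed

text \<open>The numerical factor is nonzero, so iterated partial derivatives recover all
  coefficients.\<close>

lemma lookup_pdiff:
  fixes f :: "'n cpoly"
  shows "lookup (pdiff j f) m
    = of_nat (Suc (lookup m j)) * lookup f (m + single j 1)"
proof (induction f rule: poly_mapping_induct_single)
  case (single n c)
  let ?e = "single j (1::nat)"
  show ?case
  proof (cases "lookup n j = 0")
    case True
    then have "n \<noteq> m + ?e"
      by (metis add_is_0 lookup_add lookup_single_eq one_neq_zero)
    with True show ?thesis
      by (simp add: pdiff_single lookup_single when_def)
  next
    case False
    have eq: "n - ?e = m \<longleftrightarrow> n = m + ?e"
    proof
      assume m: "n - ?e = m"
      show "n = m + ?e"
        by (rule poly_mapping_eqI) (use False in \<open>auto simp: m[symmetric] lookup_add lookup_minus lookup_single when_def\<close>)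
    qed simp
    show ?thesis
      unfolding pdiff_single lookup_single eq by (simp add: when_def lookup_add)
  qed
qed (simp_all add: pdiff_add lookup_add algebra_simps)

lemma pev_at_0: "pev f 0 = lookup f 0"
proof -
  have "(\<Prod>i\<in>UNIV. (0 :: complex) ^ lookup m i) = (if m = 0 then 1 else 0)" for m :: "'a \<Rightarrow>\<^sub>0 nat"
  proof (cases "m = 0")
    case False
    then obtain i where "lookup m i \<noteq> 0"
      by (metis lookup_zero poly_mapping_eqI)
    then have "\<exists>i\<in>UNIV. (0 :: complex) ^ lookup m i = 0"
      by (intro bexI[of _ i]) auto
    then show ?thesis using False by (simp add: prod_zero)
  qed simp
  then have "pev f 0 = (\<Sum>m\<in>keys f. if m = 0 then lookup f 0 else 0)"
    unfolding pev_def by (intro sum.cong) auto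
  then show ?thesis
    by (simp add: in_keys_iff)
qed

lemma exponent_induct [case_names zero add]:
  fixes m :: "'n::finite \<Rightarrow>\<^sub>0 nat"
  assumes "P 0" and "\<And>m j. P m \<Longrightarrow> P (m + single j 1)"
  shows "P m"
proof (induction "\<Sum>i\<in>UNIV. lookup m i" arbitrary: m rule: less_induct)
  case less
  show ?case
  proof (cases "m = 0")
    case False
    then obtain j where j: "lookup m j \<noteq> 0"
      by (metis lookup_zero poly_mapping_eqI)
    let ?e = "single j (1::nat)"
    have m: "m = (m - ?e) + ?e"
      by (rule poly_mapping_eqI) (use j in \<open>auto simp: lookup_add lookup_minus lookup_single when_def\<close>)
    have "(\<Sum>i\<in>UNIV. lookup (m - ?e) i) < (\<Sum>i\<in>UNIV. lookup m i)"
      by (rule sum_strict_mono_ex1) (use j in \<open>auto simp: lookup_minus lookup_single when_def\<close>)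
    then have "P (m - ?e)" by (rule less)
    from assms(2)[OF this] show ?thesis using m by metis
  qed (simp add: assms)
qed

lemma pev_pdiff_eq_0:
  assumes "\<And>x. pev f x = 0"
  shows "pev (pdiff j f) x = 0"
proof -
  have "((\<lambda>t. pev f (x + t *s axis j 1)) has_field_derivative (\<Sum>k\<in>UNIV. pev (pdiff k f) (x + 0 *s axis j 1) * axis j 1 $ k)) (at 0)"
    by (rule has_field_derivative_pev_line)
  then have "((\<lambda>t. 0) has_field_derivative pev (pdiff j f) x) (at 0)"
    by (simp add: assms axis_def if_distrib cong: if_cong)
  from DERIV_unique[OF this DERIV_const] show ?thesis .
qed

text \<open>The constant coefficient is the value at 0. The other coefficients are, up to nonzero
  factors, constant coefficients of iterated derivatives, which vanish everywhere as well.\<close>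

lemma pev_eq_0_imp:
  fixes f :: "'n::finite cpoly"
  assumes "\<And>x. pev f x = 0"
  shows "f = 0"
proof (rule poly_mapping_eqI)
  fix m
  show "lookup f m = lookup 0 m"
    using assms
  proof (induction m arbitrary: f rule: exponent_induct)
    case zero
    then show ?case by (metis pev_at_0 lookup_zero)
  next
    case (add m j)
    have "lookup (pdiff j f) m = 0"
      using add.IH[of "pdiff j f"] pev_pdiff_eq_0[OF add.prems] by simp
    then show ?case
      unfolding lookup_pdiff lookup_zero by (metis mult_eq_0_iff of_nat_eq_0_iff nat.distinct(1))
  qed
qed

lemma pev_eqI: "(\<And>x. pev f x = pev g x) \<Longrightarrow> f = g"
  using pev_eq_0_imp[of "f - g"] by (simp add: pev_simps)

lemma pdiff_all_0_imp_Const: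
  fixes f :: "'n::finite cpoly"
  assumes "\<And>j. pdiff j f = 0"
  shows "\<exists>c. f = Const c"
proof (intro exI poly_mapping_eqI)
  fix m
  show "lookup f m = lookup (Const (lookup f 0)) m"
  proof (induction m rule: exponent_induct)
    case (add m j)
    have "m + single j 1 \<noteq> (0 :: 'n \<Rightarrow>\<^sub>0 nat)"
      by (metis add_is_0 lookup_add lookup_single_eq lookup_zero one_neq_zero)
    moreover have "lookup f (m + single j 1) = 0"
      using lookup_pdiff[of j f m] assms[of j] by (metis lookup_zero mult_eq_0_iff of_nat_eq_0_iff nat.distinct(1))
    ultimately show ?case
      by (metis Const_def lookup_single_not_eq)
  qed (simp add: Const_def)
qed

lemma pev_nonzero_ex:
  fixes f :: "'n::finite cpoly"
  assumes "f \<noteq> 0"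
  obtains x where "pev f x \<noteq> 0"
  using assms pev_eq_0_imp by blast

section \<open>Vector fields and linear forms\<close>

definition vder :: "'n::finite cpoly^'n \<Rightarrow> 'n cpoly \<Rightarrow> 'n cpoly" where
  "vder a f = (\<Sum>j\<in>UNIV. a $ j * pdiff j f)"

lemma pev_numeral [simp]: "pev (numeral k) x = numeral k"
  using pev_of_nat[of "numeral k" x] by simp

lemma vder_add: "vder a (f + g) = vder a f + vder a g"
  and vder_mult: "vder a (f * g) = f * vder a g + g * vder a f"
  and vder_Const [simp]: "vder a (Const c) = 0"
  by (simp_all add: vder_def pdiff_simps sum.distrib sum_distrib_left algebra_simps)

lemma vder_Var [simp]: "vder a (Var j) = a $ j"
proof -
  have "vder a (Var j) = (\<Sum>i\<in>UNIV. if i = j then a $ j else 0)"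
    unfolding vder_def by (intro sum.cong) (auto simp: pdiff_Var)
  then show ?thesis by simp
qed

lemma vder_sum: "vder a (sum f A) = (\<Sum>i\<in>A. vder a (f i))"
  by (simp add: vder_def pdiff_sum sum_distrib_left) (rule sum.swap)

lemma vder_prod:
  assumes "finite A"
  shows "vder a (prod f A) = (\<Sum>i\<in>A. vder a (f i) * prod f (A - {i}))"
  using assms
proof (induction rule: finite_induct)
  case empty
  show ?case using vder_Const[of a 1] by simp
next
  case (insert x F)
  have "(\<Sum>i\<in>F. vder a (f i) * prod f (insert x F - {i})) = (\<Sum>i\<in>F. f x * (vder a (f i) * prod f (F - {i})))"
  proof (rule sum.cong[OF refl])
    fix i assume i: "i \<in> F"
    with insert have "insert x F - {i} = insert x (F - {i})" by auto
    with insert show "vder a (f i) * prod f (insert x F - {i}) = f x * (vder a (f i) * prod f (F - {i}))"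
      by (simp add: algebra_simps)
  qed
  moreover have "insert x F - {x} = F" using insert by auto
  ultimately show ?case
    using insert by (simp add: vder_mult sum_distrib_left algebra_simps)
qed

lemma vder_of_int_mult: "vder a (of_int k * f) = of_int k * vder a f"
proof -
  have "of_int k = Const (of_int k)" by (simp add: Const_def)
  then have "vder a (of_int k) = 0" by (metis vder_Const)
  then show ?thesis by (simp add: vder_mult)
qed

lemma vder_poly_subst: "vder a (poly_subst g f) = (\<Sum>i\<in>UNIV. poly_subst g (pdiff i f) * vder a (g i))"
  unfolding vder_def pdiff_poly_subst sum_distrib_left by (subst sum.swap) (simp add: algebra_simps)

lemma vder_det:
  fixes A :: "'n::finite cpoly^'m::finite^'m"
  shows "vder a (det A) = (\<Sum>k\<in>UNIV. det (\<chi> i. if i = k then (\<chi> j. vder a (A $ k $ j)) else A $ i))"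
proof -
  have "vder a (\<Prod>i\<in>UNIV. A $ i $ p i)
      = (\<Sum>k\<in>UNIV. \<Prod>i\<in>UNIV. (if i = k then (\<chi> j. vder a (A $ k $ j)) else A $ i) $ p i)" for p
  proof -
    have "(\<Prod>i\<in>UNIV. (if i = k then (\<chi> j. vder a (A $ k $ j)) else A $ i) $ p i)
        = vder a (A $ k $ p k) * (\<Prod>i\<in>UNIV - {k}. A $ i $ p i)" for k
      by (subst prod.remove[of _ k]) (auto intro!: prod.cong)
    then show ?thesis by (simp add: vder_prod)
  qed
  then show ?thesis
    by (simp add: det_def vder_sum vder_of_int_mult sum_distrib_left) (rule sum.swap)
qed

section \<open>Pointwise gradients and the bilinear form\<close>

definition evm :: "'n::finite cpoly^'k^'m \<Rightarrow> complex^'n \<Rightarrow> complex^'k^'m" where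
  "evm A x = (\<chi> i j. pev (A $ i $ j) x)"

lemma evm_nth [simp]: "evm A x $ i $ j = pev (A $ i $ j) x"
  by (simp add: evm_def)

lemma pev_det: "pev (det A) x = det (evm A x)"
  by (simp add: det_def pev_simps)

text \<open>The form is bilinear and not Hermitian, so nonzero isotropic vectors exist; real vectors
  are not among them.\<close>

definition cdot :: "complex^'n::finite \<Rightarrow> complex^'n \<Rightarrow> complex" where
  "cdot x y = (\<Sum>i\<in>UNIV. x $ i * y $ i)"

lemma cdot_commute: "cdot x y = cdot y x"
  by (simp add: cdot_def mult.commute)

lemma cdot_add [simp]: "cdot x (y + z) = cdot x y + cdot x z" "cdot (x + y) z = cdot x z + cdot y z"
  and cdot_diff [simp]: "cdot x (y - z) = cdot x y - cdot x z" "cdot (x - y) z = cdot x z - cdot y z"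
  and cdot_scale [simp]: "cdot x (c *s y) = c * cdot x y" "cdot (c *s x) y = c * cdot x y"
  and cdot_0 [simp]: "cdot x 0 = 0" "cdot 0 x = 0"
  by (simp_all add: cdot_def sum.distrib sum_subtractf sum_distrib_left algebra_simps)

lemma cdot_axis [simp]: "cdot x (axis i 1) = x $ i" "cdot (axis i 1) x = x $ i"
proof -
  have "(\<Sum>j\<in>UNIV. x $ j * axis i 1 $ j) = (\<Sum>j\<in>UNIV. if j = i then x $ i else 0)"
    by (intro sum.cong) (auto simp: axis_def)
  then show "cdot x (axis i 1) = x $ i" by (simp add: cdot_def)
  then show "cdot (axis i 1) x = x $ i" by (simp only: cdot_commute)
qed

lemma cdot_eq_0_imp: "(\<And>y. cdot x y = 0) \<Longrightarrow> x = 0"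
  by (metis cdot_axis(1) vec_eq_iff zero_index)

lemma matrix_vector_cdot: "A *v x = (\<chi> i. cdot (A $ i) x)"
  by (simp add: matrix_vector_mult_def cdot_def)

definition grad :: "'n::finite cpoly \<Rightarrow> complex^'n \<Rightarrow> complex^'n" where
  "grad f x = (\<chi> j. pev (pdiff j f) x)"

lemma grad_nth [simp]: "grad f x $ j = pev (pdiff j f) x"
  by (simp add: grad_def)

lemma grad_mult: "grad (f * g) x = pev f x *s grad g x + pev g x *s grad f x"
  and grad_Const [simp]: "grad (Const c) x = 0"
  and grad_1 [simp]: "grad 1 x = 0"
  and grad_Var [simp]: "grad (Var j) x = axis j 1"
  by (simp_all add: vec_eq_iff pdiff_simps pev_simps axis_def)

lemma grad_sum: "grad (sum f A) x = (\<Sum>i\<in>A. grad (f i) x)"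
  by (simp add: vec_eq_iff pdiff_simps pev_simps)

lemma pev_vder: "pev (vder a f) x = cdot (\<chi> j. pev (a $ j) x) (grad f x)"
  by (simp add: vder_def cdot_def pev_simps)

lemma grad_poly_subst: "grad (poly_subst g f) x = (\<Sum>i\<in>UNIV. pev (poly_subst g (pdiff i f)) x *s grad (g i) x)"
  by (simp add: vec_eq_iff pdiff_poly_subst pev_simps)

definition cvec :: "complex^'n \<Rightarrow> 'n cpoly^'n" where
  "cvec a = (\<chi> j. Const (a $ j))"

lemma pev_vder_cvec: "pev (vder (cvec a) f) x = cdot a (grad f x)"
  by (simp add: pev_vder cvec_def)

section \<open>Divisibility by linear forms\<close>

definition lform :: "complex^'n::finite \<Rightarrow> 'n cpoly" where
  "lform a = (\<Sum>j\<in>UNIV. Const (a $ j) * Var j)"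

lemma pev_lform [simp]: "pev (lform a) x = cdot a x"
  by (simp add: lform_def pev_simps cdot_def)

lemma pdiff_lform: "pdiff j (lform a) = Const (a $ j)"
proof -
  have "pdiff j (lform a) = (\<Sum>i\<in>UNIV. if i = j then Const (a $ j) else 0)"
    unfolding lform_def pdiff_sum by (intro sum.cong) (auto simp: pdiff_simps)
  then show ?thesis by simp
qed

lemma grad_lform [simp]: "grad (lform a) x = a"
  by (simp add: vec_eq_iff pdiff_lform)

lemma lform_eq_0_iff [simp]: "lform a = 0 \<longleftrightarrow> a = 0"
  by (metis grad_lform lform_def pdiff_0 pev_0 grad_def vec_eq_iff grad_nth zero_index pev_lform cdot_eq_0_imp cdot_0(2) pev_eqI)

text \<open>\<open>h\<close> is the projection onto the hyperplane \<open>cdot a x = 0\<close> along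
  a coordinate axis not contained in it. Substituting \<open>h\<close> is restriction to the
  hyperplane, with the ideal of \<open>lform a\<close> as its kernel.\<close>

lemma lform_reduction:
  fixes a :: "complex^'n::finite"
  assumes "a \<noteq> 0"
  obtains h where "\<And>f. lform a dvd f \<longleftrightarrow> poly_subst h f = 0"
    and "\<And>x. cdot a (\<chi> i. pev (h i) x) = 0" and "\<And>x. cdot a x = 0 \<Longrightarrow> (\<chi> i. pev (h i) x) = x"
proof -
  obtain k where k: "a $ k \<noteq> 0" using assms by (auto simp: vec_eq_iff)
  define h :: "'n \<Rightarrow> 'n cpoly" where
    "h = (\<lambda>i. if i = k then Var k - Const (1 / a $ k) * lform a else Var i)"
  have hx: "(\<chi> i. pev (h i) x) = x - (cdot a x / a $ k) *s axis k 1" for x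
    by (simp add: vec_eq_iff h_def pev_simps axis_def)
  have dot: "cdot a (\<chi> i. pev (h i) x) = 0" for x
    unfolding hx using k by simp
  have "lform a dvd f \<longleftrightarrow> poly_subst h f = 0" for f
  proof
    assume "lform a dvd f"
    then obtain g where "f = lform a * g" ..
    moreover have "poly_subst h (lform a) = 0"
      by (rule pev_eqI) (simp add: pev_poly_subst dot)
    ultimately show "poly_subst h f = 0" by (simp add: poly_subst_mult)
  next
    have "lform a dvd poly_subst Var f - poly_subst h f"
      by (rule dvd_poly_subst_diff) (simp add: h_def)
    moreover assume "poly_subst h f = 0"
    ultimately show "lform a dvd f" by simp
  qed
  then show ?thesis using that dot by (simp add: hx)
qed

lemma lform_dvdI:
  assumes "a \<noteq> 0" and "\<And>x. cdot a x = 0 \<Longrightarrow> pev f x = 0"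
  shows "lform a dvd f"
proof -
  obtain h where h: "\<And>f. lform a dvd f \<longleftrightarrow> poly_subst h f = 0" "\<And>x. cdot a (\<chi> i. pev (h i) x) = 0"
    using lform_reduction[OF assms(1)] by metis
  show ?thesis
    unfolding h by (rule pev_eqI) (simp add: pev_poly_subst h assms)
qed

lemma lform_dvd_iff:
  assumes "a \<noteq> 0"
  shows "lform a dvd f \<longleftrightarrow> (\<forall>x. cdot a x = 0 \<longrightarrow> pev f x = 0)"
  using lform_dvdI[OF assms] by (auto simp: pev_mult elim!: dvdE)

text \<open>Linear forms are prime: restriction to the hyperplane is a homomorphism into
  \<open>'n cpoly\<close>, which is an integral domain by virtue of the linear order on the index
  type.\<close>

lemma lform_dvd_mult:
  fixes f :: "'n::{finite,linorder} cpoly"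
  assumes "a \<noteq> 0" and "lform a dvd f * g"
  shows "lform a dvd f \<or> lform a dvd g"
  using lform_reduction[OF assms(1)] assms(2) by (metis mult_eq_0_iff poly_subst_mult)

lemma lform_dvd_prod:
  fixes f :: "'i \<Rightarrow> 'n::{finite,linorder} cpoly"
  assumes "a \<noteq> 0" "finite A" "lform a dvd prod f A"
  shows "\<exists>i\<in>A. lform a dvd f i"
  using assms(2,3)
proof (induction rule: finite_induct)
  case empty
  then show ?case using lform_dvd_iff[OF assms(1), of 1] by (auto dest: spec[of _ 0])
next
  case (insert x F)
  then show ?case using lform_dvd_mult[OF assms(1), of "f x" "prod f F"] by auto
qed

text \<open>The relation is not symmetric, since \<open>b = 0\<close> is allowed. For
  \<open>a \<noteq> 0\<close> its negation is linear independence of \<open>a\<close> and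
  \<open>b\<close>.\<close>

definition proportional :: "complex^'n \<Rightarrow> complex^'n \<Rightarrow> bool" where
  "proportional a b \<longleftrightarrow> (\<exists>c. b = c *s a)"

lemma lform_dvd_lform:
  assumes "a \<noteq> 0" "lform a dvd lform b"
  shows "proportional a b"
proof -
  obtain k where k: "a $ k \<noteq> 0" using assms by (auto simp: vec_eq_iff)
  have "b = (b $ k / a $ k) *s a"
  proof -
    have "b $ j = b $ k / a $ k * a $ j" for j
    proof -
      have "cdot a (axis j 1 - (a $ j / a $ k) *s axis k 1) = 0" using k by simp
      then have "cdot b (axis j 1 - (a $ j / a $ k) *s axis k 1) = 0"
        using assms lform_dvd_iff[of a "lform b"] by (metis pev_lform)
      then show ?thesis by simp
    qed
    then show ?thesis by (metis vec_eq_iff vector_smult_component)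
  qed
  then show ?thesis unfolding proportional_def ..
qed

text \<open>Pairwise nonproportional linear forms are nonassociated primes, so they can be split off
  one after the other.\<close>

lemma prod_lform_dvd:
  fixes f :: "'n::{finite,linorder} cpoly"
  assumes "finite R" and "\<And>r. r \<in> R \<Longrightarrow> b r \<noteq> 0"
    and "\<And>r s. r \<in> R \<Longrightarrow> s \<in> R \<Longrightarrow> r \<noteq> s \<Longrightarrow> \<not> proportional (b r) (b s)"
    and "\<And>r. r \<in> R \<Longrightarrow> lform (b r) dvd f"
  shows "(\<Prod>r\<in>R. lform (b r)) dvd f"
  using assms
proof (induction R arbitrary: f rule: finite_induct)
  case (insert x F)
  have "(\<Prod>r\<in>F. lform (b r)) dvd f" using insert by simp
  then obtain g where g: "f = (\<Prod>r\<in>F. lform (b r)) * g" ..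
  have "\<not> lform (b x) dvd (\<Prod>r\<in>F. lform (b r))"
  proof
    assume "lform (b x) dvd (\<Prod>r\<in>F. lform (b r))"
    then obtain s where "s \<in> F" "lform (b x) dvd lform (b s)"
      using lform_dvd_prod[of "b x" F "\<lambda>r. lform (b r)"] insert by auto
    moreover from this insert have "proportional (b x) (b s)" by (intro lform_dvd_lform) auto
    ultimately show False using insert by (metis insertI1 insertI2)
  qed
  then have "lform (b x) dvd g"
    using lform_dvd_mult[of "b x" "\<Prod>r\<in>F. lform (b r)" g] g insert by auto
  then show ?case using insert g by (auto simp: mult.commute intro: mult_dvd_mono)
qed simp

section \<open>Zeros and interpolation at points in general position\<close>

lemma common_nonzero:
  fixes f :: "'i \<Rightarrow> 'n::{finite,linorder} cpoly"
  assumes "finite A" "\<And>i. i \<in> A \<Longrightarrow> f i \<noteq> 0"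
  obtains x where "\<And>i. i \<in> A \<Longrightarrow> pev (f i) x \<noteq> 0"
proof -
  have "prod f A \<noteq> 0" using assms by simp
  then obtain x where "pev (prod f A) x \<noteq> 0" using pev_nonzero_ex by blast
  then have "pev (f i) x \<noteq> 0" if "i \<in> A" for i using that assms by (auto simp: pev_prod)
  then show ?thesis using that by blast
qed

text \<open>A general line misses finitely many subspaces of codimension two, and a line on which
  \<open>q\<close> is not constant contains a zero of \<open>q\<close>.\<close>

lemma nonunit_zero_off_codim2:
  fixes q :: "'n::{finite,linorder} cpoly"
  assumes q: "\<And>c. q \<noteq> Const c" and fin: "finite P"
    and ind: "\<And>a b. (a, b) \<in> P \<Longrightarrow> a \<noteq> 0 \<and> \<not> proportional a b"
  obtains z where "pev q z = 0" "\<And>a b. (a, b) \<in> P \<Longrightarrow> cdot a z \<noteq> 0 \<or> cdot b z \<noteq> 0"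
proof -
  obtain x where x: "\<And>r. r \<in> P \<Longrightarrow> pev (lform (fst r)) x \<noteq> 0"
    using common_nonzero[OF fin, of "\<lambda>r. lform (fst r)"] ind by (metis lform_eq_0_iff prod.collapse)
  \<comment> \<open>\<open>cdot (e r) y\<close> is the 2 by 2 determinant of the values of the pair
    of forms at \<open>x\<close> and \<open>y\<close>. It vanishes if the line through
    \<open>x\<close> and \<open>y\<close> meets their common zero set.\<close>
  define e where "e = (\<lambda>r :: (complex, 'n) vec \<times> (complex, 'n) vec. cdot (fst r) x *s snd r - cdot (snd r) x *s fst r)"
  have e0: "e r \<noteq> 0" if "r \<in> P" for r
  proof
    assume "e r = 0"
    then have "snd r = (cdot (snd r) x / cdot (fst r) x) *s fst r"
      using x[OF that] by (simp add: e_def vec_eq_iff field_simps)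
    then show False using ind[of "fst r" "snd r"] that unfolding proportional_def by auto
  qed
  have "(q - Const (pev q x)) * (\<Prod>r\<in>P. lform (e r)) \<noteq> 0"
    using fin e0 q by simp
  then obtain y where y: "pev ((q - Const (pev q x)) * (\<Prod>r\<in>P. lform (e r))) y \<noteq> 0"
    using pev_nonzero_ex by blast
  then have "pev q x \<noteq> pev q y" by (auto simp: pev_simps)
  then obtain t where t: "pev q (x + t *s (y - x)) = 0"
    by (rule pev_root_on_line)
  have "cdot a (x + t *s (y - x)) \<noteq> 0 \<or> cdot b (x + t *s (y - x)) \<noteq> 0" if ab: "(a, b) \<in> P" for a b
  proof (rule ccontr)
    assume "\<not> ?thesis"
    then have *: "cdot a x + t * (cdot a y - cdot a x) = 0" "cdot b x + t * (cdot b y - cdot b x) = 0" by (simp_all add: algebra_simps)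
    have "cdot a x * cdot b y - cdot b x * cdot a y \<noteq> 0"
      using y fin ab by (auto simp: pev_simps e_def)
    moreover have "t * (cdot a x * cdot b y - cdot b x * cdot a y) = 0" "(1 - t) * (cdot a x * cdot b y - cdot b x * cdot a y) = 0"
      using * by algebra+
    ultimately show False by auto
  qed
  with t that show ?thesis by blast
qed

text \<open>Since \<open>q\<close> does not vanish identically on any of the hyperplanes, there is a
  line, transversal to all of them, that meets them outside the zeros of \<open>q\<close> and on
  which \<open>q\<close> is not constant. A zero of \<open>q\<close> on this line is as
  required.\<close>

lemma nonunit_zero_off_hyperplanes:
  fixes q :: "'n::{finite,linorder} cpoly"
  assumes q: "\<And>c. q \<noteq> Const c" and fin: "finite R"
    and b: "\<And>r. r \<in> R \<Longrightarrow> b r \<noteq> 0" and nd: "\<And>r. r \<in> R \<Longrightarrow> \<not> lform (b r) dvd q"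
  obtains z where "pev q z = 0" "\<And>r. r \<in> R \<Longrightarrow> cdot (b r) z \<noteq> 0"
proof -
  have "(q - Const (pev q 0)) * (\<Prod>r\<in>R. lform (b r)) \<noteq> 0"
    using fin b q by simp
  then obtain y where y: "pev ((q - Const (pev q 0)) * (\<Prod>r\<in>R. lform (b r))) y \<noteq> 0"
    using pev_nonzero_ex by blast
  then have y1: "pev q y \<noteq> pev q 0" and y2: "\<And>r. r \<in> R \<Longrightarrow> cdot (b r) y \<noteq> 0"
    using fin by (auto simp: pev_simps)
  \<comment> \<open>\<open>pr r\<close> is the projection along \<open>y\<close> onto the hyperplane
    of \<open>r\<close>: it sends \<open>x\<close> to the point where the line through
    \<open>x\<close> in direction \<open>y\<close> meets the hyperplane.\<close>
  define pr where "pr = (\<lambda>r i. Var i - Const (y $ i / cdot (b r) y) * lform (b r))"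
  have pr: "(\<chi> i. pev (pr r i) x) = x - (cdot (b r) x / cdot (b r) y) *s y" for r x
    by (simp add: pr_def pev_simps vec_eq_iff)
  \<comment> \<open>Where this difference is nonzero, \<open>q\<close> is not constant on the line
    in direction \<open>y\<close>.\<close>
  define q' where "q' = poly_subst (\<lambda>i. Var i + Const (y $ i)) q - q"
  have q': "pev q' x = pev q (x + y) - pev q x" for x
  proof -
    have "(\<chi> i. x $ i + y $ i) = x + y" by (simp add: vec_eq_iff)
    then show ?thesis by (simp add: q'_def pev_simps pev_poly_subst)
  qed
  have "q' \<noteq> 0" using q'[of 0] y1 by auto
  moreover have "poly_subst (pr r) q \<noteq> 0" if r: "r \<in> R" for r
  proof -
    obtain x where x: "cdot (b r) x = 0" "pev q x \<noteq> 0"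
      using nd[OF r] lform_dvdI[OF b[OF r]] by blast
    then have "pev (poly_subst (pr r) q) x \<noteq> 0" by (simp add: pev_poly_subst pr)
    then show ?thesis by auto
  qed
  ultimately have "q' * (\<Prod>r\<in>R. poly_subst (pr r) q) \<noteq> 0" using fin by simp
  then obtain x where "pev (q' * (\<Prod>r\<in>R. poly_subst (pr r) q)) x \<noteq> 0" using pev_nonzero_ex by blast
  then have x1: "pev q (x + y) \<noteq> pev q x" and x2: "\<And>r. r \<in> R \<Longrightarrow> pev q (x - (cdot (b r) x / cdot (b r) y) *s y) \<noteq> 0"
    using fin by (auto simp: pev_simps pev_poly_subst pr q')
  from x1 obtain t where "pev q (x + t *s (x + y - x)) = 0" using pev_root_on_line by metis
  then have t: "pev q (x + t *s y) = 0" by simp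
  have "cdot (b r) (x + t *s y) \<noteq> 0" if r: "r \<in> R" for r
  proof
    assume "cdot (b r) (x + t *s y) = 0"
    then have "t = - (cdot (b r) x / cdot (b r) y)" using y2[OF r] by (simp add: field_simps add_eq_0_iff)
    then have "x + t *s y = x - (cdot (b r) x / cdot (b r) y) *s y" by (simp add: vec_eq_iff)
    then show False using t x2[OF r] by simp
  qed
  with t that show ?thesis by blast
qed

lemma bump:
  fixes z :: "complex^'n::finite"
  assumes "finite F" "z \<notin> F"
  obtains f where "pev f z = 1" "grad f z = 0" "\<And>a. a \<in> F \<Longrightarrow> pev f a = 0" "\<And>a. a \<in> F \<Longrightarrow> grad f a = 0"
proof -
  have "\<exists>g. pev g z = 1 \<and> (\<forall>a\<in>F. pev g a = 0)"
    using assms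
  proof (induction rule: finite_induct)
    case empty
    show ?case by (rule exI[of _ 1]) simp
  next
    case (insert a F)
    then obtain g where g: "pev g z = 1" "\<forall>a\<in>F. pev g a = 0" by auto
    from insert obtain k where k: "z $ k \<noteq> a $ k" by (auto simp: vec_eq_iff)
    show ?case
      by (rule exI[of _ "g * (Const (1 / (z $ k - a $ k)) * (Var k - Const (a $ k)))"])
         (use g k in \<open>auto simp: pev_simps\<close>)
  qed
  then obtain g where g: "pev g z = 1" "\<And>a. a \<in> F \<Longrightarrow> pev g a = 0" by blast
  \<comment> \<open>The cubic \<open>3 g^2 - 2 g^3\<close> fixes 0 and 1 and has derivative
    \<open>6 g (1 - g)\<close>, so it keeps the interpolated values and kills the gradients.\<close>
  define f where "f = g * g * (Const 3 - Const 2 * g)"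
  have "grad f x = (6 * pev g x * (1 - pev g x)) *s grad g x" for x
    by (simp add: f_def vec_eq_iff pdiff_simps pev_simps algebra_simps)
  then show ?thesis
    using that[of f] g by (simp add: f_def pev_simps)
qed

section \<open>Finite orthogonal groups\<close>

type_synonym 'n cv = "(complex, 'n) vec"
type_synonym 'n rmat = "((real, 'n) vec, 'n) vec"

lemma det_eq_0_iff_kernel:
  fixes A :: "complex^'n::finite^'n"
  shows "det A = 0 \<longleftrightarrow> (\<exists>y. y \<noteq> 0 \<and> A *v y = 0)"
  using invertible_det_nz[of A] invertible_left_inverse[of A] matrix_left_invertible_ker[of A] by blast

definition act :: "real^'n::finite^'n \<Rightarrow> complex^'n \<Rightarrow> complex^'n" where
  "act w x = (\<chi> i. \<Sum>j\<in>UNIV. of_real (w $ i $ j) * x $ j)"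

lemma act_add: "act w (x + y) = act w x + act w y"
  and act_scale: "act w (c *s x) = c *s act w x"
  and act_0 [simp]: "act w 0 = 0"
  by (simp_all add: act_def vec_eq_iff sum.distrib sum_subtractf sum_distrib_left algebra_simps)

lemma act_sum: "act w (sum f A) = (\<Sum>i\<in>A. act w (f i))"
  by (induction A rule: infinite_finite_induct) (simp_all add: act_add)

lemma act_one [simp]: "act (mat 1) x = x"
proof -
  have "(\<Sum>j\<in>UNIV. of_real (mat 1 $ i $ j) * x $ j) = (\<Sum>j\<in>UNIV. if j = i then x $ i else 0)" for i
    by (intro sum.cong) (auto simp: mat_def)
  then show ?thesis by (simp add: act_def vec_eq_iff)
qed

lemma act_mult: "act (v ** w) x = act v (act w x)"
proof -
  have "(\<Sum>j\<in>UNIV. of_real ((v ** w) $ i $ j) * x $ j)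
      = (\<Sum>k\<in>UNIV. of_real (v $ i $ k) * (\<Sum>j\<in>UNIV. of_real (w $ k $ j) * x $ j))" for i
    unfolding matrix_matrix_mult_def sum_distrib_left
    by (subst sum.swap) (simp add: sum_distrib_left sum_distrib_right algebra_simps)
  then show ?thesis by (simp add: act_def)
qed

lemma cdot_act: "cdot (act w x) y = cdot x (act (transpose w) y)"
  unfolding cdot_def act_def
  by (simp add: transpose_def sum_distrib_left sum_distrib_right) (subst sum.swap, simp add: algebra_simps)

lemma act_transpose:
  assumes "orthogonal_matrix w"
  shows "act (transpose w) (act w x) = x" "act w (act (transpose w) x) = x"
  using assms by (simp_all add: orthogonal_matrix_def flip: act_mult)

lemma cdot_act_act: "orthogonal_matrix w \<Longrightarrow> cdot (act w x) (act w y) = cdot x y"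
  by (simp add: cdot_act act_transpose)

lemma act_axis: "act w (axis k 1) $ i = complex_of_real (w $ i $ k)"
proof -
  have "(\<Sum>j\<in>UNIV. complex_of_real (w $ i $ j) * axis k 1 $ j) = (\<Sum>j\<in>UNIV. if j = k then complex_of_real (w $ i $ k) else 0)"
    by (intro sum.cong) (auto simp: axis_def)
  then show ?thesis by (simp add: act_def)
qed

definition pact :: "real^'n::finite^'n \<Rightarrow> 'n cpoly \<Rightarrow> 'n cpoly" where
  "pact w f = poly_subst (\<lambda>i. \<Sum>j\<in>UNIV. Const (of_real (w $ i $ j)) * Var j) f"

lemma pev_pact: "pev (pact w f) x = pev f (act w x)"
  by (simp add: pact_def pev_poly_subst pev_simps act_def)

lemma pact_mult: "pact w (f * g) = pact w f * pact w g"
  and pact_sum: "pact w (sum h A) = (\<Sum>i\<in>A. pact w (h i))"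
  by (simp_all add: pact_def poly_subst_simps)

lemma pact_pact: "pact v (pact w f) = pact (w ** v) f"
  by (rule pev_eqI) (simp add: pev_pact act_mult)

lemma pdiff_pact: "pdiff j (pact w f) = (\<Sum>i\<in>UNIV. Const (of_real (w $ i $ j)) * pact w (pdiff i f))"
proof -
  have "pdiff j (\<Sum>k\<in>UNIV. Const (of_real (w $ i $ k)) * Var k) = Const (of_real (w $ i $ j))" for i
    using pdiff_lform[of j "\<chi> k. complex_of_real (w $ i $ k)"] by (simp add: lform_def)
  then show ?thesis
    by (simp add: pact_def pdiff_poly_subst mult.commute)
qed

lemma vder_cvec_pact: "vder (cvec a) (pact w f) = pact w (vder (cvec (act w a)) f)"
  by (rule pev_eqI) (simp add: pev_vder_cvec pev_pact grad_def pdiff_pact pev_simps cdot_def act_def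
      sum_distrib_left sum_distrib_right, subst sum.swap, simp add: algebra_simps)

lemma grad_pact: "grad (pact w f) x = act (transpose w) (grad f (act w x))"
  by (simp add: vec_eq_iff pdiff_pact pev_simps pev_pact act_def transpose_def)

lemma invariant_ring_iff: "f \<in> invariant_ring W \<longleftrightarrow> (\<forall>w\<in>W. pact w f = f)"
  by (simp add: invariant_ring_def pact_def)

definition rvec :: "real^'n \<Rightarrow> complex^'n" where
  "rvec a = (\<chi> i. complex_of_real (a $ i))"

lemma rvec_nth [simp]: "rvec a $ i = complex_of_real (a $ i)"
  by (simp add: rvec_def)

lemma cdot_rvec: "cdot (rvec a) (rvec b) = complex_of_real (a \<bullet> b)"
  by (simp add: cdot_def inner_vec_def)

text \<open>For a unit vector \<open>a\<close> this is the orthogonal reflection in the hyperplane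
  normal to \<open>a\<close>.\<close>

definition refl_matrix :: "real^'n::finite \<Rightarrow> real^'n^'n" where
  "refl_matrix a = (\<chi> i j. (if i = j then 1 else 0) - 2 * a $ i * a $ j)"

lemma act_refl_matrix: "act (refl_matrix a) x = x - (2 * cdot (rvec a) x) *s rvec a"
proof -
  have "(\<Sum>j\<in>UNIV. of_real ((if i = j then 1 else 0) - 2 * a $ i * a $ j) * x $ j)
      = (\<Sum>j\<in>UNIV. if j = i then x $ i else 0) - (\<Sum>j\<in>UNIV. 2 * rvec a $ i * (rvec a $ j * x $ j))" for i
    unfolding sum_subtractf[symmetric] by (intro sum.cong) (auto simp: algebra_simps)
  then show ?thesis
    by (simp add: act_def refl_matrix_def vec_eq_iff cdot_def sum_distrib_left algebra_simps)
qed

text \<open>The reason is that an orthogonal matrix that differs from the identity by a matrix of rank one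
  is a reflection.\<close>

lemma fixed_space_codim2:
  fixes w :: "real^'n::finite^'n"
  assumes orth: "orthogonal_matrix w" and w1: "w \<noteq> mat 1" and nr: "\<And>a. norm a = 1 \<Longrightarrow> w \<noteq> refl_matrix a"
  shows "\<exists>a b. a \<noteq> 0 \<and> \<not> proportional a b \<and> (\<forall>z. act w z = z \<longrightarrow> cdot a z = 0 \<and> cdot b z = 0)"
proof (rule ccontr)
  assume neg: "\<not> ?thesis"
  define r :: "'n \<Rightarrow> real^'n" where "r = (\<lambda>i. w $ i - axis i 1)"
  have rz: "cdot (rvec (r i)) z = act w z $ i - z $ i" for i z
  proof -
    have "rvec (r i) = rvec (w $ i) - axis i 1" by (auto simp: r_def vec_eq_iff axis_def)
    then show ?thesis by (simp add: act_def cdot_def[of "rvec (w $ i)"])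
  qed
  obtain i where i: "r i \<noteq> 0"
    using w1 by (auto simp: r_def vec_eq_iff mat_def axis_def) metis
  then obtain k where k: "r i $ k \<noteq> 0" by (auto simp: vec_eq_iff)
  have "rvec (r i) \<noteq> 0" using k by (auto simp: vec_eq_iff)
  \<comment> \<open>Every row of \<open>w - 1\<close> kills the fixed vectors. By the negated claim
    any row is then a multiple of a nonzero one, so \<open>w - 1\<close> has rank one.\<close>
  then have "proportional (rvec (r i)) (rvec (r j))" for j
    using neg rz by (metis cancel_comm_monoid_add_class.diff_cancel)
  then obtain c where c: "\<And>j. rvec (r j) = c j *s rvec (r i)"
    unfolding proportional_def by metis
  define a where "a = r i /\<^sub>R norm (r i)"
  have a1: "norm a = 1" using i by (simp add: a_def)
  define b where "b = (\<lambda>j. (r j $ k / r i $ k) * norm (r i))"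
  have rj: "r j $ m = b j * a $ m" for j m
  proof -
    have "c j = complex_of_real (r j $ k / r i $ k)"
      using arg_cong[OF c[of j], of "\<lambda>v. v $ k"] k by (simp add: field_simps)
    then have "complex_of_real (r j $ m) = complex_of_real (r j $ k / r i $ k * r i $ m)"
      using arg_cong[OF c[of j], of "\<lambda>v. v $ m"] by simp
    then have "r j $ m = r j $ k / r i $ k * r i $ m" by (simp only: of_real_eq_iff)
    then show ?thesis using i by (simp add: a_def b_def)
  qed
  have w: "w $ j $ m = (if j = m then 1 else 0) + b j * a $ m" for j m
    using rj[of j m] by (auto simp: r_def axis_def)
  have aa: "(\<Sum>m\<in>UNIV. a $ m * a $ m) = 1"
    using a1 by (simp add: norm_eq_1 inner_vec_def)
  \<comment> \<open>These are the entries of \<open>w w^T = 1\<close> for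
    \<open>w = 1 + b a^T\<close> with a unit vector \<open>a\<close>.\<close>
  have rel: "b j * a $ m + b m * a $ j + b j * b m = 0" for j m
  proof -
    have "(w ** transpose w) $ j $ m = (mat 1 :: real^'n^'n) $ j $ m"
      using orth by (simp add: orthogonal_matrix_def)
    then have "(\<Sum>k\<in>UNIV. w $ j $ k * w $ m $ k) = (if j = m then 1 else 0)"
      by (simp add: matrix_matrix_mult_def transpose_def mat_def)
    moreover have "w $ j $ k * w $ m $ k = (if k = j then (if k = m then 1 else 0) else 0)
        + (if k = j then b m * a $ j else 0) + (if k = m then b j * a $ m else 0) + b j * b m * (a $ k * a $ k)" for k
      unfolding w by (auto simp: algebra_simps)
    ultimately show ?thesis
      using aa by (simp add: sum.distrib flip: sum_distrib_left)
  qed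
  define t where "t = (\<Sum>m\<in>UNIV. a $ m * b m)"
  have bt: "b j * (1 + t) = - t * a $ j" for j
  proof -
    have "(\<Sum>m\<in>UNIV. a $ m * (b j * a $ m + b m * a $ j + b j * b m)) = 0" by (simp add: rel)
    then have "b j * (\<Sum>m\<in>UNIV. a $ m * a $ m) + a $ j * t + b j * t = 0"
      by (simp add: t_def sum.distrib sum_distrib_left algebra_simps)
    then show ?thesis using aa by (simp add: algebra_simps)
  qed
  have t1: "1 + t \<noteq> 0"
  proof
    assume "1 + t = 0"
    then have "a = 0" using bt by (auto simp: vec_eq_iff)
    then show False using a1 by simp
  qed
  define s where "s = - t / (1 + t)"
  have bs: "b j = s * a $ j" for j
    using bt[of j] t1 by (simp add: s_def field_simps)
  have "t = s" unfolding t_def bs using aa by (simp add: mult.left_commute flip: sum_distrib_left)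
  \<comment> \<open>Now \<open>w = 1 + s a a^T\<close>; the value \<open>s = 0\<close> gives the
    identity and \<open>s = -2\<close> the reflection in the hyperplane normal to
    \<open>a\<close>.\<close>
  then have "s * (s + 2) = 0" using t1 by (simp add: s_def field_simps)
  then consider "s = 0" | "s = - 2" by force
  then show False
  proof cases
    case 1
    then show False using w1 w bs by (simp add: vec_eq_iff mat_def)
  next
    case 2
    then have "w = refl_matrix a" using w bs by (simp add: vec_eq_iff refl_matrix_def)
    then show False using nr a1 by blast
  qed
qed

section \<open>Mirrors, stabilizers and orbit sums\<close>

locale orthogonal_group =
  fixes W :: "'n::{finite,linorder} rmat set"
  assumes finite_W: "finite W"
    and one_in: "mat 1 \<in> W"
    and mult_in: "v \<in> W \<Longrightarrow> w \<in> W \<Longrightarrow> v ** w \<in> W"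
    and transpose_in: "w \<in> W \<Longrightarrow> transpose w \<in> W"
    and orth: "w \<in> W \<Longrightarrow> orthogonal_matrix w"
begin

definition refls :: "'n rmat set" where
  "refls = {s \<in> W. \<exists>a. norm a = 1 \<and> s = refl_matrix a}"

text \<open>A unit normal of the mirror. It is determined up to sign, and it is real, so it is not
  isotropic.\<close>

definition root_vec :: "'n rmat \<Rightarrow> 'n cv" where
  "root_vec s = rvec (SOME a. norm a = 1 \<and> s = refl_matrix a)"

definition stab :: "'n cv \<Rightarrow> ('n rmat) set" where
  "stab z = {w \<in> W. act w z = z}"

abbreviation rform :: "'n rmat \<Rightarrow> 'n cpoly" where "rform s \<equiv> lform (root_vec s)"

lemma finite_refls: "finite refls"
  using finite_W by (simp add: refls_def)

lemma reflection_in: "s \<in> refls \<Longrightarrow> s \<in> W"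
  by (simp add: refls_def)

lemma reflectionE:
  assumes "s \<in> refls"
  obtains a where "norm a = 1" "s = refl_matrix a" "root_vec s = rvec a"
proof -
  define a where "a = (SOME a. norm a = 1 \<and> s = refl_matrix a)"
  have "norm a = 1 \<and> s = refl_matrix a"
    unfolding a_def by (rule someI_ex) (use assms in \<open>auto simp: refls_def\<close>)
  moreover have "root_vec s = rvec a" by (simp add: root_vec_def a_def)
  ultimately show ?thesis using that by blast
qed

lemma cdot_root: "s \<in> refls \<Longrightarrow> cdot (root_vec s) (root_vec s) = 1"
  by (elim reflectionE) (simp add: cdot_rvec norm_eq_1)

lemma root_nonzero: "s \<in> refls \<Longrightarrow> root_vec s \<noteq> 0"
  using cdot_root by fastforce

lemma act_reflection: "s \<in> refls \<Longrightarrow> act s x = x - (2 * cdot (root_vec s) x) *s root_vec s"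
  by (elim reflectionE) (simp add: act_refl_matrix)

lemma reflection_fixed_iff: "s \<in> refls \<Longrightarrow> act s x = x \<longleftrightarrow> cdot (root_vec s) x = 0"
  using root_nonzero by (auto simp: act_reflection)

lemma transpose_reflection: "s \<in> refls \<Longrightarrow> transpose s = s"
  by (elim reflectionE) (simp add: transpose_def refl_matrix_def vec_eq_iff mult.commute mult.left_commute)

lemma reflection_ne_one: "s \<in> refls \<Longrightarrow> s \<noteq> mat 1"
  by (metis act_one reflection_fixed_iff cdot_root zero_neq_one)

lemma roots_not_proportional:
  assumes s: "s \<in> refls" and t: "t \<in> refls" and "s \<noteq> t"
  shows "\<not> proportional (root_vec s) (root_vec t)"
proof
  assume "proportional (root_vec s) (root_vec t)"
  then obtain c where c: "root_vec t = c *s root_vec s" unfolding proportional_def ..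
  have c2: "c * c = 1" using cdot_root[OF t] cdot_root[OF s] by (simp add: c)
  have "act t x = act s x" for x
  proof -
    have "(2 * (c * cdot (root_vec s) x)) * c = 2 * cdot (root_vec s) x * (c * c)" by (simp only: algebra_simps)
    then show ?thesis
      using s t by (simp add: act_reflection c vector_smult_assoc c2)
  qed
  then have "complex_of_real (t $ i $ k) = complex_of_real (s $ i $ k)" for i k
    by (metis act_axis)
  then show False using \<open>s \<noteq> t\<close> by (simp add: vec_eq_iff)
qed

lemma one_in_stab: "mat 1 \<in> stab z"
  by (simp add: stab_def one_in)

definition generic :: "'n cv \<Rightarrow> bool" where
  "generic z \<longleftrightarrow> stab z = {mat 1} \<or> (\<exists>s\<in>refls. stab z = {mat 1, s})"

text \<open>The points that are not generic lie in finitely many subspaces of codimension at least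
  two, namely the fixed spaces of the elements other than 1 and the reflections, and the
  intersections of two mirrors.\<close>

lemma generic_zero:
  assumes q: "\<And>c. q \<noteq> Const c"
  obtains z where "pev q z = 0" "generic z"
proof -
  define Q where "Q = (\<lambda>(w :: 'n rmat) (a, b). a \<noteq> 0 \<and> \<not> proportional a b \<and> (\<forall>z. act w z = z \<longrightarrow> cdot a z = 0 \<and> cdot b z = (0 :: complex)))"
  have "\<exists>r. Q w r" if "w \<in> W - refls - {mat 1}" for w
    using fixed_space_codim2[of w] that orth unfolding Q_def refls_def by auto
  then obtain r where r: "\<And>w. w \<in> W - refls - {mat 1} \<Longrightarrow> Q w (r w)" by metis
  define P where "P = r ` (W - refls - {mat 1}) \<union> (\<lambda>(s, t). (root_vec s, root_vec t)) ` {(s, t). s \<in> refls \<and> t \<in> refls \<and> s \<noteq> t}"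
  have "finite {(s, t). s \<in> refls \<and> t \<in> refls \<and> s \<noteq> t}"
    by (rule finite_subset[of _ "refls \<times> refls"]) (auto simp: finite_refls)
  then have "finite P" unfolding P_def using finite_W by auto
  moreover have "a \<noteq> 0 \<and> \<not> proportional a b" if ab: "(a, b) \<in> P" for a b
  proof -
    from ab consider w where "w \<in> W - refls - {mat 1}" "(a, b) = r w"
      | s t where "s \<in> refls" "t \<in> refls" "s \<noteq> t" "a = root_vec s" "b = root_vec t"
      unfolding P_def by auto
    then show ?thesis
    proof cases
      case 1
      have "Q w (a, b)" using r[OF 1(1)] unfolding 1(2)[symmetric] .
      then show ?thesis by (simp add: Q_def)
    next
      case 2
      then show ?thesis using root_nonzero roots_not_proportional by auto
    qed
  qed
  ultimately obtain z where z: "pev q z = 0" "\<And>a b. (a, b) \<in> P \<Longrightarrow> cdot a z \<noteq> 0 \<or> cdot b z \<noteq> 0"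
    using nonunit_zero_off_codim2[OF q] by metis
  have 1: "w \<in> refls" if w: "w \<in> stab z" "w \<noteq> mat 1" for w
  proof (rule ccontr)
    assume "w \<notin> refls"
    with w have w': "w \<in> W - refls - {mat 1}" by (auto simp: stab_def)
    obtain a b where ab: "r w = (a, b)" by force
    with w' have "(a, b) \<in> P" unfolding P_def by force
    moreover have "cdot a z = 0 \<and> cdot b z = 0"
      using r[OF w'] w by (simp add: ab Q_def stab_def)
    ultimately show False using z by blast
  qed
  have 2: "s = t" if "s \<in> stab z" "t \<in> stab z" "s \<noteq> mat 1" "t \<noteq> mat 1" for s t
  proof (rule ccontr)
    assume "s \<noteq> t"
    have st: "s \<in> refls" "t \<in> refls" using 1 that by auto
    then have "(root_vec s, root_vec t) \<in> P" using \<open>s \<noteq> t\<close> unfolding P_def by (auto intro!: UnI2 image_eqI[of _ _ "(s, t)"])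
    moreover have "cdot (root_vec s) z = 0" "cdot (root_vec t) z = 0"
      using st that by (auto simp: stab_def reflection_fixed_iff)
    ultimately show False using z by blast
  qed
  have "stab z = {mat 1} \<or> (\<exists>s\<in>refls. stab z = {mat 1, s})"
  proof (cases "stab z = {mat 1}")
    case False
    then obtain s where "s \<in> stab z" "s \<noteq> mat 1" using one_in_stab by blast
    then have "stab z = {mat 1, s}" "s \<in> refls" using 1 2 one_in_stab by auto
    then show ?thesis by blast
  qed simp
  with z(1) that show ?thesis unfolding generic_def by blast
qed

text \<open>The root form is itself a nonconstant polynomial, and a generic zero of it has no room
  for further elements in its stabilizer.\<close>

lemma generic_on_hyperplane:
  assumes s: "s \<in> refls"
  obtains z where "cdot (root_vec s) z = 0" "stab z = {mat 1, s}"
proof -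
  have "rform s \<noteq> Const c" for c
    using pdiff_lform[of _ "root_vec s"] root_nonzero[OF s] by (metis Const_eq_0 pdiff_Const vec_eq_iff zero_index)
  then obtain z where z: "pev (rform s) z = 0" "generic z"
    using generic_zero by blast
  then have "s \<in> stab z" using s by (simp add: stab_def reflection_in reflection_fixed_iff)
  with z reflection_ne_one[OF s] have "stab z = {mat 1, s}" by (auto simp: generic_def)
  with z that show ?thesis by simp
qed

text \<open>The Reynolds operator without the factor \<open>1 / card W\<close>.\<close>

definition orbit_sum :: "'n cpoly \<Rightarrow> 'n cpoly" where
  "orbit_sum f = (\<Sum>w\<in>W. pact w f)"

lemma right_mult_bij: "v \<in> W \<Longrightarrow> bij_betw (\<lambda>w. w ** v) W W"
proof (rule bij_betw_byWitness[where f' = "\<lambda>w. w ** transpose v"])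
  assume v: "v \<in> W"
  then have "v ** transpose v = mat 1" "transpose v ** v = mat 1" using orth[OF v] by (simp_all add: orthogonal_matrix_def)
  then show "\<forall>a\<in>W. a ** v ** transpose v = a" "\<forall>a\<in>W. a ** transpose v ** v = a"
    by (simp_all flip: matrix_mul_assoc)
qed (auto intro: mult_in transpose_in)

lemma orbit_sum_invariant: "orbit_sum f \<in> invariant_ring W"
  unfolding invariant_ring_iff orbit_sum_def
proof
  fix v assume "v \<in> W"
  then show "pact v (\<Sum>w\<in>W. pact w f) = (\<Sum>w\<in>W. pact w f)"
    unfolding pact_sum pact_pact by (rule sum.reindex_bij_betw[OF right_mult_bij])
qed

definition orbit_bump :: "'n cv \<Rightarrow> 'n cpoly \<Rightarrow> bool" where
  "orbit_bump z f \<longleftrightarrow> pev f z = 1 \<and> grad f z = 0 \<and>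
     (\<forall>w\<in>W - stab z. pev f (act w z) = 0 \<and> grad f (act w z) = 0)"

lemma orbit_bump_exists: "\<exists>f. orbit_bump z f"
proof -
  have "z \<notin> (\<lambda>w. act w z) ` (W - stab z)" by (auto simp: stab_def)
  moreover have "finite ((\<lambda>w. act w z) ` (W - stab z))" using finite_W by simp
  ultimately obtain f where "pev f z = 1" "grad f z = 0"
    "\<And>a. a \<in> (\<lambda>w. act w z) ` (W - stab z) \<Longrightarrow> pev f a = 0" "\<And>a. a \<in> (\<lambda>w. act w z) ` (W - stab z) \<Longrightarrow> grad f a = 0"
    using bump by metis
  then show ?thesis by (auto simp: orbit_bump_def)
qed

text \<open>Only the stabilizer contributes at \<open>z\<close>. The bump is squared for the sake of
  second derivatives: at the other points of the orbit \<open>f\<close> has zero 1-jet, while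
  \<open>f * f\<close> has zero 2-jet, as the Hessian in \<open>Jdet_simple_zero\<close>
  demands.\<close>

lemma grad_orbit_sum_bump:
  assumes f: "orbit_bump z f"
  shows "grad (orbit_sum (h * f * f)) z = (\<Sum>w\<in>stab z. act (transpose w) (grad h z))"
proof -
  have "grad (h * f * f) (act w z) = 0" if "w \<in> W - stab z" for w
    using bspec[OF conjunct2[OF conjunct2[OF f[unfolded orbit_bump_def]]] that] by (simp add: grad_mult pev_mult)
  then have "grad (orbit_sum (h * f * f)) z = (\<Sum>w\<in>stab z. grad (pact w (h * f * f)) z)"
    unfolding orbit_sum_def grad_sum
    by (intro sum.mono_neutral_right) (auto simp: stab_def finite_W grad_pact)
  also have "\<dots> = (\<Sum>w\<in>stab z. act (transpose w) (grad h z))"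
    using f by (intro sum.cong) (simp_all add: stab_def grad_pact grad_mult pev_mult orbit_bump_def)
  finally show ?thesis .
qed

end

section \<open>Basic invariants\<close>

lemma adjugate_transpose: "adjugate (transpose A) = transpose (adjugate A)"
proof -
  have "cofactor (transpose A) i j = cofactor A j i" for i j
    unfolding cofactor_def
    by (subst det_transpose[symmetric]) (rule arg_cong[of _ _ det], simp add: transpose_def vec_eq_iff)
  then show ?thesis by (simp add: adjugate_def transpose_def vec_eq_iff)
qed

lemma adjugate_mul_matrix: "adjugate A ** A = mat (det A)"
proof -
  have "transpose (adjugate A ** A) = transpose A ** adjugate (transpose A)"
    by (simp add: adjugate_transpose matrix_transpose_mul)
  then have "adjugate A ** A = transpose (mat (det A))"
    by (metis matrix_mul_adjugate det_transpose transpose_transpose)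
  then show ?thesis by (simp add: transpose_mat)
qed

lemma det_replace_row: "det (\<chi> r. if r = i then v else A $ r) = (\<Sum>j\<in>UNIV. v $ j * adjugate A $ j $ i)"
proof -
  have "(\<Sum>j\<in>UNIV. v $ j * adjugate A $ j $ i) = (\<Sum>j\<in>UNIV. det (\<chi> r. if r = i then v $ j *s axis j 1 else A $ r))"
    by (simp add: adjugate_def cofactor_row det_row_mul)
  also have "\<dots> = det (\<chi> r. if r = i then (\<Sum>j\<in>UNIV. v $ j *s axis j 1) else A $ r)"
    by (simp add: det_linear_row_sum)
  also have "(\<Sum>j\<in>UNIV. v $ j *s axis j 1) = v"
    by (simp add: vec_eq_iff axis_def if_distrib cong: if_cong)
  finally show ?thesis by simp
qed

text \<open>Uniqueness of coefficients with respect to the rows of a matrix with nonzero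
  determinant; the adjugate serves as inverse up to that determinant.\<close>

lemma row_mult_cancel:
  fixes A :: "('a::idom, 'n::finite) vec^'n"
  assumes "\<And>j. (\<Sum>i\<in>UNIV. a i * A $ i $ j) = 0" and "det A \<noteq> 0"
  shows "a i = 0"
proof -
  have "(\<Sum>j\<in>UNIV. (\<Sum>i\<in>UNIV. a i * A $ i $ j) * adjugate A $ j $ k) = (\<Sum>i\<in>UNIV. a i * (A ** adjugate A) $ i $ k)" for k
    unfolding matrix_matrix_mult_def sum_distrib_left sum_distrib_right
    by (subst sum.swap) (simp add: sum_distrib_left algebra_simps)
  moreover have "(\<Sum>i\<in>UNIV. a i * (A ** adjugate A) $ i $ k) = a k * det A" for k
    by (simp add: matrix_mul_adjugate mat_def if_distrib cong: if_cong)
  ultimately have "a i * det A = 0" using assms(1) by simp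
  then show ?thesis using assms(2) by simp
qed

lemma pdiff_vder_cvec: "pdiff j (vder (cvec a) f) = vder (cvec a) (pdiff j f)"
  by (simp add: vder_def cvec_def pdiff_simps pdiff_commute)

lemma evm_jacobian: "evm (jacobian p) x $ i = grad (p i) x"
  by (simp add: vec_eq_iff jacobian_def)

lemma jacobian_poly_subst:
  "jacobian (\<lambda>i. poly_subst p (g i)) = (\<chi> i k. poly_subst p (pdiff k (g i))) ** jacobian p"
  by (simp add: jacobian_def vec_eq_iff matrix_matrix_mult_def pdiff_poly_subst)

lemma cdot_uminus [simp]: "cdot x (- y) = - cdot x y" "cdot (- x) y = - cdot x y"
  by (simp_all add: cdot_def sum_negf)

locale invariant_basis = orthogonal_group W for W :: "'n::{finite,linorder} rmat set" +
  fixes d :: "'n \<Rightarrow> nat" and p :: "'n \<Rightarrow> 'n cpoly"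
  assumes basic: "basic_invariants W d p"
begin

definition Jdet :: "'n cpoly" where
  "Jdet = det (jacobian p)"

lemma p_invariant: "p i \<in> invariant_ring W"
  using basic poly_subst_Var[of p i] unfolding basic_invariants_def by (metis rangeI)

lemma poly_subst_p_invariant: "poly_subst p g \<in> invariant_ring W"
  using basic unfolding basic_invariants_def by blast

lemma invariantE:
  assumes "f \<in> invariant_ring W"
  obtains g where "f = poly_subst p g"
  using basic assms unfolding basic_invariants_def by blast

lemma poly_subst_p_inject: "poly_subst p f = poly_subst p g \<longleftrightarrow> f = g"
  using basic unfolding basic_invariants_def by (auto dest: injD)

lemma pev_invariant: "f \<in> invariant_ring W \<Longrightarrow> w \<in> W \<Longrightarrow> pev f (act w x) = pev f x"
  unfolding invariant_ring_iff by (metis pev_pact)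

lemma grad_invariant:
  assumes "f \<in> invariant_ring W" "w \<in> W"
  shows "grad f (act w x) = act w (grad f x)"
proof -
  have "pact w f = f" using assms by (simp add: invariant_ring_iff)
  then have "grad f x = act (transpose w) (grad f (act w x))" by (metis grad_pact)
  then show ?thesis using act_transpose[OF orth[OF assms(2)]] by metis
qed

lemma grad_invariant_in_span:
  assumes "f \<in> invariant_ring W"
  obtains c where "grad f x = (\<Sum>i\<in>UNIV. c i *s grad (p i) x)"
proof -
  obtain g where "f = poly_subst p g" using assms by (rule invariantE)
  then show ?thesis using that[of "\<lambda>i. pev (poly_subst p (pdiff i g)) x"] by (simp add: grad_poly_subst)
qed

lemma Jdet_eq_0_iff: "pev Jdet x = 0 \<longleftrightarrow> (\<exists>y. y \<noteq> 0 \<and> (\<forall>i. cdot (grad (p i) x) y = 0))"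
proof -
  have "(\<chi> i. cdot (grad (p i) x) y) = 0 \<longleftrightarrow> (\<forall>i. cdot (grad (p i) x) y = 0)" for y
    by (simp add: vec_eq_iff)
  then show ?thesis
    unfolding Jdet_def pev_det det_eq_0_iff_kernel matrix_vector_cdot evm_jacobian by (simp only:)
qed

lemma cdot_sum_left: "cdot (\<Sum>i\<in>A. v i) y = (\<Sum>i\<in>A. cdot (v i) y)"
  by (induction A rule: infinite_finite_induct) simp_all

text \<open>Every invariant is a polynomial in the \<open>p i\<close>, so a kernel vector of the
  Jacobian matrix kills the gradients of all invariants, in particular of those obtained by
  interpolation.\<close>

lemma kernel_grad_invariant:
  assumes "\<And>i. cdot (grad (p i) x) y = 0" "f \<in> invariant_ring W"
  shows "cdot (grad f x) y = 0"
proof -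
  obtain c where "grad f x = (\<Sum>i\<in>UNIV. c i *s grad (p i) x)"
    using grad_invariant_in_span[OF assms(2)] by blast
  then show ?thesis by (simp add: cdot_sum_left assms(1))
qed

text \<open>With trivial stabilizer the orbit sums of bumps have arbitrary gradients at
  \<open>z\<close>, so no nonzero vector is killed by all of them.\<close>

lemma Jdet_trivial_stab:
  assumes st: "stab z = {mat 1}"
  shows "pev Jdet z \<noteq> 0"
proof
  assume "pev Jdet z = 0"
  then obtain y where y: "y \<noteq> 0" "\<And>i. cdot (grad (p i) z) y = 0" unfolding Jdet_eq_0_iff by blast
  obtain f where f: "orbit_bump z f" using orbit_bump_exists by blast
  have "y $ k = 0" for k
  proof -
    have "grad (orbit_sum (lform (axis k 1) * f * f)) z = axis k 1"
      unfolding grad_orbit_sum_bump[OF f] st by (simp add: transpose_mat)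
    then show ?thesis
      using kernel_grad_invariant[OF y(2) orbit_sum_invariant[of "lform (axis k 1) * f * f"]] by simp
  qed
  then show False using y(1) by (simp add: vec_eq_iff)
qed

text \<open>The gradient at a point of the mirror is fixed by \<open>s\<close>, hence tangent to the
  mirror.\<close>

lemma grad_invariant_root:
  assumes "f \<in> invariant_ring W" "s \<in> refls" "cdot (root_vec s) x = 0"
  shows "cdot (root_vec s) (grad f x) = 0"
  using assms by (metis reflection_fixed_iff grad_invariant reflection_in)

lemma Jdet_hyperplane:
  assumes "s \<in> refls" "cdot (root_vec s) x = 0"
  shows "pev Jdet x = 0"
  unfolding Jdet_eq_0_iff
  using grad_invariant_root[OF p_invariant assms] root_nonzero[OF assms(1)] by (metis cdot_commute)

text \<open>Adapted invariants have Jacobian matrix, along the normal line at a generic point of the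
  hyperplane, with independent rows except for one that is proportional to the parameter times the root.\<close>

lemma Jdet_simple_zero:
  assumes s: "s \<in> refls" and st: "stab z = {mat 1, s}"
  shows "cdot (root_vec s) (grad Jdet z) \<noteq> 0"
proof
  assume neg: "cdot (root_vec s) (grad Jdet z) = 0"
  define a where "a = root_vec s"
  have aa: "cdot a a = 1" using cdot_root[OF s] by (simp add: a_def)
  have s1: "s \<noteq> mat 1" by (rule reflection_ne_one[OF s])
  have "s \<in> stab z" using st by simp
  then have az: "cdot a z = 0" using s by (simp add: stab_def reflection_fixed_iff a_def)
  have ts: "act (transpose s) x = x - (2 * cdot a x) *s a" for x
    using s by (simp add: transpose_reflection act_reflection a_def)
  obtain k where k: "a $ k \<noteq> 0" using root_nonzero[OF s] by (auto simp: vec_eq_iff a_def)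
  obtain f where f: "orbit_bump z f" using orbit_bump_exists by blast
  \<comment> \<open>For \<open>j \<noteq> k\<close> these vectors form a basis of the hyperplane
    normal to \<open>a\<close>.\<close>
  define \<xi> where "\<xi> = (\<lambda>j. axis j 1 - (a $ j / a $ k) *s axis k 1)"
  have a\<xi>: "cdot a (\<xi> j) = 0" for j using k by (simp add: \<xi>_def)
  \<comment> \<open>Prescribed jets: linear coordinates along the mirror and, in place
    \<open>k\<close>, half the square of the normal coordinate, whose derivative along
    \<open>a\<close> is the normal coordinate itself.\<close>
  define h where "h = (\<lambda>j. if j = k then Const (1/2) * lform a * lform a else lform (\<xi> j))"
  define F where "F = (\<lambda>j. orbit_sum (h j * f * f))"
  have "\<exists>g. F j = poly_subst p g" for j
    unfolding F_def using orbit_sum_invariant by (metis invariantE)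
  then obtain g where g: "\<And>j. F j = poly_subst p (g j)" by metis
  have gradF: "grad (F j) z = (if j = k then 0 else 2 *s \<xi> j)" for j
  proof -
    have "grad (F j) z = grad (h j) z + act (transpose s) (grad (h j) z)"
      using s1 unfolding F_def grad_orbit_sum_bump[OF f] st by (simp add: transpose_mat)
    moreover have "grad (h j) z = (if j = k then 0 else \<xi> j)"
      by (simp add: h_def grad_mult pev_mult az)
    ultimately show ?thesis by (simp add: ts a\<xi> vec_eq_iff)
  qed
  have hessF: "grad (vder (cvec a) (F k)) z = 2 *s a"
  proof -
    define u where "u = lform a * f"
    define H where "H = Const (1/2) * u * u"
    have H: "h k * f * f = H" by (simp add: h_def H_def u_def algebra_simps)
    have vH: "vder (cvec b) H = u * vder (cvec b) u" for b
    proof -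
      have "vder (cvec b) H = (Const (1/2) + Const (1/2)) * (u * vder (cvec b) u)"
        by (simp only: H_def vder_mult vder_Const) (simp add: algebra_simps)
      then show ?thesis by (simp flip: Const_add)
    qed
    have "grad (vder (cvec a) (F k)) z = (\<Sum>w\<in>W. act (transpose w) (grad (u * vder (cvec (act w a)) u) (act w z)))"
      by (simp add: F_def H orbit_sum_def vder_sum vder_cvec_pact vH grad_sum grad_pact)
    also have "\<dots> = (\<Sum>w\<in>stab z. act (transpose w) (grad (u * vder (cvec (act w a)) u) (act w z)))"
    proof (rule sum.mono_neutral_right)
      show "\<forall>w\<in>W - stab z. act (transpose w) (grad (u * vder (cvec (act w a)) u) (act w z)) = 0"
      proof
        fix w assume w: "w \<in> W - stab z"
        show "act (transpose w) (grad (u * vder (cvec (act w a)) u) (act w z)) = 0"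
          using bspec[OF conjunct2[OF conjunct2[OF f[unfolded orbit_bump_def]]] w]
          by (simp add: grad_mult u_def pev_mult)
      qed
    qed (auto simp: finite_W stab_def)
    also have "\<dots> = (\<Sum>w\<in>stab z. act (transpose w) (cdot (act w a) a *s a))"
    proof (rule sum.cong[OF refl])
      fix w assume "w \<in> stab z"
      then have "act w z = z" by (simp add: stab_def)
      then show "act (transpose w) (grad (u * vder (cvec (act w a)) u) (act w z)) = act (transpose w) (cdot (act w a) a *s a)"
        using f by (simp add: grad_mult u_def pev_mult az orbit_bump_def pev_vder_cvec)
    qed
    also have "\<dots> = a + act (transpose s) (cdot (act s a) a *s a)"
      using s1 unfolding st by (simp add: transpose_mat aa)
    also have "\<dots> = 2 *s a"
      by (simp add: aa ts act_reflection[OF s] a_def[symmetric] vec_eq_iff)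
    finally show ?thesis .
  qed
  have row: "evm (jacobian F) z $ i = (if i = k then 0 else 2 *s \<xi> i)" for i
    by (simp add: evm_jacobian gradF)
  have "pev (vder (cvec a) (det (jacobian F))) z
      = (\<Sum>r\<in>UNIV. det (\<chi> i. if i = r then grad (vder (cvec a) (F r)) z else evm (jacobian F) z $ i))"
  proof -
    have "evm (\<chi> i. if i = r then (\<chi> j. vder (cvec a) (jacobian F $ r $ j)) else jacobian F $ i) z
       = (\<chi> i. if i = r then grad (vder (cvec a) (F r)) z else evm (jacobian F) z $ i)" for r
      by (auto simp: vec_eq_iff jacobian_def pdiff_vder_cvec)
    then show ?thesis by (simp add: vder_det pev_simps pev_det)
  qed
  \<comment> \<open>Row \<open>k\<close> of the Jacobian matrix of \<open>F\<close> vanishes at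
    \<open>z\<close>, so only the summand in which this row is differentiated survives.\<close>
  also have "\<dots> = (\<Sum>r\<in>UNIV. if r = k then det (\<chi> i. if i = k then 2 *s a else 2 *s \<xi> i) else 0)"
  proof (rule sum.cong[OF refl])
    fix r
    show "det (\<chi> i. if i = r then grad (vder (cvec a) (F r)) z else evm (jacobian F) z $ i)
      = (if r = k then det (\<chi> i. if i = k then 2 *s a else 2 *s \<xi> i) else 0)"
    proof (cases "r = k")
      case True
      then have "(\<chi> i. if i = r then grad (vder (cvec a) (F r)) z else evm (jacobian F) z $ i)
          = (\<chi> i. if i = k then 2 *s a else 2 *s \<xi> i)"
        by (intro Cart_lambda_cong) (simp add: row hessF)
      with True show ?thesis by simp
    next
      case False
      then have "det (\<chi> i. if i = r then grad (vder (cvec a) (F r)) z else evm (jacobian F) z $ i) = 0"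
        by (intro det_zero_row[of k]) (simp add: row row_def vec_eq_iff)
      with False show ?thesis by simp
    qed
  qed
  also have "\<dots> = det (\<chi> i. if i = k then 2 *s a else 2 *s \<xi> i)" by simp
  finally have lhs: "pev (vder (cvec a) (det (jacobian F))) z = det (\<chi> i. if i = k then 2 *s a else 2 *s \<xi> i)" .
  have "det (\<chi> i. if i = k then 2 *s a else 2 *s \<xi> i) \<noteq> 0"
  proof
    assume "det (\<chi> i. if i = k then 2 *s a else 2 *s \<xi> i) = 0"
    then obtain y where y: "y \<noteq> 0" "(\<chi> i. if i = k then 2 *s a else 2 *s \<xi> i) *v y = 0"
      unfolding det_eq_0_iff_kernel by blast
    then have r: "cdot (if i = k then 2 *s a else 2 *s \<xi> i) y = 0" for i
      by (simp add: matrix_vector_cdot vec_eq_iff)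
    have ya: "y $ i = (y $ k / a $ k) * a $ i" for i
    proof (cases "i = k")
      case False
      with r[of i] have "cdot (\<xi> i) y = 0" by simp
      then show ?thesis by (simp add: \<xi>_def)
    qed (use k in simp)
    then have "y = (y $ k / a $ k) *s a" by (metis vec_eq_iff vector_smult_component)
    then have "cdot a y = (y $ k / a $ k)" using aa by (metis cdot_scale(1) mult.right_neutral)
    moreover have "cdot a y = 0" using r[of k] by simp
    ultimately have "y $ k = 0" using k by simp
    then have "y $ i = 0" for i using ya[of i] by simp
    then show False using y(1) by (simp add: vec_eq_iff)
  qed
  \<comment> \<open>By the chain rule \<open>det (jacobian F)\<close> is a multiple of
    \<open>Jdet\<close>, which is assumed to vanish at \<open>z\<close> together with its normal
    derivative.\<close>
  moreover have "det (jacobian F) = det (\<chi> i k. poly_subst p (pdiff k (g i))) * Jdet"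
    unfolding g[abs_def] fun_eq_iff[symmetric] jacobian_poly_subst det_mul Jdet_def by simp
  then have "pev (vder (cvec a) (det (jacobian F))) z = 0"
    using neg Jdet_hyperplane[OF s az[unfolded a_def]]
    by (simp add: vder_mult pev_simps pev_vder_cvec a_def)
  ultimately show False using lhs by simp
qed

text \<open>The quotient of \<open>Jdet\<close> by the product of the root forms has no generic
  zero, because \<open>Jdet\<close> is nonzero at points with trivial stabilizer and has simple
  zeros at generic points of the mirrors. A nonconstant polynomial would have a generic
  zero.\<close>

lemma Jdet_factorization: "\<exists>c. c \<noteq> 0 \<and> Jdet = Const c * (\<Prod>s\<in>refls. rform s)"
proof -
  have "(\<Prod>s\<in>refls. rform s) dvd Jdet"
    by (rule prod_lform_dvd) (auto simp: finite_refls root_nonzero roots_not_proportional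
        intro!: lform_dvdI Jdet_hyperplane)
  then obtain g where g: "Jdet = (\<Prod>s\<in>refls. rform s) * g" ..
  have gz: "pev g z \<noteq> 0" if "generic z" for z
  proof
    assume z: "pev g z = 0"
    then have "stab z \<noteq> {mat 1}" using Jdet_trivial_stab[of z] by (auto simp: g pev_mult)
    with that obtain s where s: "s \<in> refls" "stab z = {mat 1, s}" unfolding generic_def by blast
    define r where "r = (\<Prod>s\<in>refls - {s}. rform s) * g"
    have "Jdet = rform s * r"
      unfolding g r_def using s(1) finite_refls by (simp add: prod.remove mult.assoc)
    moreover have "pev r z = 0" using z by (simp add: r_def pev_mult)
    moreover have "cdot (root_vec s) z = 0"
    proof -
      have "s \<in> stab z" using s by simp
      then show ?thesis using s by (simp add: stab_def reflection_fixed_iff)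
    qed
    ultimately have "grad Jdet z = 0" by (simp add: grad_mult)
    then show False using Jdet_simple_zero[OF s] by simp
  qed
  have "\<exists>c. g = Const c"
  proof (rule ccontr)
    assume "\<nexists>c. g = Const c"
    then have "\<And>c. g \<noteq> Const c" by blast
    then obtain z where "pev g z = 0" "generic z"
      using generic_zero by blast
    with gz[of z] show False by blast
  qed
  then obtain c where c: "g = Const c" ..
  have "c \<noteq> 0"
  proof -
    have "Var undefined \<noteq> Const c" for c :: complex
      by (metis pdiff_Const pdiff_Var zero_neq_one)
    then obtain z :: "'n cv" where "generic z"
      using generic_zero by metis
    then show ?thesis using gz c by fastforce
  qed
  then show ?thesis using g c by (auto simp: mult.commute)
qed

lemma Jdet_nonzero: "Jdet \<noteq> 0"
  using Jdet_factorization root_nonzero finite_refls by auto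

lemma Jdet_dvdI:
  assumes "\<And>s x. s \<in> refls \<Longrightarrow> cdot (root_vec s) x = 0 \<Longrightarrow> pev f x = 0"
  shows "Jdet dvd f"
proof -
  obtain c where c: "c \<noteq> 0" "Jdet = Const c * (\<Prod>s\<in>refls. rform s)"
    using Jdet_factorization by blast
  have "(\<Prod>s\<in>refls. rform s) dvd f"
    by (rule prod_lform_dvd) (auto simp: finite_refls root_nonzero roots_not_proportional
        intro!: lform_dvdI assms)
  then show ?thesis
    using mult_dvd_mono[OF Const_dvd_one[OF c(1)], of "\<Prod>s\<in>refls. rform s" f] by (simp add: c(2))
qed

definition equivariant :: "('n cpoly, 'n) vec \<Rightarrow> bool" where
  "equivariant a \<longleftrightarrow> (\<forall>w\<in>W. \<forall>x. (\<chi> j. pev (a $ j) (act w x)) = act w (\<chi> j. pev (a $ j) x))"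

text \<open>Cramer's rule expresses \<open>a\<close> through the gradients with denominator \<open>det J\<close>; the numerators
  vanish on every reflecting hyperplane.\<close>

lemma equivariantE:
  assumes eq: "equivariant a"
  obtains f where "\<And>i. f i \<in> invariant_ring W" "\<And>j. a $ j = (\<Sum>i\<in>UNIV. f i * pdiff j (p i))"
proof -
  define c where "c = (\<lambda>i. det (\<chi> r. if r = i then a else jacobian p $ r))"
  have "Jdet dvd c i" for i
  proof (rule Jdet_dvdI)
    fix s x assume s: "s \<in> refls" "cdot (root_vec s) x = 0"
    \<comment> \<open>On the mirror the field \<open>a\<close> and all gradients are orthogonal to
      the root, so the Cramer numerator is the determinant of a matrix with the root in its
      kernel.\<close>
    let ?M = "evm (\<chi> r. if r = i then a else jacobian p $ r) x"
    have "act s x = x" using s by (simp add: reflection_fixed_iff)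
    then have "act s (\<chi> j. pev (a $ j) x) = (\<chi> j. pev (a $ j) x)"
      using eq reflection_in[OF s(1)] unfolding equivariant_def by metis
    then have "cdot (\<chi> j. pev (a $ j) x) (root_vec s) = 0"
      using s by (simp add: reflection_fixed_iff cdot_commute)
    moreover have "cdot (grad (p r) x) (root_vec s) = 0" for r
      using grad_invariant_root[OF p_invariant s] by (simp add: cdot_commute)
    moreover have "?M $ r = (if r = i then (\<chi> j. pev (a $ j) x) else grad (p r) x)" for r
      by (simp add: vec_eq_iff jacobian_def)
    ultimately have "?M *v root_vec s = 0"
      unfolding matrix_vector_cdot by (simp add: vec_eq_iff[of "\<chi> i. _ i"])
    then show "pev (c i) x = 0"
      unfolding c_def pev_det det_eq_0_iff_kernel using root_nonzero[OF s(1)] by blast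
  qed
  then have "\<exists>f. \<forall>i. c i = Jdet * f i" by (intro choice allI) (auto elim!: dvdE)
  then obtain f where f: "\<And>i. c i = Jdet * f i" by blast
  have aj: "a $ j = (\<Sum>i\<in>UNIV. f i * pdiff j (p i))" for j
  proof -
    have "Jdet * (\<Sum>i\<in>UNIV. f i * pdiff j (p i)) = (\<Sum>i\<in>UNIV. c i * jacobian p $ i $ j)"
      by (simp add: f jacobian_def sum_distrib_left mult.assoc)
    also have "\<dots> = (\<Sum>k\<in>UNIV. a $ k * (adjugate (jacobian p) ** jacobian p) $ k $ j)"
      unfolding c_def det_replace_row matrix_matrix_mult_def sum_distrib_left sum_distrib_right
      by (subst sum.swap) (simp add: sum_distrib_left algebra_simps)
    also have "\<dots> = Jdet * a $ j"
      by (simp add: adjugate_mul_matrix mat_def Jdet_def if_distrib cong: if_cong)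
    finally show ?thesis using Jdet_nonzero by simp
  qed
  have "f i \<in> invariant_ring W" for i
    unfolding invariant_ring_iff
  proof
    fix w assume w: "w \<in> W"
    \<comment> \<open>Transport by \<open>w\<close> gives a second expansion of the same field. The
      gradients are linearly independent over the polynomials, so the coefficients agree.\<close>
    have "(\<Sum>i\<in>UNIV. (pact w (f i) - f i) * jacobian p $ i $ j) = 0" for j
    proof (rule pev_eqI)
      fix x
      have ev: "(\<chi> j. pev (a $ j) y) = (\<Sum>i\<in>UNIV. pev (f i) y *s grad (p i) y)" for y
        by (simp add: aj vec_eq_iff pev_simps)
      have "act w (\<Sum>i\<in>UNIV. pev (f i) x *s grad (p i) x) = (\<Sum>i\<in>UNIV. pev (f i) (act w x) *s grad (p i) (act w x))"
        using eq w unfolding equivariant_def ev by simp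
      also have "\<dots> = act w (\<Sum>i\<in>UNIV. pev (f i) (act w x) *s grad (p i) x)"
        by (simp add: act_sum act_scale grad_invariant[OF p_invariant w])
      finally have e: "act w (\<Sum>i\<in>UNIV. pev (f i) x *s grad (p i) x) = act w (\<Sum>i\<in>UNIV. pev (f i) (act w x) *s grad (p i) x)" .
      have "(\<Sum>i\<in>UNIV. pev (f i) x *s grad (p i) x) = (\<Sum>i\<in>UNIV. pev (f i) (act w x) *s grad (p i) x)"
        using arg_cong[OF e, of "act (transpose w)"] by (simp only: act_transpose(1)[OF orth[OF w]])
      from arg_cong[OF this, of "\<lambda>v. v $ j"]
      show "pev (\<Sum>i\<in>UNIV. (pact w (f i) - f i) * jacobian p $ i $ j) x = pev 0 x"
        by (simp add: pev_simps pev_pact jacobian_def left_diff_distrib sum_subtractf)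
    qed
    then have "pact w (f i) - f i = 0"
      by (rule row_mult_cancel) (use Jdet_nonzero in \<open>simp add: Jdet_def\<close>)
    then show "pact w (f i) = f i" by simp
  qed
  with aj that show ?thesis by blast
qed

end

section \<open>Weights\<close>

text \<open>Homogeneity in terms of dilations. Integer weights can be subtracted; a negative weight
  forces the polynomial to be zero, and zero has every weight.\<close>

definition weight :: "int \<Rightarrow> 'n::finite cpoly \<Rightarrow> bool" where
  "weight e f \<longleftrightarrow> (\<forall>t x. t \<noteq> 0 \<longrightarrow> pev f (t *s x) = t powi e * pev f x)"

lemma weightD: "weight e f \<Longrightarrow> t \<noteq> 0 \<Longrightarrow> pev f (t *s x) = t powi e * pev f x"
  by (simp add: weight_def)

lemma weight_homogeneous:
  assumes "homogeneous e f"
  shows "weight (int e) f"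
proof -
  have "(\<Prod>i\<in>UNIV. (t * x $ i) ^ lookup m i)
      = t ^ (\<Sum>i\<in>UNIV. lookup m i) * (\<Prod>i\<in>UNIV. (x $ i) ^ lookup m i)" for t :: complex and x and m :: "'a \<Rightarrow>\<^sub>0 nat"
    by (simp add: power_mult_distrib prod.distrib power_sum)
  then have "lookup f m * (\<Prod>i\<in>UNIV. (t * x $ i) ^ lookup m i)
      = t ^ e * (lookup f m * (\<Prod>i\<in>UNIV. (x $ i) ^ lookup m i))"
    if "m \<in> keys f" for m t x
    using that assms unfolding homogeneous_def by simp
  then show ?thesis
    unfolding weight_def pev_def sum_distrib_left by (auto intro!: sum.cong)
qed

lemma weight_mult: "weight e f \<Longrightarrow> weight e' g \<Longrightarrow> weight (e + e') (f * g)"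
  by (simp add: weight_def pev_mult power_int_add)

lemma weight_sum: "(\<And>i. i \<in> A \<Longrightarrow> weight e (f i)) \<Longrightarrow> weight e (sum f A)"
  by (simp add: weight_def pev_sum sum_distrib_left)

lemma weight_0 [simp]: "weight e 0"
  by (simp add: weight_def)

lemma weight_prod:
  assumes "finite A" "\<And>i. i \<in> A \<Longrightarrow> weight (e i) (f i)"
  shows "weight (\<Sum>i\<in>A. e i) (prod f A)"
  using assms
proof (induction rule: finite_induct)
  case empty
  show ?case by (simp add: weight_def)
next
  case (insert x F)
  then show ?case by (simp add: weight_mult)
qed

lemma weight_of_int_mult: "weight e f \<Longrightarrow> weight e (of_int k * f)"
  by (simp add: weight_def pev_simps)

text \<open>If the weights of the entries split as \<open>a i + b j\<close>, all terms of the
  Leibniz sum have the same weight.\<close>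

lemma weight_det:
  fixes A :: "'n::finite cpoly^'m::finite^'m"
  assumes "\<And>i j. weight (a i + b j) (A $ i $ j)"
  shows "weight ((\<Sum>i\<in>UNIV. a i) + (\<Sum>i\<in>UNIV. b i)) (det A)"
  unfolding det_def
proof (intro weight_sum weight_of_int_mult)
  fix q :: "'m \<Rightarrow> 'm" assume "q \<in> {q. q permutes UNIV}"
  then have "(\<Sum>i\<in>UNIV. b (q i)) = (\<Sum>i\<in>UNIV. b i)"
    by (intro sum.reindex_bij_betw) (auto simp: permutes_bij)
  then show "weight ((\<Sum>i\<in>UNIV. a i) + (\<Sum>i\<in>UNIV. b i)) (\<Prod>i\<in>UNIV. A $ i $ q i)"
    using weight_prod[of UNIV "\<lambda>i. a i + b (q i)" "\<lambda>i. A $ i $ q i"] assms by (simp add: sum.distrib)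
qed

definition pscale :: "complex \<Rightarrow> 'n::finite cpoly \<Rightarrow> 'n cpoly" where
  "pscale t f = poly_subst (\<lambda>i. Const t * Var i) f"

lemma pev_pscale: "pev (pscale t f) x = pev f (t *s x)"
proof -
  have "(\<chi> i. t * x $ i) = t *s x" by (simp add: vec_eq_iff)
  then show ?thesis by (simp add: pscale_def pev_poly_subst pev_simps)
qed

lemma pdiff_pscale: "pdiff j (pscale t f) = Const t * pscale t (pdiff j f)"
proof -
  have "pdiff j (pscale t f) = (\<Sum>i\<in>UNIV. if i = j then Const t * pscale t (pdiff j f) else 0)"
    unfolding pscale_def pdiff_poly_subst by (intro sum.cong) (auto simp: pdiff_simps)
  then show ?thesis by simp
qed

lemma grad_pscale: "grad (pscale t f) x = t *s grad f (t *s x)"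
  by (simp add: vec_eq_iff pdiff_pscale pev_mult pev_pscale)

lemma weight_pdiff:
  assumes "weight e f"
  shows "weight (e - 1) (pdiff j f)"
  unfolding weight_def
proof (intro allI impI)
  fix t :: complex and x :: "complex^'a" assume t: "t \<noteq> 0"
  have "pscale t f = Const (t powi e) * f"
    by (rule pev_eqI) (simp add: pev_pscale pev_mult weightD[OF assms t])
  then have "Const t * pscale t (pdiff j f) = Const (t powi e) * pdiff j f"
    by (metis pdiff_pscale pdiff_mult pdiff_Const mult_zero_right add_0_right)
  from arg_cong[OF this, of "\<lambda>f. pev f x"]
  have "t * pev (pdiff j f) (t *s x) = t powi e * pev (pdiff j f) x"
    by (simp add: pev_mult pev_pscale)
  then show "pev (pdiff j f) (t *s x) = t powi (e - 1) * pev (pdiff j f) x"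
    using t by (simp add: power_int_diff field_simps)
qed

text \<open>Differentiate the scaling law at \<open>t = 1\<close>.\<close>

lemma euler:
  assumes "weight e f"
  shows "cdot (grad f x) x = of_int e * pev f x"
proof -
  have "((\<lambda>t. pev f (0 + t *s x)) has_field_derivative cdot (grad f x) x) (at 1)"
    using has_field_derivative_pev_line[of f 0 x 1] by (simp add: cdot_def)
  moreover have "((\<lambda>t. t powi e * pev f x) has_field_derivative of_int e * pev f x) (at 1)"
    by (auto intro!: derivative_eq_intros)
  then have "((\<lambda>t. pev f (0 + t *s x)) has_field_derivative of_int e * pev f x) (at 1)"
    by (rule has_field_derivative_transform_within_open[of _ _ _ "- {0}"]) (auto simp: weightD[OF assms])
  ultimately show ?thesis by (rule DERIV_unique)
qed

text \<open>Along a line through 0 the polynomial \<open>t^(-e) f (t x)\<close> equals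
  \<open>f x\<close> for all \<open>t \<noteq> 0\<close>, hence identically, but it vanishes at
  \<open>t = 0\<close>.\<close>

lemma weight_negative:
  assumes "weight e f" "e < 0"
  shows "f = 0"
proof (rule pev_eqI)
  fix x
  obtain P where P: "\<And>t. pev f (0 + t *s x) = poly P t" using pev_line_poly by metis
  define k where "k = nat (- e)"
  have k: "k > 0" using assms(2) by (simp add: k_def)
  have "poly (monom 1 k * P - [:pev f x:]) t = 0" if t: "t \<noteq> 0" for t
  proof -
    have "t ^ k * t powi e = 1"
      using t assms(2) by (simp add: k_def power_int_def field_simps)
    moreover have "poly P t = t powi e * pev f x" using P[of t] weightD[OF assms(1) t, of x] by simp
    ultimately have "t ^ k * poly P t = pev f x" by (metis mult.assoc mult_1)
    then show ?thesis by (simp add: poly_monom)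
  qed
  then have "- {0} \<subseteq> {t. poly (monom 1 k * P - [:pev f x:]) t = 0}" by auto
  moreover have "infinite (- {0 :: complex})" by (simp add: infinite_UNIV_char_0 Compl_eq_Diff_UNIV)
  ultimately have "monom 1 k * P - [:pev f x:] = 0"
    using poly_roots_finite infinite_super by metis
  then have "poly (monom 1 k * P - [:pev f x:]) 0 = 0" by simp
  then have "0 ^ k * poly P 0 - pev f x = 0" unfolding poly_diff poly_mult poly_monom by simp
  then show "pev f x = pev 0 x" using k by (simp add: power_0_left)
qed

lemma weight_0_imp_Const:
  assumes "weight 0 f"
  shows "f = Const (pev f 0)"
proof (rule pev_eqI)
  fix x
  have "pev (f - Const (pev f x)) 0 = 0"
    by (rule pev_line_0[of _ _ x]) (simp add: pev_simps weightD[OF assms])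
  then show "pev f x = pev (Const (pev f 0)) x" by (simp add: pev_simps)
qed

section \<open>Schur's lemma and lying over\<close>

lemma linear_term_zero:
  fixes b c :: real
  assumes "\<And>t. 2 * t * b + t ^ 2 * c \<ge> 0"
  shows "b = 0"
proof (rule ccontr)
  assume b: "b \<noteq> 0"
  \<comment> \<open>This choice turns the linear term into \<open>- 2 t^2 (1 + |c|)\<close>, which
    outweighs the quadratic one.\<close>
  define t where "t = - b / (1 + \<bar>c\<bar>)"
  have "1 + \<bar>c\<bar> > 0" by simp
  then have t: "t * (1 + \<bar>c\<bar>) = - b" by (simp add: t_def)
  have "t \<noteq> 0" using t b by auto
  have "2 * t * b + t ^ 2 * c = t\<^sup>2 * (c - 2 * (1 + \<bar>c\<bar>))"
    using t by (simp add: power2_eq_square) algebra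
  also have "\<dots> < 0" using \<open>t \<noteq> 0\<close> by (intro mult_pos_neg) auto
  finally show False using assms[of t] by simp
qed

text \<open>A point where the quadratic form of \<open>A\<close> is maximal on the unit sphere is an
  eigenvector, and its eigenspace is stable under \<open>W\<close>.\<close>

lemma schur_symmetric:
  fixes A :: "real^'n::finite^'n"
  assumes irr: "irreducible_action W"
    and sym: "\<And>i j. A $ i $ j = A $ j $ i"
    and comm: "\<And>w x. w \<in> W \<Longrightarrow> A *v (w *v x) = w *v (A *v x)"
  shows "\<exists>c. \<forall>x. A *v x = c *\<^sub>R x"
proof -
  have Asym: "x \<bullet> (A *v y) = y \<bullet> (A *v x)" for x y
    unfolding inner_vec_def matrix_vector_mult_def
    by (simp add: sum_distrib_left, subst sum.swap) (simp add: sym algebra_simps)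
  have cont: "continuous_on (sphere 0 1) (\<lambda>x :: real^'n. x \<bullet> (A *v x))"
    unfolding inner_vec_def matrix_vector_mult_def by (auto intro!: continuous_intros bounded_linear.continuous_on[OF bounded_linear_vec_nth])
  have "axis undefined 1 \<in> (sphere 0 1 :: (real^'n) set)" by (simp add: norm_axis_1)
  then have "sphere 0 1 \<noteq> ({} :: (real^'n) set)" by blast
  from continuous_attains_sup[OF compact_sphere this cont]
  obtain u where u: "norm u = 1" and max: "\<And>y. norm y = 1 \<Longrightarrow> y \<bullet> (A *v y) \<le> u \<bullet> (A *v u)"
    by (auto simp: dist_norm)
  define c where "c = u \<bullet> (A *v u)"
  have uu: "u \<bullet> u = 1" using u by (simp add: norm_eq_1)
  have psd: "y \<bullet> (A *v y) \<le> c * (y \<bullet> y)" for y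
  proof (cases "y = 0")
    case False
    then have "(y /\<^sub>R norm y) \<bullet> (A *v (y /\<^sub>R norm y)) \<le> c" unfolding c_def by (intro max) simp
    then have "(y \<bullet> (A *v y)) / (norm y * norm y) \<le> c"
      by (simp add: matrix_vector_mult_scaleR field_simps)
    then show ?thesis using False by (simp add: divide_le_eq dot_square_norm power2_eq_square)
  qed simp
  have "y \<bullet> (c *\<^sub>R u - A *v u) = 0" for y
  proof (rule linear_term_zero)
    fix t :: real
    have "(u + t *\<^sub>R y) \<bullet> (A *v (u + t *\<^sub>R y)) \<le> c * ((u + t *\<^sub>R y) \<bullet> (u + t *\<^sub>R y))" by (rule psd)
    then show "2 * t * (y \<bullet> (c *\<^sub>R u - A *v u)) + t ^ 2 * (c * (y \<bullet> y) - y \<bullet> (A *v y)) \<ge> 0"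
      by (simp add: inner_add_left inner_add_right inner_diff_right matrix_vector_right_distrib matrix_vector_mult_scaleR
          Asym[of u y] inner_commute[of u y] uu c_def[symmetric] power2_eq_square algebra_simps)
  qed
  then have Au: "A *v u = c *\<^sub>R u" by (metis inner_eq_zero_iff right_minus_eq)
  define U where "U = {x. A *v x = c *\<^sub>R x}"
  have "subspace U"
    unfolding U_def subspace_def by (auto simp: matrix_vector_right_distrib matrix_vector_mult_scaleR scaleR_add_right)
  moreover have "w *v x \<in> U" if "w \<in> W" "x \<in> U" for w x
    using that comm by (simp add: U_def matrix_vector_mult_scaleR)
  moreover have "u \<in> U" "u \<noteq> 0" using Au u by (auto simp: U_def)
  ultimately have "U = UNIV" using irr unfolding irreducible_action_def by blast
  then show ?thesis unfolding U_def by blast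
qed

section \<open>Zeros of ideals and surjectivity of the quotient map\<close>

definition cideal :: "'n cpoly set \<Rightarrow> bool" where
  "cideal I \<longleftrightarrow> 0 \<in> I \<and> (\<forall>f\<in>I. \<forall>g\<in>I. f + g \<in> I) \<and> (\<forall>f\<in>I. \<forall>g. g * f \<in> I)"

definition poly_at :: "complex poly \<Rightarrow> 'n \<Rightarrow> 'n::finite cpoly" where
  "poly_at P j = (\<Sum>k\<le>degree P. Const (coeff P k) * Var j ^ k)"

lemma pev_poly_at: "pev (poly_at P j) x = poly P (x $ j)"
  by (simp add: poly_at_def pev_simps poly_altdef)

text \<open>Split \<open>P\<close> as \<open>(X - r) Q\<close>. If adding
  \<open>Var j - Const r\<close> makes the ideal improper, multiplying the resulting expression for
  1 by \<open>poly_at Q j\<close> shows that \<open>poly_at Q j\<close> lies in \<open>I\<close>,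
  and the degree has dropped.\<close>

lemma cideal_add_linear:
  assumes I: "cideal I" "1 \<notin> I" and P: "P \<noteq> 0" "poly_at P j \<in> I"
  shows "\<exists>I' r. cideal I' \<and> I \<subseteq> I' \<and> 1 \<notin> I' \<and> Var j - Const r \<in> I'"
  using P
proof (induction "degree P" arbitrary: P rule: less_induct)
  case less
  show ?case
  proof (cases "degree P = 0")
    case True
    then obtain c where "P = [:c:]" using degree_eq_zeroE by blast
    then have "c \<noteq> 0" "Const c \<in> I" using less.prems by (auto simp: poly_at_def)
    then have "Const (1 / c) * Const c \<in> I" using I unfolding cideal_def by blast
    then show ?thesis using I(2) \<open>c \<noteq> 0\<close> by (simp flip: Const_mult)
  next
    case False
    then have "\<not> constant (poly P)" by (simp add: constant_degree)
    then obtain r where "poly P r = 0" using fundamental_theorem_of_algebra by blast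
    then obtain Q where Q: "P = [:- r, 1:] * Q" unfolding poly_eq_0_iff_dvd by (auto elim: dvdE)
    have "Q \<noteq> 0" using Q less.prems by auto
    then have deg: "degree Q < degree P" unfolding Q by (subst degree_mult_eq) auto
    define I' where "I' = {f + (Var j - Const r) * g | f g. f \<in> I}"
    show ?thesis
    proof (cases "1 \<in> I'")
      case True
      then obtain f g where fg: "1 = f + (Var j - Const r) * g" "f \<in> I" unfolding I'_def by blast
      have PQ: "poly_at P j = (Var j - Const r) * poly_at Q j"
        by (rule pev_eqI) (simp add: pev_poly_at Q pev_simps algebra_simps)
      have "poly_at Q j = poly_at Q j * (f + (Var j - Const r) * g)" by (simp flip: fg(1))
      then have "poly_at Q j = poly_at Q j * f + g * poly_at P j"
        by (simp add: PQ algebra_simps)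
      then have "poly_at Q j \<in> I"
        using I(1) fg(2) less.prems(2) unfolding cideal_def by metis
      with less.hyps[OF deg] \<open>Q \<noteq> 0\<close> show ?thesis by blast
    next
      case False
      have "cideal I'"
        unfolding cideal_def
      proof (intro conjI ballI allI)
        show "0 \<in> I'" unfolding I'_def using I(1) by (auto simp: cideal_def intro!: exI[of _ 0])
      next
        fix f g assume "f \<in> I'" "g \<in> I'"
        then obtain f1 f2 g1 g2 where f: "f = f1 + (Var j - Const r) * f2" "f1 \<in> I"
          and g: "g = g1 + (Var j - Const r) * g2" "g1 \<in> I"
          unfolding I'_def by blast
        have "f + g = (f1 + g1) + (Var j - Const r) * (f2 + g2)" unfolding f g by (simp add: algebra_simps)
        moreover have "f1 + g1 \<in> I" using f g I(1) by (auto simp: cideal_def)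
        ultimately show "f + g \<in> I'" unfolding I'_def by blast
      next
        fix f g assume "f \<in> I'"
        then obtain f1 f2 where f: "f = f1 + (Var j - Const r) * f2" "f1 \<in> I" unfolding I'_def by blast
        have "g * f = g * f1 + (Var j - Const r) * (g * f2)" unfolding f by (simp add: algebra_simps)
        moreover have "g * f1 \<in> I" using f I(1) by (auto simp: cideal_def)
        ultimately show "g * f \<in> I'" unfolding I'_def by blast
      qed
      moreover have "I \<subseteq> I'"
      proof
        fix f assume "f \<in> I"
        moreover have "f = f + (Var j - Const r) * 0" by simp
        ultimately show "f \<in> I'" unfolding I'_def by blast
      qed
      moreover have "Var j - Const r \<in> I'"
      proof -
        have "Var j - Const r = 0 + (Var j - Const r) * 1" "0 \<in> I" using I(1) by (auto simp: cideal_def)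
        then show ?thesis unfolding I'_def by blast
      qed
      ultimately show ?thesis using False by blast
    qed
  qed
qed

text \<open>A form of the Nullstellensatz. One coordinate after the other is made congruent to a
  constant while the ideal stays proper; then every polynomial is congruent to its value at
  \<open>z\<close>.\<close>

lemma cideal_zero_exists:
  fixes I :: "'n::finite cpoly set"
  assumes I: "cideal I" "1 \<notin> I" and alg: "\<And>j. \<exists>P. P \<noteq> 0 \<and> poly_at P j \<in> I"
  obtains z where "\<And>f. f \<in> I \<Longrightarrow> pev f z = 0"
proof -
  have "\<exists>I' z. cideal I' \<and> I \<subseteq> I' \<and> 1 \<notin> I' \<and> (\<forall>j\<in>A. Var j - Const (z $ j) \<in> I')" if "finite A" for A :: "'n set"
    using that
  proof (induction rule: finite_induct)
    case empty
    show ?case using I by auto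
  next
    case (insert k A)
    then obtain I' z where I': "cideal I'" "I \<subseteq> I'" "1 \<notin> I'" "\<forall>j\<in>A. Var j - Const (z $ j) \<in> I'" by blast
    obtain P where "P \<noteq> 0" "poly_at P k \<in> I'" using alg I'(2) by blast
    then obtain I'' r where I'': "cideal I''" "I' \<subseteq> I''" "1 \<notin> I''" "Var k - Const r \<in> I''"
      using cideal_add_linear[OF I'(1,3)] by metis
    have "\<forall>j\<in>insert k A. Var j - Const ((\<chi> i. if i = k then r else z $ i) $ j) \<in> I''"
      using I' I'' by auto
    then show ?case using I'' I'(2) by blast
  qed
  from this[OF finite[of UNIV]] obtain I' z where I': "cideal I'" "I \<subseteq> I'" "1 \<notin> I'" "\<And>j. Var j - Const (z $ j) \<in> I'"
    by (metis UNIV_I)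
  have key: "f - Const (pev f z) \<in> I'" for f
  proof (induction f rule: cpoly_induct)
    case (Const c)
    show ?case using I'(1) by (simp add: cideal_def)
  next
    case (add f g)
    have "f + g - Const (pev (f + g) z) = (f - Const (pev f z)) + (g - Const (pev g z))"
      by (simp add: pev_simps Const_add)
    with add I'(1) show ?case unfolding cideal_def by metis
  next
    case (mult f g)
    have "f * g - Const (pev (f * g) z) = g * (f - Const (pev f z)) + Const (pev f z) * (g - Const (pev g z))"
      by (simp add: pev_simps Const_mult algebra_simps)
    with mult I'(1) show ?case unfolding cideal_def by metis
  qed (use I' in simp)
  have "pev f z = 0" if f: "f \<in> I" for f
  proof (rule ccontr)
    assume nz: "pev f z \<noteq> 0"
    have "f + (- 1) * (f - Const (pev f z)) \<in> I'"
      using I'(1,2) key f unfolding cideal_def by blast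
    then have "Const (1 / pev f z) * Const (pev f z) \<in> I'"
      using I'(1) unfolding cideal_def by auto
    then show False using I'(3) nz by (simp flip: Const_mult)
  qed
  then show ?thesis using that by blast
qed

context invariant_basis
begin

text \<open>A point over \<open>a\<close> is a zero of the ideal \<open>I\<close> generated by the
  \<open>p i - Const (a $ i)\<close>. Averaging over \<open>W\<close> shows that \<open>I\<close> is
  proper, and the coordinates are algebraic modulo \<open>I\<close> because they are integral over
  the invariants.\<close>

lemma invariants_surjective: "\<exists>z. \<forall>i. pev (p i) z = a $ i"
proof -
  define I where "I = {\<Sum>i\<in>UNIV. (p i - Const (a $ i)) * s i | s. True}"
  have memI: "(\<Sum>i\<in>UNIV. (p i - Const (a $ i)) * s i) \<in> I" for s unfolding I_def by blast
  have I: "cideal I"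
    unfolding cideal_def
  proof (intro conjI ballI allI)
    show "0 \<in> I" using memI[of "\<lambda>_. 0"] by simp
  next
    fix f g assume "f \<in> I" "g \<in> I"
    then obtain s t where "f = (\<Sum>i\<in>UNIV. (p i - Const (a $ i)) * s i)" "g = (\<Sum>i\<in>UNIV. (p i - Const (a $ i)) * t i)"
      unfolding I_def by blast
    then show "f + g \<in> I" using memI[of "\<lambda>i. s i + t i"] by (simp add: sum.distrib distrib_left)
  next
    fix f g assume "f \<in> I"
    then obtain s where "f = (\<Sum>i\<in>UNIV. (p i - Const (a $ i)) * s i)" unfolding I_def by blast
    then show "g * f \<in> I" using memI[of "\<lambda>i. g * s i"] by (simp add: sum_distrib_left mult.left_commute)
  qed
  have one: "1 \<notin> I"
  proof
    assume "1 \<in> I"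
    then obtain s where s: "1 = (\<Sum>i\<in>UNIV. (p i - Const (a $ i)) * s i)" unfolding I_def by blast
    have "\<exists>g. orbit_sum (s i) = poly_subst p g" for i
      using orbit_sum_invariant by (metis invariantE)
    then obtain g where g: "\<And>i. orbit_sum (s i) = poly_subst p (g i)" by metis
    have pw: "pact w (p i - Const (a $ i)) = p i - Const (a $ i)" if "w \<in> W" for w i
      using p_invariant[of i] that unfolding invariant_ring_iff by (simp add: pact_def poly_subst_simps)
    have "orbit_sum 1 = (\<Sum>w\<in>W. \<Sum>i\<in>UNIV. (p i - Const (a $ i)) * pact w (s i))"
      unfolding orbit_sum_def
    proof (rule sum.cong[OF refl])
      fix w assume w: "w \<in> W"
      show "pact w 1 = (\<Sum>i\<in>UNIV. (p i - Const (a $ i)) * pact w (s i))"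
        by (subst s) (simp add: pact_sum pact_mult pw[OF w])
    qed
    also have "\<dots> = (\<Sum>i\<in>UNIV. (p i - Const (a $ i)) * orbit_sum (s i))"
      unfolding orbit_sum_def sum_distrib_left by (rule sum.swap)
    also have "\<dots> = poly_subst p (\<Sum>i\<in>UNIV. (Var i - Const (a $ i)) * g i)"
      by (simp add: g poly_subst_simps)
    finally have "orbit_sum 1 = poly_subst p (\<Sum>i\<in>UNIV. (Var i - Const (a $ i)) * g i)" .
    moreover have "orbit_sum 1 = poly_subst p (Const (of_nat (card W)))"
      unfolding poly_subst_Const by (simp add: orbit_sum_def pact_def Const_of_nat)
    ultimately have "poly_subst p (Const (of_nat (card W))) = poly_subst p (\<Sum>i\<in>UNIV. (Var i - Const (a $ i)) * g i)"
      by (simp only:)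
    then have "Const (of_nat (card W)) = (\<Sum>i\<in>UNIV. (Var i - Const (a $ i)) * g i)"
      by (simp only: poly_subst_p_inject)
    \<comment> \<open>At \<open>a\<close> all terms on the right vanish.\<close>
    from arg_cong[OF this, of "\<lambda>f. pev f a"] have "card W = 0" by (simp add: pev_simps)
    then show False using finite_W one_in by auto
  qed
  have sub: "poly_subst p g - Const (pev g a) \<in> I" for g
  proof (induction g rule: cpoly_induct)
    case (Const c)
    show ?case using I by (simp add: cideal_def)
  next
    case (Var j)
    have "(\<Sum>i\<in>UNIV. (p i - Const (a $ i)) * (if i = j then 1 else 0)) = p j - Const (a $ j)"
      by (simp add: if_distrib cong: if_cong)
    then show ?case using memI[of "\<lambda>i. if i = j then 1 else 0"] by simp
  next
    case (add f g)
    have "poly_subst p (f + g) - Const (pev (f + g) a) = (poly_subst p f - Const (pev f a)) + (poly_subst p g - Const (pev g a))"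
      by (simp add: pev_simps Const_add poly_subst_simps)
    with add I show ?case unfolding cideal_def by metis
  next
    case (mult f g)
    have "poly_subst p (f * g) - Const (pev (f * g) a)
        = poly_subst p g * (poly_subst p f - Const (pev f a)) + Const (pev f a) * (poly_subst p g - Const (pev g a))"
      by (simp add: pev_simps Const_mult poly_subst_simps algebra_simps)
    with mult I show ?case unfolding cideal_def by metis
  qed
  have "\<exists>P. P \<noteq> 0 \<and> poly_at P j \<in> I" for j
  proof -
    \<comment> \<open>The orbit polynomial of the coordinate \<open>Var j\<close>. Its coefficients
      are invariants, and invariants are congruent to constants modulo \<open>I\<close>.\<close>
    define P where "P = (\<Prod>w\<in>W. [:- pact w (Var j), 1:])"
    have evP: "pev (coeff (\<Prod>w\<in>A. [:- pact w (Var j), 1:]) k) x = coeff (\<Prod>w\<in>A. [:- (act w x $ j), 1:]) k" if "finite A" for A k x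
      using that
    proof (induction A arbitrary: k rule: finite_induct)
      case (insert w A)
      then show ?case by (cases k) (simp_all add: pev_simps pev_pact)
    qed simp
    have "coeff P k \<in> invariant_ring W" for k
      unfolding invariant_ring_iff
    proof
      fix v assume v: "v \<in> W"
      show "pact v (coeff P k) = coeff P k"
      proof (rule pev_eqI)
        fix x
        have "(\<Prod>w\<in>W. [:- (act w (act v x) $ j), 1:]) = (\<Prod>w\<in>W. [:- (act (w ** v) x $ j), 1:])"
          by (simp add: act_mult)
        also have "\<dots> = (\<Prod>w\<in>W. [:- (act w x $ j), 1:])"
          using prod.reindex_bij_betw[OF right_mult_bij[OF v], of "\<lambda>w. [:- (act w x $ j), 1:]"] .
        finally show "pev (pact v (coeff P k)) x = pev (coeff P k) x"
          unfolding P_def by (simp only: pev_pact evP[OF finite_W])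
      qed
    qed
    then have "\<exists>g. coeff P k = poly_subst p g" for k by (metis invariantE)
    then obtain g where g: "\<And>k. coeff P k = poly_subst p (g k)" by metis
    define n where "n = card W"
    define c where "c = (\<lambda>k. pev (g k) a)"
    have degP: "degree P = n" unfolding P_def n_def by (subst degree_prod_eq_sum_degree) auto
    have "lead_coeff P = 1" unfolding P_def by (simp add: lead_coeff_prod)
    then have "poly_subst p (g n) = poly_subst p 1" using g[of n] degP by simp
    then have cn: "c n = 1" unfolding poly_subst_p_inject by (simp add: c_def)
    define Q where "Q = (\<Sum>k\<le>n. monom (c k) k)"
    have "coeff Q n = 1" unfolding Q_def by (simp add: coeff_sum cn)
    then have "Q \<noteq> 0" by auto
    have "poly P (Var j) = 0"
    proof -
      have "pact (mat 1) (Var j) = Var j" by (rule pev_eqI) (simp add: pev_pact)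
      then have "poly [:- pact (mat 1) (Var j), 1:] (Var j) = 0" by simp
      then show ?thesis unfolding P_def poly_prod by (rule prod_zero[OF finite_W bexI[OF _ one_in]])
    qed
    then have "(\<Sum>k\<le>n. poly_subst p (g k) * Var j ^ k) = 0"
      by (simp add: poly_altdef degP g)
    moreover have "poly_at Q j = (\<Sum>k\<le>n. Const (c k) * Var j ^ k)"
      by (rule pev_eqI) (simp add: pev_poly_at pev_simps Q_def poly_sum poly_monom)
    ultimately have "poly_at Q j = (\<Sum>k\<le>n. (- (Var j ^ k)) * (poly_subst p (g k) - Const (c k)))"
      by (simp add: algebra_simps sum_subtractf)
    also have "\<dots> \<in> I"
    proof -
      have "(\<Sum>k\<in>A. (- (Var j ^ k)) * (poly_subst p (g k) - Const (c k))) \<in> I" if "finite A" for A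
        using that
      proof (induction rule: finite_induct)
        case empty
        show ?case using I by (simp add: cideal_def)
      next
        case (insert x F)
        have "(- (Var j ^ x)) * (poly_subst p (g x) - Const (c x)) \<in> I"
          using I sub[of "g x"] unfolding cideal_def c_def by blast
        then show ?case
          unfolding sum.insert[OF insert(1,2)] using insert.IH I unfolding cideal_def by blast
      qed
      then show ?thesis by blast
    qed
    finally show ?thesis using \<open>Q \<noteq> 0\<close> by blast
  qed
  then obtain z where z: "\<And>f. f \<in> I \<Longrightarrow> pev f z = 0" using cideal_zero_exists[OF I one] by metis
  have "pev (p i) z = a $ i" for i
    using z[OF sub[of "Var i"]] by (simp add: pev_simps)
  then show ?thesis by blast
qed

end

section \<open>Regular vectors on the zero line of the lower invariants\<close>

text \<open>The fixed vectors form a stable subspace, so a nonzero one makes the action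
  trivial.\<close>

lemma irreducible_no_fixed_vector:
  assumes irr: "irreducible_action W" and v: "v \<noteq> 0" and fixed: "\<And>w. w \<in> W \<Longrightarrow> w *v v = v"
  shows "W \<subseteq> {mat 1}"
proof -
  define U where "U = {v. \<forall>w\<in>W. w *v v = v}"
  have "subspace U"
    unfolding U_def subspace_def by (auto simp: matrix_vector_right_distrib matrix_vector_mult_scaleR)
  moreover have "w *v u \<in> U" if "w \<in> W" "u \<in> U" for w u
    using that by (simp add: U_def)
  moreover have "v \<in> U" using fixed by (simp add: U_def)
  ultimately have "U = UNIV" using irr v unfolding irreducible_action_def by blast
  then have "w *v x = mat 1 *v x" if "w \<in> W" for w x using that by (auto simp: U_def)
  then show ?thesis by (auto simp: matrix_eq)
qed

definition re_vec :: "complex^'n \<Rightarrow> real^'n" where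
  "re_vec x = (\<chi> i. Re (x $ i))"

definition im_vec :: "complex^'n \<Rightarrow> real^'n" where
  "im_vec x = (\<chi> i. Im (x $ i))"

lemma re_vec_act: "re_vec (act w x) = w *v re_vec x"
  and im_vec_act: "im_vec (act w x) = w *v im_vec x"
  by (simp_all add: re_vec_def im_vec_def act_def matrix_vector_mult_def)

lemma act_rvec: "act w (rvec x) = rvec (w *v x)"
  by (simp add: act_def matrix_vector_mult_def vec_eq_iff)

lemma irreducible_no_fixed_cv:
  assumes "irreducible_action W" "x \<noteq> 0" "\<And>w. w \<in> W \<Longrightarrow> act w x = x"
  shows "W \<subseteq> {mat 1}"
proof (cases "re_vec x = 0")
  case False
  with assms show ?thesis
    by (intro irreducible_no_fixed_vector[of W "re_vec x"]) (simp_all flip: re_vec_act)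
next
  case True
  with assms(2) have "im_vec x \<noteq> 0"
    by (auto simp: re_vec_def im_vec_def vec_eq_iff complex_eq_iff)
  with assms show ?thesis
    by (intro irreducible_no_fixed_vector[of W "im_vec x"]) (simp_all flip: im_vec_act)
qed

lemma cis_root_power_eq_1:
  assumes "k < h" "cis (2 * pi / real h) ^ k = 1"
  shows "k = 0"
proof -
  have "inj_on (\<lambda>k. cis (2 * pi * real k / real h)) {..<h}"
    using bij_betw_roots_unity[of h] assms(1) by (auto simp: bij_betw_def)
  moreover have "cis (2 * pi * real k / real h) = cis (2 * pi * real 0 / real h)"
    using assms(2) by (simp add: DeMoivre mult.commute)
  ultimately show ?thesis by (rule inj_onD) (use assms(1) in auto)
qed

lemma cis_root_power: "h > 0 \<Longrightarrow> cis (2 * pi / real h) ^ h = 1"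
  by (simp add: DeMoivre)

text \<open>\<open>mono_d\<close> gives the last index the top degree. \<open>nontrivial\<close>
  sets aside the trivial group, which acts irreducibly on a line only and has a linear basic
  invariant there.\<close>

locale irreducible_invariants = invariant_basis W d p
  for W :: "'n::{finite,linorder} rmat set" and d p +
  assumes irr: "irreducible_action W" and mono_d: "mono d" and nontrivial: "W \<noteq> {mat 1}"
begin

abbreviation l :: 'n where "l \<equiv> Max UNIV"

text \<open>The exponents of the group, as integers because their differences occur as
  weights.\<close>

definition e :: "'n \<Rightarrow> int" where "e i = int (d i) - 1"

lemma weight_p: "weight (int (d i)) (p i)"
  using basic by (auto simp: basic_invariants_def intro: weight_homogeneous)

lemma weight_pdiff_p: "weight (e i) (pdiff j (p i))"
  using weight_pdiff[OF weight_p] by (simp add: e_def)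

lemma p_not_Const: "p i \<noteq> Const c"
proof
  assume "p i = Const c"
  then have "poly_subst p (Var i) = poly_subst p (Const c)" by simp
  then have "Var i = Const c" by (simp only: poly_subst_p_inject)
  then show False by (metis pdiff_Const pdiff_Var zero_neq_one)
qed

text \<open>A linear invariant would have a constant gradient fixed by \<open>W\<close>.\<close>

lemma degree_ge_2: "d i \<ge> 2"
proof (rule ccontr)
  assume "\<not> ?thesis"
  then consider "d i = 0" | "d i = 1" by linarith
  then show False
  proof cases
    case 1
    then show False using weight_0_imp_Const[of "p i"] weight_p[of i] p_not_Const by auto
  next
    case 2
    then have "weight 0 (pdiff j (p i))" for j using weight_pdiff_p[of i j] by (simp add: e_def)
    then have c: "pdiff j (p i) = Const (pev (pdiff j (p i)) 0)" for j by (rule weight_0_imp_Const)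
    have const: "grad (p i) x = grad (p i) 0" for x
      unfolding grad_def vec_eq_iff by (subst c) simp
    show False
    proof (cases "grad (p i) 0 = 0")
      case True
      then have "pdiff j (p i) = 0" for j using c[of j] by (simp add: vec_eq_iff)
      then show False using pdiff_all_0_imp_Const p_not_Const by blast
    next
      case False
      have "act w (grad (p i) 0) = grad (p i) 0" if "w \<in> W" for w
        using grad_invariant[OF p_invariant that, of i 0] by simp
      then have "W \<subseteq> {mat 1}" using irreducible_no_fixed_cv[OF irr False] by blast
      then show False using nontrivial one_in by blast
    qed
  qed
qed

lemma e_pos: "e i \<ge> 1"
  using degree_ge_2[of i] by (simp add: e_def)

lemma degree_le: "d i \<le> d l"
  using mono_d by (auto simp: mono_def)

lemma e_le: "e i \<le> e l"
  using degree_le[of i] by (simp add: e_def)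

lemma gradient_coeffs_unique:
  assumes "\<And>j. (\<Sum>i\<in>UNIV. f i * pdiff j (p i)) = 0"
  shows "f i = 0"
  by (rule row_mult_cancel[of f "jacobian p"]) (use assms Jdet_nonzero in \<open>simp_all add: jacobian_def Jdet_def\<close>)

text \<open>The scaling of the field passes to the coefficients by their uniqueness. A single
  \<open>t\<close> is considered because the averaged field in \<open>regular_zero_exists\<close> is
  homogeneous only with respect to roots of unity.\<close>

lemma gradient_coeffs_scale:
  assumes a: "\<And>j. a $ j = (\<Sum>i\<in>UNIV. f i * pdiff j (p i))" and t: "t \<noteq> 0"
    and sc: "\<And>j x. pev (a $ j) (t *s x) = c * pev (a $ j) x"
  shows "pev (f i) (t *s x) = c * t powi (- e i) * pev (f i) x"
proof -
  have "Const (t powi e i) * pscale t (f i) - Const c * f i = 0" for i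
  proof (rule gradient_coeffs_unique[of "\<lambda>i. Const (t powi e i) * pscale t (f i) - Const c * f i"], rule pev_eqI)
    fix j x
    have "pev (\<Sum>i\<in>UNIV. (Const (t powi e i) * pscale t (f i) - Const c * f i) * pdiff j (p i)) x
       = (\<Sum>i\<in>UNIV. pev (f i) (t *s x) * (t powi e i * pev (pdiff j (p i)) x)) - c * (\<Sum>i\<in>UNIV. pev (f i) x * pev (pdiff j (p i)) x)"
      by (simp add: pev_simps pev_pscale sum_subtractf sum_distrib_left algebra_simps)
    also have "\<dots> = (\<Sum>i\<in>UNIV. pev (f i) (t *s x) * pev (pdiff j (p i)) (t *s x)) - c * (\<Sum>i\<in>UNIV. pev (f i) x * pev (pdiff j (p i)) x)"
      by (simp add: weightD[OF weight_pdiff_p t])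
    also have "\<dots> = pev (a $ j) (t *s x) - c * pev (a $ j) x"
      by (simp add: a pev_simps)
    finally show "pev (\<Sum>i\<in>UNIV. (Const (t powi e i) * pscale t (f i) - Const c * f i) * pdiff j (p i)) x = pev 0 x"
      using sc by simp
  qed
  from arg_cong[OF this[of i], of "\<lambda>f. pev f x"]
  have "t powi e i * pev (f i) (t *s x) = c * pev (f i) x" by (simp add: pev_simps pev_pscale)
  then show ?thesis using t by (simp add: power_int_minus field_simps)
qed

lemma gradient_coeffs_weight:
  assumes "\<And>j. a $ j = (\<Sum>i\<in>UNIV. f i * pdiff j (p i))" and "\<And>j. weight k (a $ j)"
  shows "weight (k - e i) (f i)"
  unfolding weight_def
proof (intro allI impI)
  fix t x assume t: "t \<noteq> (0 :: complex)"
  have "pev (f i) (t *s x) = t powi k * t powi (- e i) * pev (f i) x"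
    by (rule gradient_coeffs_scale[OF assms(1) t]) (rule weightD[OF assms(2) t])
  then show "pev (f i) (t *s x) = t powi (k - e i) * pev (f i) x"
    using t by (simp flip: power_int_add)
qed

text \<open>The Hessian of a quadratic invariant commutes with \<open>W\<close>. It may be complex,
  so Schur's lemma is applied to its real and imaginary parts.\<close>

lemma quadratic_gradient:
  assumes di: "d i = 2"
  shows "\<exists>c. \<forall>x. grad (p i) x = c *s x"
proof -
  define H where "H = (\<lambda>j k. pev (pdiff k (pdiff j (p i))) 0)"
  have "weight 0 (pdiff k (pdiff j (p i)))" for j k
    using weight_pdiff[OF weight_pdiff_p[of i j], of k] di by (simp add: e_def)
  then have H: "pdiff k (pdiff j (p i)) = Const (H j k)" for j k
    unfolding H_def by (rule weight_0_imp_Const)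
  have gr: "grad (p i) x $ j = (\<Sum>k\<in>UNIV. H j k * x $ k)" for x j
  proof -
    have "weight 1 (pdiff j (p i))" using weight_pdiff_p[of i j] di by (simp add: e_def)
    from euler[OF this, of x] show ?thesis by (simp add: cdot_def H)
  qed
  have Hsym: "H j k = H k j" for j k unfolding H_def by (simp add: pdiff_commute)
  have schur: "\<exists>c. \<forall>x. (\<chi> j k. g (H j k)) *v x = c *\<^sub>R x"
    if g: "\<And>y. (\<chi> j. g (y $ j)) = gv y" and gact: "\<And>w y. gv (act w y) = w *v gv y"
      and glin: "\<And>u v. g (\<Sum>k\<in>(UNIV :: 'n set). u k * complex_of_real (v k)) = (\<Sum>k\<in>UNIV. g (u k) * v k)"
    for g :: "complex \<Rightarrow> real" and gv :: "'n cv \<Rightarrow> (real, 'n) vec"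
  proof (rule schur_symmetric[OF irr])
    have mv: "(\<chi> j k. g (H j k)) *v x = gv (grad (p i) (rvec x))" for x
      unfolding g[symmetric] by (simp only: gr rvec_nth glin) (simp add: matrix_vector_mult_def)
    fix w x assume "w \<in> W"
    then show "(\<chi> j k. g (H j k)) *v (w *v x) = w *v ((\<chi> j k. g (H j k)) *v x)"
      unfolding mv by (simp add: grad_invariant[OF p_invariant] gact flip: act_rvec)
  qed (simp add: Hsym)
  obtain a where a: "\<And>x. (\<chi> j k. Re (H j k)) *v x = a *\<^sub>R x"
    using schur[of Re re_vec] re_vec_act by (auto simp: re_vec_def)
  obtain b where b: "\<And>x. (\<chi> j k. Im (H j k)) *v x = b *\<^sub>R x"
    using schur[of Im im_vec] im_vec_act by (auto simp: im_vec_def)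
  have ax: "((\<chi> j k. g j k) *v axis k 1) $ j = g j k" for g :: "'n \<Rightarrow> 'n \<Rightarrow> real" and j k
    by (simp add: matrix_vector_mult_def axis_def if_distrib cong: if_cong)
  have HR: "Re (H j k) = (if j = k then a else 0)" "Im (H j k) = (if j = k then b else 0)" for j k
    using arg_cong[OF a[of "axis k 1"], of "\<lambda>v. v $ j"] arg_cong[OF b[of "axis k 1"], of "\<lambda>v. v $ j"]
    by (simp_all only: ax) (simp_all add: axis_def)
  have Hc: "H j k = (if j = k then Complex a b else 0)" for j k
    using HR[of j k] by (simp add: complex_eq_iff)
  have "grad (p i) x = Complex a b *s x" for x
    unfolding vec_eq_iff gr Hc by (simp add: if_distrib if_distribR cong: if_cong)
  then show ?thesis by blast
qed

text \<open>When the Euler field is expanded in the gradients, the coefficient of index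
  \<open>i\<close> has weight \<open>1 - e i\<close>, which is negative unless
  \<open>d i = 2\<close>. Two quadratic basic invariants would have dependent gradients.\<close>

lemma quadratic_invariant:
  obtains q c where "d q = 2" "c \<noteq> 0" "\<And>x. grad (p q) x = c *s x" "\<And>i. d i = 2 \<Longrightarrow> i = q"
proof -
  have "equivariant (\<chi> j. Var j)" by (simp add: equivariant_def vec_eq_iff)
  then obtain f where f: "\<And>j. (\<chi> j. Var j) $ j = (\<Sum>i\<in>UNIV. f i * pdiff j (p i))"
    by (metis equivariantE)
  have "weight 1 ((\<chi> j. Var j) $ j)" for j by (simp add: weight_def)
  note wf = gradient_coeffs_weight[OF f this]
  have "\<exists>i. f i \<noteq> 0"
  proof (rule ccontr)
    assume "\<not> ?thesis"
    then have "Var l = (0 :: 'n cpoly)" using f[of l] by simp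
    then show False by (metis pdiff_0 pdiff_Var zero_neq_one)
  qed
  then obtain q where "f q \<noteq> 0" by blast
  then have "1 - e q \<ge> 0" using wf[of q] weight_negative by (metis not_le)
  then have dq: "d q = 2" using degree_ge_2[of q] by (simp add: e_def)
  have nz: "c \<noteq> 0" if "\<And>x. grad (p i) x = c *s x" for i c
  proof
    assume "c = 0"
    then have "pdiff j (p i) = 0" for j
      using that by (intro pev_eqI) (simp add: vec_eq_iff)
    then show False using pdiff_all_0_imp_Const p_not_Const by blast
  qed
  obtain c where c: "\<And>x. grad (p q) x = c *s x" using quadratic_gradient[OF dq] by blast
  have "i = q" if di: "d i = 2" for i
  proof (rule ccontr)
    assume "i \<noteq> q"
    obtain b where b: "\<And>x. grad (p i) x = b *s x" using quadratic_gradient[OF di] by blast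
    have "(\<Sum>r\<in>UNIV. (if r = q then Const b else if r = i then - Const c else 0) * pdiff j (p r)) = 0" for j
    proof -
      have "(\<Sum>r\<in>UNIV. (if r = q then Const b else if r = i then - Const c else 0) * pdiff j (p r))
         = (\<Sum>r\<in>UNIV. (if r = q then Const b * pdiff j (p q) else 0) + (if r = i then - Const c * pdiff j (p i) else 0))"
        using \<open>i \<noteq> q\<close> by (intro sum.cong) auto
      also have "\<dots> = Const b * pdiff j (p q) - Const c * pdiff j (p i)" by (simp add: sum.distrib)
      also have "\<dots> = 0"
      proof (rule pev_eqI)
        fix x
        have "pev (pdiff j (p q)) x = c * x $ j" "pev (pdiff j (p i)) x = b * x $ j"
          using b[of x] c[of x] by (metis grad_nth vector_smult_component)+
        then show "pev (Const b * pdiff j (p q) - Const c * pdiff j (p i)) x = pev 0 x" by (simp add: pev_simps)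
      qed
      finally show ?thesis .
    qed
    from gradient_coeffs_unique[OF this, of q] nz[OF b] show False by simp
  qed
  with dq c nz[OF c] that show ?thesis by blast
qed

text \<open>The common zero line of the lower degree invariants consists of regular vectors. At a point
  \<open>z\<close> of that line, an equivariant vector field of degree congruent to 1 modulo the top degree has
  the same 1-jet, in the directions that kill all invariants, as a multiple of the Euler field. Averaging
  over \<open>W\<close> and the roots of unity produces such a field that is constant to first order, so there are no
  such directions.\<close>

lemma regular_zero_exists:
  obtains z where "\<And>i. i \<noteq> l \<Longrightarrow> pev (p i) z = 0" "pev (p l) z = 1" "pev Jdet z \<noteq> 0"
proof -
  obtain z where z: "\<And>i. pev (p i) z = axis l 1 $ i" using invariants_surjective by metis
  have z1: "pev (p i) z = 0" if "i \<noteq> l" for i using z[of i] that by (simp add: axis_def)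
  have z2: "pev (p l) z = 1" using z[of l] by simp
  define h where "h = d l"
  have h: "h > 0" using degree_ge_2[of l] by (simp add: h_def)
  define \<omega> where "\<omega> = cis (2 * pi / real h)"
  have \<omega>0: "\<omega> \<noteq> 0" by (simp add: \<omega>_def)
  have \<omega>h: "\<omega> ^ h = 1" using cis_root_power[OF h] by (simp add: \<omega>_def)
  have z0: "z \<noteq> 0"
  proof
    assume "z = 0"
    then have "pev (p l) z = 2 ^ h * pev (p l) z"
      using weightD[OF weight_p[of l], of 2 z] by (simp add: h_def)
    then have "(2 :: complex) ^ h = 1" using z2 by simp
    then have "(2 :: nat) ^ h = 1" by (metis of_nat_1 of_nat_eq_iff of_nat_numeral of_nat_power)
    then show False using h by simp
  qed
  \<comment> \<open>The points other than \<open>z\<close> in its orbit under \<open>W\<close> and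
    the multiplications by roots of unity.\<close>
  define F where "F = (\<lambda>(k, w). \<omega> ^ k *s act w z) ` ({..<h} \<times> W) - {z}"
  have "finite F" "z \<notin> F" using finite_W by (auto simp: F_def)
  then obtain f where f: "pev f z = 1" "grad f z = 0" "\<And>a. a \<in> F \<Longrightarrow> pev f a = 0" "\<And>a. a \<in> F \<Longrightarrow> grad f a = 0"
    using bump by metis
  have fF: "pev f (\<omega> ^ k *s act w z) = (if \<omega> ^ k *s act w z = z then 1 else 0)" "grad f (\<omega> ^ k *s act w z) = 0"
    if "w \<in> W" "k < h" for w k
  proof -
    have "\<omega> ^ k *s act w z = z \<or> \<omega> ^ k *s act w z \<in> F" using that by (force simp: F_def)
    then show "pev f (\<omega> ^ k *s act w z) = (if \<omega> ^ k *s act w z = z then 1 else 0)" "grad f (\<omega> ^ k *s act w z) = 0"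
      using f \<open>z \<notin> F\<close> by auto
  qed
  \<comment> \<open>The factor \<open>inverse (\<omega> ^ k)\<close> makes the average scale by
    \<open>\<omega>\<close> under the dilation by \<open>\<omega>\<close>, as the Euler field
    does.\<close>
  define \<theta> :: "('n cpoly, 'n) vec" where
    "\<theta> = (\<chi> j. \<Sum>w\<in>W. \<Sum>k<h. pscale (\<omega> ^ k) (pact w f) * Const (inverse (\<omega> ^ k) * act (transpose w) z $ j))"
  have pev\<theta>: "(\<chi> j. pev (\<theta> $ j) x)
      = (\<Sum>w\<in>W. \<Sum>k<h. (pev f (\<omega> ^ k *s act w x) * inverse (\<omega> ^ k)) *s act (transpose w) z)" for x
    by (simp add: \<theta>_def vec_eq_iff pev_simps pev_pscale pev_pact act_scale mult.assoc)
  have "equivariant \<theta>"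
    unfolding equivariant_def
  proof (intro ballI allI)
    fix u x assume u: "u \<in> W"
    define G where "G = (\<lambda>w. \<Sum>k<h. (pev f (\<omega> ^ k *s act w x) * inverse (\<omega> ^ k)) *s act u (act (transpose w) z))"
    have "(\<Sum>k<h. (pev f (\<omega> ^ k *s act w (act u x)) * inverse (\<omega> ^ k)) *s act (transpose w) z) = G (w ** u)" for w
      by (simp add: G_def act_mult matrix_transpose_mul act_transpose(2)[OF orth[OF u]])
    then have "(\<chi> j. pev (\<theta> $ j) (act u x)) = (\<Sum>w\<in>W. G (w ** u))"
      unfolding pev\<theta> by simp
    also have "\<dots> = (\<Sum>w\<in>W. G w)" by (rule sum.reindex_bij_betw[OF right_mult_bij[OF u]])
    also have "\<dots> = act u (\<chi> j. pev (\<theta> $ j) x)"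
      unfolding pev\<theta> G_def by (simp add: act_sum act_scale)
    finally show "(\<chi> j. pev (\<theta> $ j) (act u x)) = act u (\<chi> j. pev (\<theta> $ j) x)" .
  qed
  then obtain g where g: "\<And>i. g i \<in> invariant_ring W" "\<And>j. \<theta> $ j = (\<Sum>i\<in>UNIV. g i * pdiff j (p i))"
    using equivariantE by metis
  have \<theta>scale: "(\<chi> j. pev (\<theta> $ j) (\<omega> *s x)) = \<omega> *s (\<chi> j. pev (\<theta> $ j) x)" for x
  proof -
    have "(\<Sum>k<h. (pev f (\<omega> ^ k *s act w (\<omega> *s x)) * inverse (\<omega> ^ k)) *s act (transpose w) z)
        = \<omega> *s (\<Sum>k<h. (pev f (\<omega> ^ k *s act w x) * inverse (\<omega> ^ k)) *s act (transpose w) z)" for w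
    proof -
      define G where "G = (\<lambda>k. (pev f (\<omega> ^ k *s act w x) * inverse (\<omega> ^ k)) *s act (transpose w) z)"
      have "(pev f (\<omega> ^ k *s act w (\<omega> *s x)) * inverse (\<omega> ^ k)) *s act (transpose w) z = \<omega> *s G (Suc k)" for k
        using \<omega>0 by (simp add: G_def act_scale vector_smult_assoc mult.commute mult.left_commute)
      moreover have "(\<Sum>k<h. G (Suc k)) = (\<Sum>k<h. G k)"
      proof -
        have "G h = G 0" by (simp add: G_def \<omega>h)
        then show ?thesis using sum.lessThan_Suc_shift[of G h] sum.lessThan_Suc[of G h] by simp
      qed
      ultimately have "(\<Sum>k<h. (pev f (\<omega> ^ k *s act w (\<omega> *s x)) * inverse (\<omega> ^ k)) *s act (transpose w) z)
          = \<omega> *s (\<Sum>k<h. G k)"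
        by (simp only: vec.scale_sum_right[symmetric])
      then show ?thesis by (simp only: G_def)
    qed
    then show ?thesis unfolding pev\<theta> by (simp add: vec.scale_sum_right)
  qed
  \<comment> \<open>As only \<open>p l\<close> is nonzero at \<open>z\<close>, invariants take the
    same value at \<open>z\<close> and \<open>\<omega> *s z\<close>. But \<open>g i\<close> scales
    by the power \<open>1 - e i\<close> of \<open>\<omega>\<close>, and
    \<open>e i - 1 = d i - 2\<close> lies between 0 and \<open>h - 1\<close>.\<close>
  have gz: "pev (g i) z = 0" if "d i \<noteq> 2" for i
  proof -
    obtain G where G: "g i = poly_subst p G" using g(1) invariantE by metis
    have "pev (p k) (\<omega> *s z) = pev (p k) z" for k
      using weightD[OF weight_p[of k] \<omega>0, of z] z1[of k] \<omega>h by (cases "k = l") (auto simp: h_def)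
    then have "pev (g i) (\<omega> *s z) = pev (g i) z" by (simp add: G pev_poly_subst)
    moreover have "pev (g i) (\<omega> *s z) = \<omega> * \<omega> powi (- e i) * pev (g i) z"
    proof (rule gradient_coeffs_scale[OF g(2) \<omega>0])
      show "pev (\<theta> $ j) (\<omega> *s x) = \<omega> * pev (\<theta> $ j) x" for j x
        using arg_cong[OF \<theta>scale[of x], of "\<lambda>v. v $ j"] by simp
    qed
    moreover have "\<omega> * \<omega> powi (- e i) \<noteq> 1"
    proof
      assume "\<omega> * \<omega> powi (- e i) = 1"
      then have "\<omega> powi e i = \<omega>" using \<omega>0 by (simp add: power_int_minus field_simps)
      then have "\<omega> powi (e i - 1) = 1" using \<omega>0 by (simp add: power_int_diff)
      moreover have "e i - 1 = int (d i - 2)" using degree_ge_2[of i] by (simp add: e_def)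
      ultimately have "\<omega> ^ (d i - 2) = 1" by simp
      moreover have "d i - 2 < h" using degree_le[of i] degree_ge_2[of i] by (simp add: h_def)
      ultimately have "d i - 2 = 0" using cis_root_power_eq_1 unfolding \<omega>_def by blast
      then show False using degree_ge_2[of i] that by simp
    qed
    ultimately show ?thesis by (metis mult_cancel_right1 mult.commute)
  qed
  obtain q c where q: "d q = 2" "c \<noteq> 0" "\<And>x. grad (p q) x = c *s x" "\<And>i. d i = 2 \<Longrightarrow> i = q"
    using quadratic_invariant by metis
  have gq: "pev (g i) z = 0" if "i \<noteq> q" for i using gz[of i] q(4) that by blast
  have pq: "pdiff j (p q) = Const c * Var j" for j
  proof (rule pev_eqI)
    show "pev (pdiff j (p q)) x = pev (Const c * Var j) x" for x
      using arg_cong[OF q(3)[of x], of "\<lambda>v. v $ j"] by (simp add: pev_simps)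
  qed
  have \<theta>z: "(\<chi> j. pev (\<theta> $ j) z) = (pev (g q) z * c) *s z"
  proof -
    have "pev (\<theta> $ j) z = (\<Sum>i\<in>UNIV. if i = q then pev (g q) z * c * z $ j else 0)" for j
      unfolding g(2) pev_sum by (intro sum.cong) (auto simp: pev_simps gq pq)
    then show ?thesis by (simp add: vec_eq_iff)
  qed
  \<comment> \<open>Each pair \<open>(w, k)\<close> that fixes \<open>z\<close> contributes
    \<open>z\<close> itself, and the other pairs contribute nothing.\<close>
  have "(\<chi> j. pev (\<theta> $ j) z) = of_nat (card {(w, k). w \<in> W \<and> k < h \<and> \<omega> ^ k *s act w z = z}) *s z"
  proof -
    have "(pev f (\<omega> ^ k *s act w z) * inverse (\<omega> ^ k)) *s act (transpose w) z = (if \<omega> ^ k *s act w z = z then z else 0)"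
      if wk: "w \<in> W" "k < h" for w k
    proof (cases "\<omega> ^ k *s act w z = z")
      case True
      then have "act (transpose w) z = \<omega> ^ k *s z"
        by (metis act_scale act_transpose(1) orth wk(1))
      then show ?thesis using True fF(1)[OF wk] \<omega>0 by (simp add: vector_smult_assoc)
    qed (use fF(1)[OF wk] in simp)
    then have "(\<chi> j. pev (\<theta> $ j) z) = (\<Sum>w\<in>W. \<Sum>k<h. if \<omega> ^ k *s act w z = z then z else 0)"
      unfolding pev\<theta> by (intro sum.cong) auto
    also have "\<dots> = (\<Sum>r\<in>W \<times> {..<h}. if \<omega> ^ snd r *s act (fst r) z = z then z else 0)"
      by (simp add: sum.cartesian_product case_prod_beta)
    also have "\<dots> = (\<Sum>r\<in>{r \<in> W \<times> {..<h}. \<omega> ^ snd r *s act (fst r) z = z}. z)"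
      by (rule sum.inter_filter[symmetric]) (simp add: finite_W)
    also have "{r \<in> W \<times> {..<h}. \<omega> ^ snd r *s act (fst r) z = z} = {(w, k). w \<in> W \<and> k < h \<and> \<omega> ^ k *s act w z = z}" by auto
    finally show ?thesis by (simp add: vec_eq_iff of_nat_index)
  qed
  moreover have "card {(w, k). w \<in> W \<and> k < h \<and> \<omega> ^ k *s act w z = z} \<noteq> 0"
  proof -
    have "finite {(w, k). w \<in> W \<and> k < h \<and> \<omega> ^ k *s act w z = z}"
      by (rule finite_subset[of _ "W \<times> {..<h}"]) (auto simp: finite_W)
    moreover have "(mat 1, 0) \<in> {(w, k). w \<in> W \<and> k < h \<and> \<omega> ^ k *s act w z = z}" using h one_in by simp
    ultimately show ?thesis using card_gt_0_iff[of "{(w, k). w \<in> W \<and> k < h \<and> \<omega> ^ k *s act w z = z}"] by blast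
  qed
  ultimately have gqz: "pev (g q) z \<noteq> 0" using \<theta>z z0 by auto
  have "pev Jdet z \<noteq> 0"
    unfolding Jdet_eq_0_iff
  proof
    assume "\<exists>y. y \<noteq> 0 \<and> (\<forall>i. cdot (grad (p i) z) y = 0)"
    then obtain y where y: "y \<noteq> 0" "\<And>i. cdot (grad (p i) z) y = 0" by blast
    have "y $ j = 0" for j
    proof -
      \<comment> \<open>The expansion of \<open>\<theta>\<close> is differentiated at
        \<open>z\<close> along \<open>y\<close>. The left side is constant to first order, the
        \<open>g i\<close> are constant along \<open>y\<close>, and of the Hessians only that of
        \<open>p q\<close>, which is \<open>c\<close> times the identity, has a nonzero
        coefficient.\<close>
      have "grad (\<theta> $ j) z = 0"
      proof -
        have "grad (pscale (\<omega> ^ k) (pact w f)) z = 0" if "w \<in> W" "k < h" for w k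
          by (simp add: grad_pscale grad_pact act_scale fF[OF that])
        then show ?thesis by (simp add: \<theta>_def grad_sum grad_mult)
      qed
      moreover have "cdot (grad (\<theta> $ j) z) y = (\<Sum>i\<in>UNIV. pev (g i) z * cdot (grad (pdiff j (p i)) z) y)"
        unfolding g(2) grad_sum cdot_sum_left by (simp add: grad_mult kernel_grad_invariant[OF y(2) g(1)])
      moreover have "\<dots> = (\<Sum>i\<in>UNIV. if i = q then pev (g q) z * c * y $ j else 0)"
        by (intro sum.cong) (auto simp: gq pq grad_mult)
      ultimately show ?thesis using gqz q(2) by simp
    qed
    then show False using y(1) by (simp add: vec_eq_iff)
  qed
  with z1 z2 that show ?thesis by blast
qed

end

section \<open>The derivative of the adjugate\<close>

lemma mat_mult_left: "mat c ** A = (\<chi> i j. c * A $ i $ j)"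
  by (simp add: vec_eq_iff matrix_matrix_mult_def mat_def if_distrib if_distribR cong: if_cong)

lemma mat_mult_right: "A ** mat c = (\<chi> i j. (c :: 'a::comm_semiring_1) * A $ i $ j)"
  by (simp add: vec_eq_iff matrix_matrix_mult_def mat_def if_distrib if_distribR mult.commute cong: if_cong)

lemma matrix_mult_add_left: "(A + B) ** C = A ** C + B ** C"
  by (simp add: vec_eq_iff matrix_matrix_mult_def distrib_right sum.distrib)

lemma matrix_cancel_left:
  fixes K :: "('a::idom, 'n::finite) vec^'n"
  assumes "det K \<noteq> 0" "K ** A = K ** B"
  shows "A = B"
proof -
  have "adjugate K ** (K ** A) = adjugate K ** (K ** B)" using assms by simp
  then show ?thesis
    using assms(1) by (simp add: matrix_mul_assoc adjugate_mul_matrix mat_mult_left vec_eq_iff)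
qed

definition mder :: "'n::finite cpoly^'n \<Rightarrow> 'n cpoly^'k^'m \<Rightarrow> 'n cpoly^'k^'m" where
  "mder a A = (\<chi> i j. vder a (A $ i $ j))"

lemma mder_nth [simp]: "mder a A $ i $ j = vder a (A $ i $ j)"
  by (simp add: mder_def)

lemma mder_mult: "mder a (A ** B) = mder a A ** B + A ** mder a B"
  by (simp add: vec_eq_iff matrix_matrix_mult_def vder_sum vder_mult sum.distrib mult.commute add.commute)

lemma mder_transpose: "mder a (transpose A) = transpose (mder a A)"
  by (simp add: vec_eq_iff transpose_def)

lemma vder_0 [simp]: "vder a 0 = 0"
  using vder_Const[of a 0] by simp

lemma mder_mat: "mder a (mat c) = mat (vder a c)"
  by (simp add: vec_eq_iff mat_def)

text \<open>Jacobi's formula for the logarithmic derivative of a determinant.\<close>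

lemma vder_det_mult:
  fixes A L :: "'n::finite cpoly^'m::finite^'m"
  assumes "mder a A = L ** A"
  shows "vder a (det A) = trace L * det A"
proof -
  have "det (\<chi> i. if i = k then (\<chi> j. vder a (A $ k $ j)) else A $ i) = L $ k $ k * det A" for k
  proof -
    have "det (\<chi> i. if i = k then (\<chi> j. vder a (A $ k $ j)) else A $ i) = (mder a A ** adjugate A) $ k $ k"
      by (simp add: det_replace_row matrix_matrix_mult_def)
    also have "\<dots> = L $ k $ k * det A"
      unfolding assms by (simp add: matrix_mul_assoc[symmetric] matrix_mul_adjugate mat_mult_right mult.commute)
    finally show ?thesis .
  qed
  then show ?thesis by (simp add: vder_det trace_def sum_distrib_right)
qed

text \<open>For \<open>K = J J^T\<close> one has \<open>D K = L K + K L^T\<close> and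
  \<open>D (det K) = 2 tr(L) det K\<close>. Differentiate \<open>K M = det K\<close> and cancel
  \<open>K\<close>.\<close>

lemma mder_adjugate_gram:
  fixes L J :: "'n::{finite,linorder} cpoly^'m::finite^'m"
  assumes J: "det J \<noteq> 0" and L: "mder a J = L ** J"
  defines "M \<equiv> adjugate (J ** transpose J)"
  shows "mder a M = mat (2 * trace L) ** M - M ** L - transpose L ** M"
proof -
  let ?K = "J ** transpose J"
  have dK: "det ?K \<noteq> 0" using J by (simp add: det_mul)
  have DK: "mder a ?K = L ** ?K + ?K ** transpose L"
    by (simp add: mder_mult mder_transpose L matrix_transpose_mul matrix_mul_assoc)
  have "vder a (det ?K) = 2 * trace L * det ?K"
    by (simp add: det_mul vder_mult vder_det_mult[OF L] algebra_simps)
  then have "mder a (?K ** M) = mat (2 * trace L) ** (?K ** M)"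
    unfolding M_def matrix_mul_adjugate by (simp add: mder_mat mat_mult_left) (simp add: vec_eq_iff mat_def)
  then have "L ** (?K ** M) + ?K ** (transpose L ** M) + ?K ** mder a M = mat (2 * trace L) ** (?K ** M)"
    unfolding mder_mult[of a ?K M] DK by (simp add: matrix_mult_add_left matrix_mul_assoc)
  moreover have "L ** (?K ** M) = ?K ** (M ** L)"
    unfolding M_def matrix_mul_assoc matrix_mul_adjugate
    by (simp add: matrix_mul_assoc[symmetric] matrix_mul_adjugate mat_mult_left mat_mult_right)
  moreover have "mat (2 * trace L) ** (?K ** M) = ?K ** (mat (2 * trace L) ** M)"
    by (simp add: matrix_mul_assoc mat_mult_left mat_mult_right)
       (simp add: vec_eq_iff matrix_matrix_mult_def sum_distrib_left sum_distrib_right algebra_simps)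
  ultimately have "?K ** (M ** L + transpose L ** M + mder a M) = ?K ** (mat (2 * trace L) ** M)"
    by (simp add: matrix_add_ldistrib)
  from matrix_cancel_left[OF dK this] show ?thesis by (simp add: algebra_simps)
qed

context invariant_basis
begin

abbreviation J :: "(('n cpoly, 'n) vec, 'n) vec" where "J \<equiv> jacobian p"

definition K :: "(('n cpoly, 'n) vec, 'n) vec" where "K = J ** transpose J"

definition M :: "(('n cpoly, 'n) vec, 'n) vec" where "M = adjugate K"

lemma K_nth: "K $ i $ j = (\<Sum>k\<in>UNIV. pdiff k (p i) * pdiff k (p j))"
  by (simp add: K_def matrix_matrix_mult_def jacobian_def transpose_def)

lemma pev_K: "pev (K $ i $ j) x = cdot (grad (p i) x) (grad (p j) x)"
  by (simp add: K_nth pev_simps cdot_def)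

lemma K_symmetric: "K $ i $ j = K $ j $ i"
  by (simp add: K_nth mult.commute)

lemma det_K: "det K = Jdet * Jdet"
  by (simp add: K_def det_mul Jdet_def)

lemma K_invariant: "K $ i $ j \<in> invariant_ring W"
  unfolding invariant_ring_iff
proof
  fix w assume w: "w \<in> W"
  show "pact w (K $ i $ j) = K $ i $ j"
    by (rule pev_eqI) (simp add: pev_pact pev_K grad_invariant[OF p_invariant w] cdot_act_act[OF orth[OF w]])
qed

lemma M_symmetric: "M $ i $ j = M $ j $ i"
proof -
  have "transpose K = K" by (simp add: transpose_def vec_eq_iff K_symmetric[of _ _])
  then have "transpose M = M" unfolding M_def by (metis adjugate_transpose)
  from arg_cong[OF this, of "\<lambda>A. A $ j $ i"] show ?thesis by (simp add: transpose_def)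
qed

lemma K_mult_M: "(\<Sum>i\<in>UNIV. K $ j $ i * M $ i $ k) = (if j = k then Jdet * Jdet else 0)"
proof -
  have "(K ** M) $ j $ k = mat (det K) $ j $ k" by (simp add: M_def matrix_mul_adjugate)
  then show ?thesis by (simp add: matrix_matrix_mult_def det_K mat_def)
qed

end

section \<open>Christoffel symbols of the invariants and the matrix \<open>N\<close>\<close>

context irreducible_invariants
begin

lemma weight_K: "weight (e i + e j) (K $ i $ j)"
  unfolding K_nth by (intro weight_sum weight_mult weight_pdiff_p)

definition hess :: "'n \<Rightarrow> 'n \<Rightarrow> ('n cpoly, 'n) vec" where
  "hess k i = (\<chi> r. vder (J $ i) (pdiff r (p k)))"

text \<open>At a given point the direction \<open>grad (p i) x\<close> can be frozen. The Hessian
  applied to it is then the gradient of a derivative along a constant field, whose behaviour under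
  \<open>W\<close> is known.\<close>

lemma pev_hess: "(\<chi> r. pev (hess k i $ r) x) = grad (vder (cvec (grad (p i) x)) (p k)) x"
proof -
  have "pev (vder (J $ i) f) x = pev (vder (cvec (grad (p i) x)) f) x" for f
    by (simp add: pev_vder cvec_def jacobian_def grad_def)
  then show ?thesis by (simp add: hess_def vec_eq_iff pdiff_vder_cvec)
qed

lemma equivariant_hess: "equivariant (hess k i)"
  unfolding equivariant_def
proof (intro ballI allI)
  fix w x assume w: "w \<in> W"
  have "pact w (p k) = p k" using p_invariant[of k] w by (simp add: invariant_ring_iff)
  then have "vder (cvec (grad (p i) x)) (p k) = pact w (vder (cvec (act w (grad (p i) x))) (p k))"
    using vder_cvec_pact by metis
  then have "grad (vder (cvec (grad (p i) x)) (p k)) x = act (transpose w) (grad (vder (cvec (grad (p i) (act w x))) (p k)) (act w x))"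
    by (simp add: grad_pact grad_invariant[OF p_invariant w])
  then show "(\<chi> r. pev (hess k i $ r) (act w x)) = act w (\<chi> r. pev (hess k i $ r) x)"
    unfolding pev_hess by (simp add: act_transpose[OF orth[OF w]])
qed

text \<open>Up to convention, the contravariant Christoffel symbols of the flat metric
  \<open>K\<close> in the coordinates \<open>p\<close>.\<close>

definition christoffel :: "'n \<Rightarrow> 'n \<Rightarrow> 'n \<Rightarrow> 'n cpoly" where
  "christoffel k i = (SOME f. (\<forall>j. f j \<in> invariant_ring W) \<and> (\<forall>r. hess k i $ r = (\<Sum>j\<in>UNIV. f j * pdiff r (p j))))"

lemma christoffel: "hess k i $ r = (\<Sum>j\<in>UNIV. christoffel k i j * pdiff r (p j))"
proof -
  have "\<exists>f. (\<forall>j. f j \<in> invariant_ring W) \<and> (\<forall>r. hess k i $ r = (\<Sum>j\<in>UNIV. f j * pdiff r (p j)))"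
    using equivariantE[OF equivariant_hess[of k i]] by metis
  from someI_ex[OF this] show ?thesis unfolding christoffel_def by blast
qed

lemma weight_christoffel: "weight (e k + e i - 1 - e j) (christoffel k i j)"
proof (rule gradient_coeffs_weight[OF christoffel])
  fix r
  have "hess k i $ r = (\<Sum>s\<in>UNIV. pdiff s (p i) * pdiff s (pdiff r (p k)))"
    by (simp add: hess_def vder_def jacobian_def)
  moreover have "weight (e i + (e k - 1)) (\<Sum>s\<in>UNIV. pdiff s (p i) * pdiff s (pdiff r (p k)))"
    by (intro weight_sum weight_mult weight_pdiff weight_pdiff_p)
  ultimately have "weight (e i + (e k - 1)) (hess k i $ r)" by simp
  moreover have "e i + (e k - 1) = e k + e i - 1" by simp
  ultimately show "weight (e k + e i - 1) (hess k i $ r)" by (simp only:)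
qed

text \<open>The gradient of \<open>K $ k $ i\<close> is \<open>hess k i + hess i k\<close>, so
  \<open>N + N^T\<close> is the derivative of \<open>K\<close> with respect to \<open>p l\<close>,
  the matrix of Saito's flat metric.\<close>

definition N :: "(('n cpoly, 'n) vec, 'n) vec" where "N = (\<chi> k i. christoffel k i l)"

abbreviation minor :: "'n cpoly" where "minor \<equiv> M $ l $ l"

abbreviation NM :: "'n \<Rightarrow> 'n cpoly" where
  "NM k \<equiv> (\<Sum>i\<in>UNIV. N $ i $ k * M $ i $ l)"

text \<open>Row \<open>i\<close> of \<open>J\<close>, differentiated along the gradient of
  \<open>p k\<close>, is \<open>hess i k\<close>; hence \<open>k\<close> is the middle index of the
  multiplier.\<close>

lemma mder_jacobian: "mder (J $ k) J = (\<chi> i j. christoffel i k j) ** J"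
proof -
  have "vder (J $ k) (J $ i $ r) = (\<Sum>j\<in>UNIV. christoffel i k j * J $ j $ r)" for i r
    using christoffel[of i k r] by (simp add: hess_def jacobian_def)
  then show ?thesis by (simp add: vec_eq_iff matrix_matrix_mult_def)
qed

definition tr :: "'n \<Rightarrow> 'n cpoly" where "tr k = (\<Sum>i\<in>UNIV. christoffel i k i)"

lemma vder_Jdet: "vder (J $ k) Jdet = tr k * Jdet"
  using vder_det_mult[OF mder_jacobian[of k]] by (simp add: Jdet_def tr_def trace_def)

text \<open>The last diagonal entry of \<open>mder_adjugate_gram\<close>. The two products with the
  multiplier coincide there by the symmetry of \<open>M\<close>, and they involve column
  \<open>k\<close> of \<open>N\<close> only.\<close>

lemma vder_M: "vder (J $ k) minor = 2 * tr k * minor - 2 * (NM k)"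
proof -
  let ?L = "(\<chi> i j. christoffel i k j)"
  have "mder (J $ k) M = mat (2 * trace ?L) ** M - M ** ?L - transpose ?L ** M"
    unfolding M_def K_def
    by (rule mder_adjugate_gram[OF _ mder_jacobian]) (use Jdet_nonzero in \<open>simp add: Jdet_def\<close>)
  from arg_cong[OF this, of "\<lambda>A. A $ l $ l"]
  have "vder (J $ k) minor = 2 * trace ?L * minor - (\<Sum>i\<in>UNIV. M $ l $ i * christoffel i k l) - (\<Sum>i\<in>UNIV. christoffel i k l * M $ i $ l)"
    by (simp add: mat_mult_left) (simp add: matrix_matrix_mult_def transpose_def)
  moreover have "(\<Sum>i\<in>UNIV. M $ l $ i * christoffel i k l) = (\<Sum>i\<in>UNIV. christoffel i k l * M $ i $ l)"
    by (simp add: M_symmetric[of l] mult.commute)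
  ultimately show ?thesis by (simp add: tr_def trace_def N_def)
qed

text \<open>With \<open>h = e l + 1\<close> this is the classical sum \<open>\<ell> h / 2\<close> of
  the exponents. \<open>K\<close> is invertible at a regular vector \<open>z\<close>, so some
  permutation \<open>q\<close> selects entries that are all nonzero there. Comparing
  \<open>z\<close> with \<open>\<omega> *s z\<close> shows that \<open>h\<close> divides
  \<open>e i + e (q i)\<close>, and the bounds 2 and \<open>2 h - 2\<close> leave only
  \<open>h\<close>.\<close>

lemma coxeter_number_duality: "2 * (\<Sum>i\<in>UNIV. e i) = int CARD('n) * (e l + 1)"
proof -
  obtain z where z: "\<And>i. i \<noteq> l \<Longrightarrow> pev (p i) z = 0" "pev (p l) z = 1" "pev Jdet z \<noteq> 0"
    using regular_zero_exists by metis
  define h where "h = d l"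
  define \<omega> where "\<omega> = cis (2 * pi / real h)"
  have h: "h > 0" using degree_ge_2[of l] by (simp add: h_def)
  have \<omega>0: "\<omega> \<noteq> 0" and \<omega>h: "\<omega> ^ h = 1" using cis_root_power[OF h] by (simp_all add: \<omega>_def)
  have "det (evm K z) \<noteq> 0" using z(3) by (simp add: det_K pev_mult flip: pev_det)
  then have "\<exists>q. q permutes UNIV \<and> of_int (sign q) * (\<Prod>i\<in>UNIV. evm K z $ i $ q i) \<noteq> 0"
    unfolding det_def by (metis (mono_tags, lifting) mem_Collect_eq sum.neutral)
  then obtain q where q: "q permutes UNIV" "(\<Prod>i\<in>UNIV. pev (K $ i $ q i) z) \<noteq> 0" by auto
  have "e i + e (q i) = e l + 1" for i
  proof -
    have K0: "pev (K $ i $ q i) z \<noteq> 0" using q(2) by simp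
    obtain g where g: "K $ i $ q i = poly_subst p g" using K_invariant invariantE by metis
    have "pev (p k) (\<omega> *s z) = pev (p k) z" for k
      using weightD[OF weight_p[of k] \<omega>0, of z] z(1)[of k] \<omega>h by (cases "k = l") (auto simp: h_def)
    then have "pev (K $ i $ q i) (\<omega> *s z) = pev (K $ i $ q i) z" by (simp add: g pev_poly_subst)
    then have 1: "\<omega> powi (e i + e (q i)) = 1"
      using weightD[OF weight_K[of i "q i"] \<omega>0, of z] K0 by simp
    define n where "n = nat (e i + e (q i) - 1)"
    have n: "e i + e (q i) = int n + 1" using e_pos[of i] e_pos[of "q i"] by (simp add: n_def)
    have "n + 1 < h + h" using n e_le[of i] e_le[of "q i"] by (simp add: e_def h_def)
    have "\<omega> ^ (n + 1) = 1" using 1 n by (simp add: power_int_def nat_add_distrib)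
    moreover have "n + 1 \<ge> h"
    proof (rule ccontr)
      assume "\<not> ?thesis"
      then show False using cis_root_power_eq_1[of "n + 1" h] \<open>\<omega> ^ (n + 1) = 1\<close> by (simp add: \<omega>_def)
    qed
    then obtain r where r: "n + 1 = h + r" using le_Suc_ex by blast
    ultimately have "\<omega> ^ h * \<omega> ^ r = 1" by (simp only: power_add[symmetric])
    then have "\<omega> ^ r = 1" using \<omega>h by simp
    moreover have "r < h" using r \<open>n + 1 < h + h\<close> by simp
    ultimately have "r = 0" using cis_root_power_eq_1 unfolding \<omega>_def by blast
    then show ?thesis using n r by (simp add: e_def h_def)
  qed
  then have "(\<Sum>i\<in>UNIV. e i + e (q i)) = (\<Sum>i\<in>(UNIV :: 'n set). e l + 1)" by simp
  moreover have "(\<Sum>i\<in>UNIV. e (q i)) = (\<Sum>i\<in>UNIV. e i)"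
    by (rule sum.reindex_bij_betw) (use q(1) in \<open>auto simp: permutes_bij\<close>)
  ultimately show ?thesis by (simp add: sum.distrib)
qed

lemma det_N: "\<exists>c. c \<noteq> 0 \<and> det N = Const c"
proof -
  \<comment> \<open>Splitting into row weights \<open>e k\<close> and column weights
    \<open>e i - 1 - e l\<close> makes \<open>weight_det\<close> applicable; the total is zero by
    \<open>coxeter_number_duality\<close>.\<close>
  have "weight (e k + (e i - 1 - e l)) (N $ k $ i)" for k i
    using weight_christoffel[of k i l] by (simp add: N_def algebra_simps)
  then have "weight ((\<Sum>i\<in>UNIV. e i) + (\<Sum>i\<in>UNIV. e i - 1 - e l)) (det N)" by (rule weight_det)
  moreover have "(\<Sum>i\<in>UNIV. e i) + (\<Sum>i\<in>UNIV. e i - 1 - e l) = 0"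
    using coxeter_number_duality by (simp add: sum_subtractf algebra_simps)
  ultimately have "weight 0 (det N)" by simp
  then have N: "det N = Const (pev (det N) 0)" by (rule weight_0_imp_Const)
  obtain z where z: "\<And>i. i \<noteq> l \<Longrightarrow> pev (p i) z = 0" "pev (p l) z = 1" "pev Jdet z \<noteq> 0"
    using regular_zero_exists by metis
  \<comment> \<open>\<open>hess k i\<close> is contracted with \<open>z\<close> in two ways. By
    Euler's formula the gradient of \<open>p j\<close> contributes \<open>d j\<close> times the
    value of \<open>p j\<close>, which is zero for \<open>j \<noteq> l\<close>, while the Hessian of
    \<open>p k\<close> maps \<open>z\<close> to \<open>e k\<close> times the gradient.\<close>
  have NK: "of_nat (d l) * pev (N $ k $ i) z = of_int (e k) * pev (K $ k $ i) z" for k i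
  proof -
    have "(\<Sum>r\<in>UNIV. pev (hess k i $ r) z * z $ r) = (\<Sum>j\<in>UNIV. pev (christoffel k i j) z * cdot (grad (p j) z) z)"
      unfolding christoffel pev_simps sum_distrib_right cdot_def sum_distrib_left
      by (subst sum.swap) (simp add: mult.assoc)
    also have "\<dots> = (\<Sum>j\<in>UNIV. if j = l then of_nat (d l) * pev (N $ k $ i) z else 0)"
      using euler[OF weight_p] z by (intro sum.cong) (auto simp: N_def)
    finally have "(\<Sum>r\<in>UNIV. pev (hess k i $ r) z * z $ r) = of_nat (d l) * pev (N $ k $ i) z" by simp
    moreover have "(\<Sum>r\<in>UNIV. pev (hess k i $ r) z * z $ r)
        = (\<Sum>s\<in>UNIV. pev (pdiff s (p i)) z * cdot (grad (pdiff s (p k)) z) z)"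
      unfolding hess_def vder_def jacobian_def cdot_def sum_distrib_left
      by (simp add: pev_simps sum_distrib_right, subst sum.swap) (simp add: pdiff_commute[of _ _ "p k"] mult.assoc)
    moreover have "\<dots> = of_int (e k) * pev (K $ k $ i) z"
      by (simp add: euler[OF weight_pdiff_p] K_nth pev_simps sum_distrib_left algebra_simps)
    ultimately show ?thesis by simp
  qed
  have "det (evm N z) \<noteq> 0"
    unfolding det_eq_0_iff_kernel
  proof
    assume "\<exists>y. y \<noteq> 0 \<and> evm N z *v y = 0"
    then obtain y where y: "y \<noteq> 0" "evm N z *v y = 0" by blast
    have "(evm K z *v y) $ k = 0" for k
    proof -
      have "of_int (e k) * (evm K z *v y) $ k = of_nat (d l) * (evm N z *v y) $ k"
        by (simp add: matrix_vector_mult_def sum_distrib_left NK flip: mult.assoc)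
      then show ?thesis using y(2) e_pos[of k] by simp
    qed
    then have "evm K z *v y = 0" by (simp add: vec_eq_iff)
    then have "det (evm K z) = 0" using y(1) unfolding det_eq_0_iff_kernel by blast
    then show False using z(3) by (simp add: det_K pev_mult flip: pev_det)
  qed
  then have "pev (det N) z \<noteq> 0" by (simp add: pev_det)
  then have "pev (det N) 0 \<noteq> 0" using N by (metis pev_Const)
  then show ?thesis using N by blast
qed

end

section \<open>Saito's criterion\<close>

lemma lform_cancel_dvd:
  fixes m :: "'n::{finite,linorder} cpoly"
  assumes a: "a \<noteq> 0" and nd: "\<not> lform a dvd m" and m: "m dvd lform a * b"
  shows "m dvd b"
proof -
  obtain u where u: "lform a * b = m * u" using m ..
  then have "lform a dvd m * u" by (metis dvd_triv_left)
  then have "lform a dvd u" using lform_dvd_mult[OF a] nd by blast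
  then obtain u' where "u = lform a * u'" ..
  with u have "lform a * b = lform a * (m * u')" by (simp add: mult.left_commute)
  then have "b = m * u'" using a by simp
  then show ?thesis by simp
qed

lemma vder_mem_Der: "vder a \<in> Der"
  by (simp add: Der_def vder_add vder_mult)

lemma Der_eq_vder:
  fixes \<delta> :: "'n::finite cpoly \<Rightarrow> 'n cpoly"
  assumes "\<delta> \<in> Der"
  shows "\<delta> = vder (\<chi> j. \<delta> (Var j))"
proof
  have add: "\<delta> (f + g) = \<delta> f + \<delta> g" and const: "\<delta> (Const c * f) = Const c * \<delta> f"
    and mult: "\<delta> (f * g) = f * \<delta> g + g * \<delta> f" for f g c
    using assms unfolding Der_def by blast+
  have "\<delta> 1 = 0" using mult[of 1 1] by simp
  then have c: "\<delta> (Const c) = 0" for c using const[of c 1] by simp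
  show "\<delta> f = vder (\<chi> j. \<delta> (Var j)) f" for f
    by (induction f rule: cpoly_induct) (simp_all add: c add mult vder_add vder_mult)
qed

lemma vder_lform: "vder a (lform b) = (\<Sum>j\<in>UNIV. a $ j * Const (b $ j))"
  by (simp add: vder_def pdiff_lform)

lemma der_scale_vder: "der_scale b (vder a) = vder (\<chi> j. b * a $ j)"
  by (simp add: der_scale_def vder_def fun_eq_iff sum_distrib_left mult.assoc)

lemma vder_sum_left: "(\<Sum>i\<in>A. vder (a i)) = vder (\<Sum>i\<in>A. a i)"
proof -
  have "(\<Sum>i\<in>A. vder (a i)) f = vder (\<Sum>i\<in>A. a i) f" for f
    by (induction A rule: infinite_finite_induct) (simp_all add: vder_def sum.distrib distrib_right)
  then show ?thesis by blast
qed

lemma vder_inject: "vder a = vder b \<longleftrightarrow> a = b"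
  by (metis vder_Var vec_eq_iff)

lemma zero_not_squarefree: "\<not> squarefree (0 :: 'n::finite cpoly)"
  by (auto simp: squarefree_def intro!: exI[of _ 0])

context invariant_basis
begin

text \<open>A repeated root form would make the gradient of \<open>Jdet\<close> vanish at a generic
  point of the mirror.\<close>

lemma Jdet_root_factor:
  assumes s: "s \<in> refls"
  obtains r where "Jdet = rform s * r" "\<not> rform s dvd r"
proof -
  obtain c where c: "c \<noteq> 0" "Jdet = Const c * (\<Prod>s\<in>refls. rform s)"
    using Jdet_factorization by blast
  define r where "r = Const c * (\<Prod>t\<in>refls - {s}. rform t)"
  have J: "Jdet = rform s * r"
    unfolding c r_def using s finite_refls by (simp add: prod.remove mult.left_commute)
  have "\<not> rform s dvd r"
  proof
    assume dv: "rform s dvd r"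
    obtain z where z: "cdot (root_vec s) z = 0" "stab z = {mat 1, s}"
      using generic_on_hyperplane[OF s] by blast
    have "pev r z = 0" using dv z(1) lform_dvd_iff[OF root_nonzero[OF s]] by blast
    then have "grad Jdet z = 0" unfolding J by (simp add: grad_mult z)
    then show False using Jdet_simple_zero[OF s z(2)] by simp
  qed
  with J that show ?thesis by blast
qed

text \<open>The root forms are prime and none divides \<open>m\<close>, so they can be cancelled one
  at a time.\<close>

lemma Jdet_cancel_dvd:
  assumes nd: "\<And>s. s \<in> refls \<Longrightarrow> \<not> rform s dvd m" and m: "m dvd Jdet * b"
  shows "m dvd b"
proof -
  obtain c where c: "c \<noteq> 0" "Jdet = Const c * (\<Prod>s\<in>refls. rform s)"
    using Jdet_factorization by blast
  have "m dvd b" if "finite R" "R \<subseteq> refls" "m dvd (\<Prod>s\<in>R. rform s) * b" for R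
    using that
  proof (induction R rule: finite_induct)
    case (insert s R)
    then have "m dvd rform s * ((\<Prod>s\<in>R. rform s) * b)" by (simp add: mult.assoc)
    then have "m dvd (\<Prod>s\<in>R. rform s) * b"
      using lform_cancel_dvd[of "root_vec s" m] nd root_nonzero insert.prems(1) by blast
    then show ?case using insert by simp
  qed simp
  moreover have "m dvd (\<Prod>s\<in>refls. rform s) * b"
  proof -
    have "m dvd Const (1 / c) * (Jdet * b)" using m by simp
    also have "Const (1 / c) * (Jdet * b) = Const (1 / c * c) * ((\<Prod>s\<in>refls. rform s) * b)"
      by (simp only: c(2) Const_mult mult.assoc)
    finally show ?thesis using c(1) by simp
  qed
  ultimately show ?thesis using finite_refls by blast
qed

text \<open>A determinant of logarithmic fields is divisible by each root form
  and, by Cramer's rule applied to the derivatives of \<open>m\<close>, by \<open>m\<close>.\<close>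

lemma free_divisor_Jdet_mult:
  fixes C :: "(('n cpoly, 'n) vec, 'n) vec"
  assumes nd: "\<And>s. s \<in> refls \<Longrightarrow> \<not> rform s dvd m"
    and grads: "\<And>b. (\<And>k. m dvd b * pdiff k m) \<Longrightarrow> m dvd b"
    and sqf: "squarefree (Jdet * m)"
    and det: "det C = Const \<kappa> * (Jdet * m)" "\<kappa> \<noteq> 0"
    and logJ: "\<And>i. Jdet dvd vder (C $ i) Jdet" and logm: "\<And>i. m dvd vder (C $ i) m"
  shows "free_divisor (Jdet * m)"
proof -
  define f where "f = Jdet * m"
  have f0: "f \<noteq> 0" using sqf zero_not_squarefree f_def by auto
  have detC: "det C \<noteq> 0" using det f0 by (simp add: f_def)
  \<comment> \<open>The mirrors and \<open>m\<close> are pairwise without common factors, so a field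
    that is logarithmic for the product is logarithmic for each of them.\<close>
  have split: "(\<forall>s\<in>refls. rform s dvd vder a (rform s)) \<and> m dvd vder a m"
    if a: "f dvd vder a f" for a
  proof
    have vf: "vder a f = Jdet * vder a m + m * vder a Jdet" by (simp add: f_def vder_mult)
    show "\<forall>s\<in>refls. rform s dvd vder a (rform s)"
    proof
      fix s assume s: "s \<in> refls"
      obtain r where r: "Jdet = rform s * r" "\<not> rform s dvd r" using Jdet_root_factor[OF s] by blast
      have "rform s dvd f" by (simp add: f_def r mult.assoc)
      then have "rform s dvd vder a ((rform s) * (r * m))" using a by (metis dvd_trans f_def r(1) mult.assoc)
      then have "rform s dvd (r * m) * vder a (rform s)" by (simp add: vder_mult dvd_add_right_iff)
      then show "rform s dvd vder a (rform s)"
        using lform_dvd_mult[OF root_nonzero[OF s]] r(2) nd[OF s] by blast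
    qed
    have "m dvd vder a f" using a by (metis dvd_trans dvd_triv_right f_def)
    then have "m dvd Jdet * vder a m" unfolding vf by (simp add: dvd_add_left_iff)
    then show "m dvd vder a m" using Jdet_cancel_dvd[of m] nd by blast
  qed
  have logC: "f dvd vder (C $ i) f" for i
    unfolding f_def vder_mult
  proof (rule dvd_add)
    show "Jdet * m dvd Jdet * vder (C $ i) m" using logm[of i] by simp
    show "Jdet * m dvd m * vder (C $ i) Jdet" using logJ[of i] by (simp add: mult.commute)
  qed
  have det_dvd: "f dvd det B" if B: "\<And>i. f dvd vder (B $ i) f" for B :: "(('n cpoly, 'n) vec, 'n) vec"
  proof -
    \<comment> \<open>If \<open>q\<close> divides all entries of \<open>B u\<close>, it divides
      those of \<open>adj(B) B u = det(B) u\<close>.\<close>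
    have cramer: "q dvd det B * u k" if "\<And>i. q dvd (\<Sum>j\<in>UNIV. B $ i $ j * u j)" for q u k
    proof -
      have "(\<Sum>i\<in>UNIV. adjugate B $ k $ i * (\<Sum>j\<in>UNIV. B $ i $ j * u j)) = (\<Sum>j\<in>UNIV. (adjugate B ** B) $ k $ j * u j)"
        unfolding matrix_matrix_mult_def sum_distrib_left
        by (subst sum.swap) (simp add: sum_distrib_right mult.assoc)
      also have "\<dots> = det B * u k"
        by (simp add: adjugate_mul_matrix mat_def if_distrib if_distribR cong: if_cong)
      finally show ?thesis using that by (metis (no_types, lifting) dvd_mult dvd_sum)
    qed
    \<comment> \<open>Taking the gradient of \<open>m\<close> for \<open>u\<close> gives
      divisibility of \<open>det B\<close> times each partial derivative, and \<open>grads\<close>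
      removes the derivatives.\<close>
    have m1: "m dvd det B"
    proof (rule grads)
      show "m dvd det B * pdiff k m" for k
        by (rule cramer) (use split[OF B] in \<open>simp add: vder_def\<close>)
    qed
    then obtain u where u: "det B = m * u" ..
    have "Jdet dvd u"
    proof (rule Jdet_dvdI)
      fix s x assume s: "s \<in> refls" and x: "cdot (root_vec s) x = 0"
      obtain k where k: "root_vec s $ k \<noteq> 0" using root_nonzero[OF s] by (auto simp: vec_eq_iff)
      have "rform s dvd det B * Const (root_vec s $ k)"
        by (rule cramer) (use split[OF B] s in \<open>simp flip: vder_lform\<close>)
      then have "rform s dvd det B * Const (root_vec s $ k) * Const (1 / root_vec s $ k)"
        by (rule dvd_mult2)
      then have "rform s dvd m * u"
        using k u by (simp add: mult.assoc flip: Const_mult)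
      then have "rform s dvd u"
        using lform_dvd_mult[OF root_nonzero[OF s]] nd[OF s] by blast
      then show "pev u x = 0" using x lform_dvd_iff[OF root_nonzero[OF s]] by blast
    qed
    then show ?thesis unfolding u f_def by (simp add: mult.commute mult_dvd_mono)
  qed
  define B where "B = range (\<lambda>j. vder (C $ j))"
  have inj: "inj (\<lambda>j. vder (C $ j))"
  proof (rule injI)
    fix i j assume "vder (C $ i) = vder (C $ j)"
    then have "C $ i = C $ j" by (simp add: vder_inject)
    show "i = j"
    proof (rule ccontr)
      assume "i \<noteq> j"
      then have "det C = 0" using \<open>C $ i = C $ j\<close> by (intro det_identical_rows[of i j]) (auto simp: row_def)
      with detC show False by simp
    qed
  qed
  have "der_span B = log_Der f"
  proof
    have "der.subspace (log_Der f)"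
    proof (rule der.subspaceI)
      show "0 \<in> log_Der f" by (simp add: log_Der_def Der_def)
      show "x + y \<in> log_Der f" if "x \<in> log_Der f" "y \<in> log_Der f" for x y
        using that by (auto simp: log_Der_def Der_def algebra_simps)
      show "der_scale c x \<in> log_Der f" if "x \<in> log_Der f" for c x
        using that by (auto simp: log_Der_def Der_def der_scale_def algebra_simps)
    qed
    moreover have "B \<subseteq> log_Der f" by (auto simp: B_def log_Der_def vder_mem_Der logC)
    ultimately show "der_span B \<subseteq> log_Der f" by (intro der.span_minimal)
  next
    show "log_Der f \<subseteq> der_span B"
    proof
      fix \<delta> assume \<delta>: "\<delta> \<in> log_Der f"
      define t where "t = (\<chi> j. \<delta> (Var j))"
      have t: "\<delta> = vder t" using Der_eq_vder[of \<delta>] \<delta> by (simp add: t_def log_Der_def)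
      \<comment> \<open>The matrix with one row replaced by \<open>t\<close> still has logarithmic
        rows, so the Cramer numerators are divisible by \<open>f\<close>, hence by
        \<open>det C\<close>, which differs from \<open>f\<close> by a unit.\<close>
      have "f dvd det (\<chi> i. if i = j then t else C $ i)" for j
        by (rule det_dvd) (use \<delta> t logC in \<open>auto simp: log_Der_def\<close>)
      then have "\<exists>b. \<forall>j. det (\<chi> i. if i = j then t else C $ i) = f * b j"
        by (intro choice allI) (auto elim!: dvdE)
      then obtain b where b: "\<And>j. det (\<chi> i. if i = j then t else C $ i) = f * b j" by blast
      have "det C * t $ k = f * (\<Sum>j\<in>UNIV. b j * C $ j $ k)" for k
      proof -
        have "f * (\<Sum>j\<in>UNIV. b j * C $ j $ k) = (\<Sum>j\<in>UNIV. det (\<chi> i. if i = j then t else C $ i) * C $ j $ k)"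
          by (simp add: b sum_distrib_left mult.assoc)
        also have "\<dots> = (\<Sum>r\<in>UNIV. t $ r * (adjugate C ** C) $ r $ k)"
          unfolding det_replace_row matrix_matrix_mult_def sum_distrib_right
          by (subst sum.swap) (simp add: sum_distrib_left mult.assoc)
        also have "\<dots> = det C * t $ k"
          by (simp add: adjugate_mul_matrix mat_def if_distrib mult.commute cong: if_cong)
        finally show ?thesis by simp
      qed
      then have "f * (Const \<kappa> * t $ k) = f * (\<Sum>j\<in>UNIV. b j * C $ j $ k)" for k
        by (simp add: det f_def mult_ac)
      then have "Const \<kappa> * t $ k = (\<Sum>j\<in>UNIV. b j * C $ j $ k)" for k using f0 by (simp only: mult_cancel_left) simp
      then have "Const (1 / \<kappa>) * (Const \<kappa> * t $ k) = Const (1 / \<kappa>) * (\<Sum>j\<in>UNIV. b j * C $ j $ k)" for k by simp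
      then have tk: "t $ k = (\<Sum>j\<in>UNIV. Const (1 / \<kappa>) * b j * C $ j $ k)" for k
        using det(2) by (simp add: sum_distrib_left mult.assoc[symmetric] flip: Const_mult)
      have "\<delta> = (\<Sum>j\<in>UNIV. der_scale (Const (1 / \<kappa>) * b j) (vder (C $ j)))"
        unfolding t der_scale_vder vder_sum_left vder_inject by (simp add: vec_eq_iff tk)
      also have "\<dots> \<in> der_span B"
        by (intro der.span_sum der.span_scale der.span_base) (simp add: B_def)
      finally show "\<delta> \<in> der_span B" .
    qed
  qed
  moreover have "\<not> der_dependent B"
  proof
    assume "der_dependent B"
    then obtain T u v where T: "finite T" "T \<subseteq> B" "(\<Sum>\<delta>\<in>T. der_scale (u \<delta>) \<delta>) = 0" "v \<in> T" "u v \<noteq> 0"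
      unfolding der.dependent_explicit by blast
    define I where "I = {j. vder (C $ j) \<in> T}"
    have TI: "T = (\<lambda>j. vder (C $ j)) ` I" using T(2) by (auto simp: I_def B_def)
    have "(\<Sum>j\<in>I. der_scale (u (vder (C $ j))) (vder (C $ j))) = 0"
      using T(3) unfolding TI by (subst (asm) sum.reindex) (auto intro: inj_on_subset[OF inj])
    then have "vder (\<Sum>j\<in>I. \<chi> k. u (vder (C $ j)) * C $ j $ k) = vder 0"
      unfolding der_scale_vder vder_sum_left by (simp add: vder_def fun_eq_iff)
    then have "(\<Sum>j\<in>I. \<chi> k. u (vder (C $ j)) * C $ j $ k) = 0" by (simp add: vder_inject)
    then have "(\<Sum>j\<in>I. u (vder (C $ j)) * C $ j $ k) = 0" for k by (simp add: vec_eq_iff)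
    moreover have "(\<Sum>j\<in>UNIV. (if j \<in> I then u (vder (C $ j)) else 0) * C $ j $ k) = (\<Sum>j\<in>I. u (vder (C $ j)) * C $ j $ k)" for k
      by (rule sum.mono_neutral_cong_right) auto
    ultimately have "(if j \<in> I then u (vder (C $ j)) else 0) = 0" for j
      by (intro row_mult_cancel[of "\<lambda>j. if j \<in> I then u (vder (C $ j)) else 0" C]) (simp_all add: detC)
    moreover obtain j where "j \<in> I" "v = vder (C $ j)" using T(4) TI by auto
    ultimately show False using T(5) by (metis (full_types))
  qed
  ultimately show ?thesis
    using sqf unfolding free_divisor_def f_def by blast
qed

text \<open>The multiplier is a sign because \<open>s\<close> is an involution. If it were 1, the
  gradient of \<open>Jdet\<close> would be tangent to the mirror, contrary to the simple zero at
  generic points.\<close>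

lemma reflection_Jdet:
  assumes s: "s \<in> refls"
  shows "pev Jdet (act s x) = - pev Jdet x"
proof -
  define S :: "((complex, 'n) vec, 'n) vec" where "S = (\<chi> k j. complex_of_real (s $ j $ k))"
  have "evm J (act s y) = evm J y ** S" for y
  proof -
    have "evm J (act s y) $ i $ j = (evm J y ** S) $ i $ j" for i j
      using arg_cong[OF grad_invariant[OF p_invariant reflection_in[OF s], of i y], of "\<lambda>v. v $ j"]
      by (simp add: matrix_matrix_mult_def S_def act_def jacobian_def mult.commute)
    then show ?thesis by (simp add: vec_eq_iff)
  qed
  then have D: "pev Jdet (act s y) = det S * pev Jdet y" for y
    by (simp add: Jdet_def pev_det det_mul)
  obtain y where y: "pev Jdet y \<noteq> 0" using pev_nonzero_ex[OF Jdet_nonzero] by blast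
  have "act s (act s y) = y"
    using act_transpose(2)[OF orth[OF reflection_in[OF s]], of y] by (simp add: transpose_reflection[OF s])
  then have "pev Jdet y = det S * (det S * pev Jdet y)" using D by metis
  then have "det S * det S = 1" using y by simp
  then have "det S = 1 \<or> det S = - 1" by (simp add: square_eq_1_iff)
  moreover have "det S \<noteq> 1"
  proof
    assume "det S = 1"
    then have "pact s Jdet = Jdet" by (intro pev_eqI) (simp add: pev_pact D)
    obtain z where z: "cdot (root_vec s) z = 0" "stab z = {mat 1, s}"
      using generic_on_hyperplane[OF s] by blast
    have "grad Jdet z = act s (grad Jdet z)"
      using grad_pact[of s Jdet z] z(1) s by (simp add: \<open>pact s Jdet = Jdet\<close> transpose_reflection act_reflection)
    then have "cdot (root_vec s) (grad Jdet z) = 0" using reflection_fixed_iff[OF s] by metis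
    then show False using Jdet_simple_zero[OF s z(2)] by simp
  qed
  ultimately show ?thesis using D by simp
qed

text \<open>The quotient by the root form changes sign under \<open>s\<close>, hence vanishes on the
  mirror.\<close>

lemma invariant_root_square_dvd:
  assumes f: "f \<in> invariant_ring W" and s: "s \<in> refls" and dv: "rform s dvd f"
  shows "rform s * rform s dvd f"
proof -
  obtain g where g: "f = rform s * g" using dv ..
  have L: "pact s (rform s) = - (rform s)"
    by (rule pev_eqI) (simp add: pev_pact pev_uminus act_reflection[OF s] cdot_root[OF s])
  have "pact s f = f" using f reflection_in[OF s] by (simp add: invariant_ring_iff)
  then have "rform s * (- pact s g) = rform s * g" by (simp add: g pact_mult L)
  then have g': "- pact s g = g" using root_nonzero[OF s] by (simp only: mult_cancel_left) simp
  have "rform s dvd g"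
  proof (rule lform_dvdI[OF root_nonzero[OF s]])
    fix x assume "cdot (root_vec s) x = 0"
    then have "act s x = x" using s by (simp add: reflection_fixed_iff)
    then have "- pev g x = pev g x" using arg_cong[OF g', of "\<lambda>f. pev f x"] by (simp add: pev_uminus pev_pact)
    then show "pev g x = 0" by simp
  qed
  then show ?thesis unfolding g by (simp add: mult_dvd_mono)
qed

end

section \<open>Reducedness\<close>

context irreducible_invariants
begin

text \<open>The derivation with respect to \<open>p l\<close>, multiplied by \<open>Jdet\<close> to
  clear denominators.\<close>

definition v :: "('n cpoly, 'n) vec" where "v = (\<chi> j. adjugate J $ j $ l)"

lemma vder_v_p: "vder v (p i) = (if i = l then Jdet else 0)"
proof -
  have "vder v (p i) = (J ** adjugate J) $ i $ l"
    by (simp add: vder_def v_def matrix_matrix_mult_def jacobian_def mult.commute)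
  then show ?thesis by (simp add: matrix_mul_adjugate mat_def Jdet_def)
qed

text \<open>The adjugate of \<open>J J^T\<close> is \<open>adj(J)^T adj(J)\<close>, so its last
  diagonal entry is the bilinear square of the last column of \<open>adj(J)\<close>.\<close>

lemma M_ll: "minor = (\<Sum>j\<in>UNIV. v $ j * v $ j)"
proof -
  have "K ** (transpose (adjugate J) ** adjugate J) = J ** (transpose J ** transpose (adjugate J)) ** adjugate J"
    by (simp add: K_def matrix_mul_assoc)
  also have "transpose J ** transpose (adjugate J) = mat Jdet"
    unfolding matrix_transpose_mul[symmetric] adjugate_mul_matrix transpose_mat Jdet_def ..
  also have "J ** mat Jdet ** adjugate J = mat Jdet ** (J ** adjugate J)"
    by (simp add: mat_mult_right mat_mult_left) (simp add: vec_eq_iff matrix_matrix_mult_def sum_distrib_left mult.assoc)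
  also have "\<dots> = K ** M"
    by (simp add: M_def matrix_mul_adjugate det_K mat_mult_left flip: Jdet_def) (simp add: vec_eq_iff mat_def)
  finally have "transpose (adjugate J) ** adjugate J = M"
    by (rule matrix_cancel_left[rotated]) (simp add: det_K Jdet_nonzero)
  then have "minor = (transpose (adjugate J) ** adjugate J) $ l $ l" by simp
  then show ?thesis by (simp add: matrix_matrix_mult_def transpose_def v_def)
qed

text \<open>Differentiation by \<open>p l\<close> is equivariant, and the factor \<open>Jdet\<close>
  changes sign. Pairing with the gradients proves this where they are independent; multiplication by
  the pulled back \<open>Jdet\<close> extends it to all points.\<close>

lemma v_reflection:
  assumes s: "s \<in> refls"
  shows "(\<chi> j. pev (v $ j) (act s x)) = - act s (\<chi> j. pev (v $ j) x)"
proof -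
  let ?v = "\<lambda>x. \<chi> j. pev (v $ j) x"
  have gv: "cdot (grad (p i) x) (?v x) = (if i = l then pev Jdet x else 0)" for i x
    using arg_cong[OF vder_v_p[of i], of "\<lambda>f. pev f x"] by (simp add: pev_vder cdot_commute)
  have sW: "s \<in> W" by (rule reflection_in[OF s])
  have 1: "?v (act s x) + act s (?v x) = 0" if "pev Jdet (act s x) \<noteq> 0" for x
  proof -
    have "cdot (grad (p i) (act s x)) (?v (act s x) + act s (?v x)) = 0" for i
    proof -
      have "cdot (grad (p i) (act s x)) (act s (?v x)) = (if i = l then pev Jdet x else 0)"
        using gv[of i x] by (simp add: grad_invariant[OF p_invariant sW] cdot_act_act[OF orth[OF sW]])
      moreover have "cdot (grad (p i) (act s x)) (?v (act s x)) = (if i = l then - pev Jdet x else 0)"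
        using gv[of i "act s x"] by (simp add: reflection_Jdet[OF s])
      ultimately show ?thesis by simp
    qed
    then show ?thesis using that unfolding Jdet_eq_0_iff by blast
  qed
  have "(?v (act s x) + act s (?v x)) $ j = 0" for j
  proof -
    define G where "G = pact s (v $ j) + (\<Sum>k\<in>UNIV. Const (of_real (s $ j $ k)) * v $ k)"
    have G: "pev G x = (?v (act s x) + act s (?v x)) $ j" for x
      by (simp add: G_def pev_simps pev_pact act_def)
    have "pact s Jdet * G = 0"
    proof (rule pev_eqI)
      fix x
      show "pev (pact s Jdet * G) x = pev 0 x"
      proof (cases "pev Jdet (act s x) = 0")
        case False
        then show ?thesis using 1[OF False] by (simp add: pev_mult G del: plus_vec_def)
      qed (simp add: pev_mult pev_pact)
    qed
    moreover have "pact s Jdet \<noteq> 0"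
    proof
      assume "pact s Jdet = 0"
      then have "pev Jdet x = 0" for x
        using pev_pact[of s Jdet x] by (simp add: \<open>pact s Jdet = 0\<close> reflection_Jdet[OF s])
      then show False using pev_eq_0_imp Jdet_nonzero by blast
    qed
    ultimately have "G = 0" by simp
    then show ?thesis using G[of x] by simp
  qed
  then have "?v (act s x) + act s (?v x) = 0" unfolding vec_eq_iff by simp
  then show ?thesis by (simp add: eq_neg_iff_add_eq_0)
qed

lemma pderiv_power_lookup:
  fixes g :: "'n cpoly"
  shows "\<exists>c. c \<noteq> 0 \<and> lookup ((pdiff l ^^ k) g) (single l j) = c * lookup g (single l (j + k))"
proof (induction k arbitrary: j)
  case 0
  show ?case by (rule exI[of _ 1]) simp
next
  case (Suc k)
  obtain c where c: "c \<noteq> 0" "lookup ((pdiff l ^^ k) g) (single l (Suc j)) = c * lookup g (single l (Suc j + k))"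
    using Suc[of "Suc j"] by blast
  have "single l j + single l 1 = single l (Suc j)"
    by (simp flip: single_add)
  then have "lookup ((pdiff l ^^ Suc k) g) (single l j) = (of_nat (Suc j) * c) * lookup g (single l (j + Suc k))"
    by (simp add: lookup_pdiff c del: of_nat_Suc)
  moreover have "of_nat (Suc j) * c \<noteq> 0" using c(1) by (simp del: of_nat_Suc)
  ultimately show ?case by blast
qed

text \<open>The assumption kills the coefficients of the pure powers of the variable
  \<open>l\<close>, and all other monomials vanish on the axis.\<close>

lemma pev_axis_eq_0:
  fixes g :: "'n cpoly"
  assumes "\<And>k. pev ((pdiff l ^^ k) g) 0 = 0"
  shows "pev g (axis l 1) = 0"
proof -
  have lk: "lookup g (single l k) = 0" for k
  proof -
    obtain c where "c \<noteq> 0" "lookup ((pdiff l ^^ k) g) (single l 0) = c * lookup g (single l (0 + k))"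
      using pderiv_power_lookup by blast
    then show ?thesis using assms[of k] by (simp add: pev_at_0)
  qed
  have pz: "(\<Prod>i\<in>UNIV. (axis l 1 $ i :: complex) ^ lookup m i) = 0" if m: "m \<in> keys g" for m
  proof -
    have "m \<noteq> single l (lookup m l)"
      using m lk[of "lookup m l"] by (metis in_keys_iff)
    then obtain i where i: "lookup m i \<noteq> lookup (single l (lookup m l)) i"
      by (metis poly_mapping_eqI)
    then have "i \<noteq> l" by auto
    then have "(axis l 1 $ i :: complex) ^ lookup m i = 0"
      using i by (simp add: axis_def lookup_single_not_eq)
    then show ?thesis by (intro prod_zero) auto
  qed
  show ?thesis unfolding pev_def by (intro sum.neutral ballI) (simp only: pz mult_zero_right)
qed

text \<open>If \<open>m\<close> vanished on a hyperplane \<open>H\<close>, then so would the field \<open>v = det J \<partial>/\<partial>p\<^sub>l\<close>, which is normal to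
  \<open>H\<close> along \<open>H\<close>. Hence \<open>\<partial>/\<partial>p\<^sub>l\<close> would preserve the ideal of invariants vanishing on \<open>H\<close>,
  which contains \<open>(det J)\<^sup>2\<close>. But a power of \<open>p\<^sub>l\<close> occurs in the latter.\<close>

lemma root_not_dvd_M:
  assumes s: "s \<in> refls"
  shows "\<not> rform s dvd minor"
proof
  let ?v = "\<lambda>x. \<chi> j. pev (v $ j) x"
  assume dv: "rform s dvd minor"
  \<comment> \<open>On the mirror \<open>v\<close> is a multiple of the root by
    \<open>v_reflection\<close>, and its square is \<open>minor\<close>. The root is not isotropic,
    so \<open>v\<close> vanishes where \<open>minor\<close> does.\<close>
  have v0: "rform s dvd v $ j" for j
  proof (rule lform_dvdI[OF root_nonzero[OF s]])
    fix x assume x: "cdot (root_vec s) x = 0"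
    define c where "c = cdot (root_vec s) (?v x)"
    have "act s x = x" using s x by (simp add: reflection_fixed_iff)
    then have "?v x = - (?v x - (2 * c) *s root_vec s)"
      using v_reflection[OF s, of x] unfolding act_reflection[OF s, of "?v x"] c_def by (simp only:)
    then have "pev (v $ i) x = - (pev (v $ i) x - 2 * c * root_vec s $ i)" for i
      by (auto dest: arg_cong[of _ _ "\<lambda>u. u $ i"])
    then have "2 * pev (v $ i) x = 2 * (c * root_vec s $ i)" for i by (simp add: algebra_simps)
    then have vx: "pev (v $ i) x = c * root_vec s $ i" for i by simp
    have "pev minor x = 0" using dv x lform_dvd_iff[OF root_nonzero[OF s]] by blast
    then have "cdot (c *s root_vec s) (c *s root_vec s) = 0" by (simp add: M_ll pev_simps vx cdot_def)
    then have "c = 0" using cdot_root[OF s] by simp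
    then show "pev (v $ j) x = 0" using vx by simp
  qed
  obtain r where r: "Jdet = rform s * r" "\<not> rform s dvd r" using Jdet_root_factor[OF s] by blast
  have "det K \<in> invariant_ring W"
    unfolding invariant_ring_iff
  proof
    fix w assume w: "w \<in> W"
    have "evm K (act w x) = evm K x" for x
      by (simp add: vec_eq_iff pev_invariant[OF K_invariant w])
    then show "pact w (det K) = det K" by (intro pev_eqI) (simp add: pev_pact pev_det)
  qed
  then have "Jdet * Jdet \<in> invariant_ring W" by (simp add: det_K)
  then obtain g where g: "Jdet * Jdet = poly_subst p g" by (rule invariantE)
  define F where "F k = poly_subst p ((pdiff l ^^ k) g)" for k
  have vF: "vder v (F k) = Jdet * F (Suc k)" for k
  proof -
    have "vder v (F k) = (\<Sum>i\<in>UNIV. if i = l then F (Suc k) * Jdet else 0)"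
      unfolding F_def vder_poly_subst by (intro sum.cong) (auto simp: vder_v_p)
    then show ?thesis by (simp add: mult.commute)
  qed
  \<comment> \<open>Invariance doubles the root factor, \<open>v\<close> preserves divisibility by
    the square of the root form, and only one factor is lost to \<open>Jdet\<close> in passing to
    \<open>F (Suc k)\<close>.\<close>
  have "rform s dvd F k" for k
  proof (induction k)
    case 0
    show ?case using g by (simp add: F_def r mult.assoc flip: g)
  next
    case (Suc k)
    have "rform s * rform s dvd F k"
      using invariant_root_square_dvd[OF _ s Suc] poly_subst_p_invariant by (simp add: F_def)
    then obtain G where G: "F k = rform s * (rform s) * G" ..
    have "rform s dvd vder v (rform s)"
      unfolding vder_lform by (intro dvd_sum dvd_mult2 v0)
    then obtain u where u: "vder v (rform s) = rform s * u" ..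
    have "rform s * (r * F (Suc k)) = vder v ((rform s) * (rform s) * G)"
      using vF[of k] by (simp add: G r(1) mult.assoc)
    also have "\<dots> = rform s * ((rform s) * (vder v G + 2 * u * G))"
      by (simp add: vder_mult u algebra_simps)
    finally have "r * F (Suc k) = rform s * (vder v G + 2 * u * G)"
      using root_nonzero[OF s] by (simp only: mult_cancel_left) simp
    then have "rform s dvd r * F (Suc k)" by simp
    then show ?case using lform_dvd_mult[OF root_nonzero[OF s]] r(2) by blast
  qed
  then have F0: "pev (F k) 0 = 0" for k
    using lform_dvd_iff[OF root_nonzero[OF s]] cdot_0(1) by blast
  have p0: "(\<chi> i. pev (p i) 0) = 0"
  proof -
    have "pev (p i) 0 = 0" for i
      using euler[OF weight_p[of i], of 0] degree_ge_2[of i] by simp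
    then show ?thesis by (simp add: vec_eq_iff)
  qed
  have "pev ((pdiff l ^^ k) g) 0 = 0" for k
    using F0[of k] by (simp add: F_def pev_poly_subst p0)
  then have "pev g (axis l 1) = 0" by (rule pev_axis_eq_0)
  \<comment> \<open>\<open>p\<close> maps the regular vector to the unit point of the
    \<open>l\<close>-th axis, where \<open>g\<close> has just been seen to vanish.\<close>
  obtain z where z: "\<And>i. i \<noteq> l \<Longrightarrow> pev (p i) z = 0" "pev (p l) z = 1" "pev Jdet z \<noteq> 0"
    using regular_zero_exists by metis
  have "(\<chi> i. pev (p i) z) = axis l 1" using z by (auto simp: vec_eq_iff axis_def)
  then have "pev (Jdet * Jdet) z = 0" using \<open>pev g (axis l 1) = 0\<close> by (simp add: g pev_poly_subst)
  then show False using z(3) by (simp add: pev_mult)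
qed

text \<open>As \<open>det N\<close> is a nonzero constant, \<open>adj(N)\<close> recovers the last
  column of \<open>M\<close> from the \<open>NM k\<close>, and the last row of \<open>K\<close>
  pairs with this column to \<open>det K\<close>.\<close>

lemma M_column_combination:
  obtains c u where "c \<noteq> 0" "Const c * (Jdet * Jdet) = (\<Sum>k\<in>UNIV. u k * (NM k))"
proof -
  obtain c where c: "c \<noteq> 0" "det N = Const c" using det_N by blast
  have "(\<Sum>k\<in>UNIV. adjugate N $ k $ r * (NM k)) = Const c * M $ r $ l" for r
  proof -
    have "(\<Sum>k\<in>UNIV. adjugate N $ k $ r * (NM k)) = (\<Sum>i\<in>UNIV. (N ** adjugate N) $ i $ r * M $ i $ l)"
      unfolding matrix_matrix_mult_def sum_distrib_left
      by (subst sum.swap) (simp add: sum_distrib_left sum_distrib_right mult_ac)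
    also have "\<dots> = Const c * M $ r $ l"
      by (simp add: matrix_mul_adjugate mat_def c if_distrib if_distribR cong: if_cong)
    finally show ?thesis .
  qed
  then have "(\<Sum>r\<in>UNIV. K $ l $ r * (\<Sum>k\<in>UNIV. adjugate N $ k $ r * (NM k)))
      = (\<Sum>r\<in>UNIV. K $ l $ r * (Const c * M $ r $ l))" by simp
  also have "\<dots> = Const c * (\<Sum>r\<in>UNIV. K $ l $ r * M $ r $ l)"
    by (simp add: sum_distrib_left mult.left_commute)
  also have "\<dots> = Const c * (Jdet * Jdet)" by (simp add: K_mult_M)
  finally have *: "Const c * (Jdet * Jdet)
      = (\<Sum>r\<in>UNIV. K $ l $ r * (\<Sum>k\<in>UNIV. adjugate N $ k $ r * (NM k)))" by simp
  have "(\<Sum>r\<in>UNIV. K $ l $ r * (\<Sum>k\<in>UNIV. adjugate N $ k $ r * X k))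
      = (\<Sum>k\<in>UNIV. (\<Sum>r\<in>UNIV. K $ l $ r * adjugate N $ k $ r) * X k)" for X
    unfolding sum_distrib_left sum_distrib_right by (subst sum.swap) (simp only: mult.assoc)
  from that[OF c(1) trans[OF * this]] show ?thesis .
qed

lemma M_column_dvd:
  assumes "\<And>k. q dvd b * (NM k)"
  shows "q dvd b * (Jdet * Jdet)"
proof -
  obtain c u where c: "c \<noteq> 0" and u: "Const c * (Jdet * Jdet) = (\<Sum>k\<in>UNIV. u k * (NM k))"
    by (rule M_column_combination)
  have "q dvd (\<Sum>k\<in>UNIV. u k * (b * (NM k)))"
    by (intro dvd_sum) (simp add: assms dvd_mult)
  also have "\<dots> = b * (Const c * (Jdet * Jdet))"
    unfolding u by (simp add: sum_distrib_left mult_ac)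
  finally have "q dvd Const (1 / c) * (b * (Const c * (Jdet * Jdet)))" by (rule dvd_mult)
  also have "Const (1 / c) * (b * (Const c * (Jdet * Jdet))) = (Const (1 / c) * Const c) * (b * (Jdet * Jdet))"
    by (simp only: mult_ac)
  finally show ?thesis using c by (simp flip: Const_mult)
qed

text \<open>This is the reducedness of \<open>minor\<close>. Modulo \<open>minor\<close> its
  derivatives along the gradients are the \<open>-2 * NM k\<close>; they generate an ideal
  containing the square of \<open>Jdet\<close>, which can be cancelled.\<close>

lemma M_gradient_dvd:
  assumes "\<And>k. minor dvd b * pdiff k minor"
  shows "minor dvd b"
proof -
  have "minor dvd b * (NM k)" for k
  proof -
    have "minor dvd b * vder (J $ k) minor"
      unfolding vder_def sum_distrib_left by (intro dvd_sum) (simp add: mult.left_commute[of b] assms)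
    then have "minor dvd (b * (2 * tr k)) * minor - b * vder (J $ k) minor" by simp
    also have "(b * (2 * tr k)) * minor - b * vder (J $ k) minor = b * (2 * (NM k))"
      by (simp add: vder_M algebra_simps)
    finally have "minor dvd Const (1 / 2) * (b * ((1 + 1) * (NM k)))" by simp
    also have "Const (1 / 2) * (b * ((1 + 1) * (NM k)))
        = (Const (1 / 2) + Const (1 / 2)) * (b * (NM k))"
      by (simp only: algebra_simps mult_1_left)
    finally show ?thesis by (simp flip: Const_add)
  qed
  then have "minor dvd b * (Jdet * Jdet)" by (rule M_column_dvd)
  then have "minor dvd Jdet * (Jdet * b)" by (simp add: mult_ac)
  then show ?thesis using Jdet_cancel_dvd root_not_dvd_M by blast
qed

text \<open>A nonconstant \<open>x\<close> whose square divides the product contains no root form,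
  so it has a zero off the mirrors. There \<open>minor\<close> and its derivatives vanish, hence all
  \<open>NM k\<close>, and then \<open>Jdet\<close> as well.\<close>

lemma squarefree_Jdet_M: "squarefree (Jdet * minor)"
proof (rule squarefreeI, rule ccontr)
  fix x assume x: "x ^ 2 dvd Jdet * minor" "\<not> x dvd 1"
  have m0: "minor \<noteq> 0"
  proof
    assume "minor = 0"
    have "minor dvd 1" by (rule M_gradient_dvd) (simp add: \<open>minor = 0\<close>)
    then show False using \<open>minor = 0\<close> by simp
  qed
  have nc: "x \<noteq> Const c" for c
  proof
    assume "x = Const c"
    moreover from this have "c = 0" using Const_dvd_one x(2) by blast
    ultimately show False using x(1) m0 Jdet_nonzero by simp
  qed
  obtain y where "Jdet * minor = x ^ 2 * y" using x(1) ..
  then have y: "Jdet * minor = x * (x * y)" by (simp only: power2_eq_square mult.assoc)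
  have nd: "\<not> rform s dvd x" if s: "s \<in> refls" for s
  proof
    assume "rform s dvd x"
    then obtain x' where x': "x = rform s * x'" ..
    obtain r where r: "Jdet = rform s * r" "\<not> rform s dvd r" using Jdet_root_factor[OF s] by blast
    have "rform s * (r * minor) = rform s * (rform s * (x' * x' * y))"
      using y by (simp add: r(1) x' mult_ac)
    then have "r * minor = rform s * (x' * x' * y)"
      using root_nonzero[OF s] by (simp only: mult_cancel_left) simp
    then have "rform s dvd r * minor" by simp
    then show False using lform_dvd_mult[OF root_nonzero[OF s]] r(2) root_not_dvd_M[OF s] by blast
  qed
  obtain z where z: "pev x z = 0" "\<And>s. s \<in> refls \<Longrightarrow> cdot (root_vec s) z \<noteq> 0"
    by (rule nonunit_zero_off_hyperplanes[of x refls root_vec])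
       (use nc finite_refls root_nonzero nd in auto)
  obtain c where c: "c \<noteq> 0" "Jdet = Const c * (\<Prod>s\<in>refls. rform s)"
    using Jdet_factorization by blast
  have Jz: "pev Jdet z \<noteq> 0" using z(2) c finite_refls by (simp add: pev_simps)
  have "pev Jdet z * pev minor z = 0" using arg_cong[OF y, of "\<lambda>f. pev f z"] z(1) by (simp add: pev_mult)
  then have mz: "pev minor z = 0" using Jz by simp
  have "pev (vder a minor) z = 0" for a
    using arg_cong[OF y, of "\<lambda>f. pev (vder a f) z"] z(1) mz Jz by (simp add: vder_mult pev_simps)
  then have "pev (NM k) z = 0" for k
    using arg_cong[OF vder_M[of k], of "\<lambda>f. pev f z"] mz by (simp add: pev_simps)
  moreover obtain b u where b: "b \<noteq> 0"
    and u: "Const b * (Jdet * Jdet) = (\<Sum>k\<in>UNIV. u k * (NM k))"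
    by (rule M_column_combination)
  ultimately have "b * (pev Jdet z * pev Jdet z) = 0"
  proof -
    assume "\<And>k. pev (NM k) z = 0"
    then have "pev (Const b * (Jdet * Jdet)) z = 0" unfolding u pev_sum[of "\<lambda>k. u k * _ k"] pev_mult[of "u _"] by simp
    then show ?thesis by (simp add: pev_mult)
  qed
  then show False using b Jz by simp
qed

end

section \<open>Passage from V/W to V and the logarithmic basis\<close>

lemma poly_subst_det: "poly_subst g (det A) = det (\<chi> i j. poly_subst g (A $ i $ j))"
  by (simp add: det_def poly_subst_simps)

lemma poly_subst_adjugate: "poly_subst g (adjugate A $ i $ j) = adjugate (\<chi> i j. poly_subst g (A $ i $ j)) $ i $ j"
  unfolding adjugate_def cofactor_def vec_lambda_beta poly_subst_det
  by (rule arg_cong[of _ _ det]) (simp add: vec_eq_iff)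

context invariant_basis
begin

lemma poly_subst_descend: "f \<in> invariant_ring W \<Longrightarrow> poly_subst p (descend p f) = f"
  unfolding descend_def by (rule theI') (metis invariantE poly_subst_p_inject)

lemma poly_subst_K_matrix: "poly_subst p (adjugate (K_matrix p) $ i $ i) = M $ i $ i"
proof -
  have "(\<chi> i j. poly_subst p (K_matrix p $ i $ j)) = K"
    using K_invariant by (simp add: vec_eq_iff K_matrix_def K_def[symmetric] poly_subst_descend)
  then show ?thesis by (simp add: poly_subst_adjugate M_def)
qed

text \<open>The minor is empty, hence 1, and \<open>Jdet\<close> is a nonzero constant. The divisor
  is empty, and all derivations are logarithmic.\<close>

lemma free_divisor_one_dimensional:
  assumes W: "W = {mat 1}" and one: "\<And>i. i = k"
  shows "free_divisor (Jdet * M $ k $ k)"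
proof -
  have refl: "refls = {}" using reflection_in reflection_ne_one W by blast
  then obtain c where c: "c \<noteq> 0" "Jdet = Const c" using Jdet_factorization by auto
  have m: "M $ k $ k = 1"
  proof -
    have "(\<chi> i j. if i = k \<and> j = k then 1 else if i = k \<or> j = k then 0 else K $ i $ j) = (mat 1 :: (('n cpoly, 'n) vec, 'n) vec)"
      using one by (simp add: vec_eq_iff mat_def) metis
    then show ?thesis by (simp add: M_def adjugate_def cofactor_def)
  qed
  have "squarefree (Jdet * 1)"
  proof (rule squarefreeI)
    fix x assume "x ^ 2 dvd Jdet * 1"
    then have "x ^ 2 dvd 1" using Const_dvd_one[OF c(1)] by (metis c(2) dvd_trans mult.right_neutral)
    then show "x dvd 1" by (metis dvd_trans dvd_triv_left power2_eq_square)
  qed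
  then have "free_divisor (Jdet * 1)"
  proof (rule free_divisor_Jdet_mult[rotated 2])
    show "det J = Const 1 * (Jdet * 1)" by (simp add: Jdet_def)
    show "Jdet dvd vder (J $ i) Jdet" for i by (simp add: c)
  qed (simp_all add: refl)
  then show ?thesis by (simp add: m)
qed

end

context irreducible_invariants
begin

lemma weight_Jdet: "weight (\<Sum>i\<in>UNIV. e i) Jdet"
proof -
  have "weight (e i + 0) (J $ i $ j)" for i j using weight_pdiff_p by (simp add: jacobian_def)
  then have "weight ((\<Sum>i\<in>UNIV. e i) + (\<Sum>i\<in>(UNIV :: 'n set). 0)) (det J)" by (rule weight_det)
  then show ?thesis by (simp add: Jdet_def)
qed

lemma weight_M: "weight (2 * ((\<Sum>i\<in>UNIV. e i) - e l)) minor"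
proof -
  \<comment> \<open>The unit row and column with index \<open>l\<close> carry weight zero; the zeros
    in them have every weight.\<close>
  let ?a = "\<lambda>i. if i = l then 0 else e i"
  have "weight (?a i + ?a j) (if i = l \<and> j = l then 1 else if i = l \<or> j = l then 0 else K $ i $ j)" for i j
    using weight_K by (simp add: weight_def)
  then have "weight ((\<Sum>i\<in>UNIV. ?a i) + (\<Sum>i\<in>UNIV. ?a i)) minor"
    unfolding M_def adjugate_def cofactor_def by (simp only: vec_lambda_beta) (rule weight_det, simp)
  moreover have "(\<Sum>i\<in>UNIV. ?a i) = (\<Sum>i\<in>UNIV. e i) - e l"
    by (simp add: sum.remove[of UNIV l])
  ultimately show ?thesis by simp
qed

text \<open>The logarithmic basis consists of the Euler field and of the combinations of the gradients by the
  rows of \<open>K (N\<^sup>T)\<^sup>-\<^sup>1\<close> other than the last one, which annihilate the last column of \<open>adj K\<close>.\<close>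

theorem free_divisor_Jdet_M: "free_divisor (Jdet * minor)"
proof -
  obtain \<nu> where \<nu>: "\<nu> \<noteq> 0" "det N = Const \<nu>" using det_N by blast
  obtain q c where q: "d q = 2" "c \<noteq> 0" "\<And>x. grad (p q) x = c *s x" using quadratic_invariant by metis
  have Jq: "pev (J $ q $ j) x = c * x $ j" for j x
    using arg_cong[OF q(3)[of x], of "\<lambda>v. v $ j"] by (simp add: jacobian_def)
  \<comment> \<open>The gradient of the quadratic invariant is \<open>c\<close> times the Euler
    field.\<close>
  have euler_vder: "vder (J $ q) f = Const (c * of_int k) * f" if f: "weight k f" for f k
  proof (rule pev_eqI)
    fix x
    have "pev (vder (J $ q) f) x = c * cdot (grad f x) x"
      by (simp add: pev_vder Jq cdot_def sum_distrib_left mult_ac)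
    then show "pev (vder (J $ q) f) x = pev (Const (c * of_int k) * f) x"
      by (simp add: euler[OF f] pev_mult)
  qed
  define S where "S = (NM q)"
  have "tr q * Jdet = Const (c * of_int (\<Sum>i\<in>UNIV. e i)) * Jdet"
    unfolding vder_Jdet[symmetric] by (rule euler_vder[OF weight_Jdet])
  then have trq: "tr q = Const (c * of_int (\<Sum>i\<in>UNIV. e i))" using Jdet_nonzero by simp
  \<comment> \<open>By Euler's formula the derivative of \<open>minor\<close> along the gradient of
    \<open>p q\<close> is \<open>2 c (\<Sum> e i - e l) minor\<close>. In \<open>vder_M\<close> the
    trace term gives \<open>2 c \<Sum> e i\<close>, so the difference is accounted for by
    \<open>S\<close>.\<close>
  have S: "S = Const (c * of_int (e l)) * minor"
  proof (rule pev_eqI)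
    fix x
    have "pev (vder (J $ q) minor) x = pev (2 * tr q * minor - 2 * S) x" by (simp add: vder_M S_def)
    then show "pev S x = pev (Const (c * of_int (e l)) * minor) x"
      by (simp add: euler_vder[OF weight_M] trq pev_mult pev_diff algebra_simps)
  qed
  define B :: "(('n cpoly, 'n) vec, 'n) vec" where
    "B = (\<chi> j. if j = l then axis q 1 else (\<chi> k. Const (1 / \<nu>) * (\<Sum>i\<in>UNIV. K $ j $ i * adjugate (transpose N) $ i $ k)))"
  have BN: "(\<Sum>k\<in>UNIV. B $ j $ k * N $ i $ k) = (if j = l then N $ i $ q else K $ j $ i)" for i j
  proof (cases "j = l")
    case True
    then show ?thesis by (simp add: B_def axis_def if_distrib if_distribR cong: if_cong)
  next
    case False
    have "(\<Sum>k\<in>UNIV. B $ j $ k * N $ i $ k) = Const (1 / \<nu>) * (\<Sum>r\<in>UNIV. K $ j $ r * (adjugate (transpose N) ** transpose N) $ r $ i)"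
      using False unfolding B_def matrix_matrix_mult_def
      by (simp add: sum_distrib_left sum_distrib_right transpose_def mult.assoc) (rule sum.swap)
    also have "\<dots> = Const (1 / \<nu>) * (Const \<nu> * K $ j $ i)"
      by (simp add: adjugate_mul_matrix \<nu>(2) mat_def if_distrib mult.commute cong: if_cong)
    finally show ?thesis using False \<nu>(1) by (simp add: mult.assoc[symmetric] flip: Const_mult)
  qed
  have "B ** transpose N = (\<chi> j. if j = l then (\<chi> i. N $ i $ q) else K $ j)"
    by (simp add: vec_eq_iff matrix_matrix_mult_def transpose_def BN)
  then have "det B * Const \<nu> = det (\<chi> j. if j = l then (\<chi> i. N $ i $ q) else K $ j)"
    by (metis \<nu>(2) det_mul det_transpose)
  \<comment> \<open>Expansion along the last row, which is column \<open>q\<close> of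
    \<open>N\<close>, against the last column of \<open>adj(K)\<close>.\<close>
  also have "\<dots> = S" by (simp add: det_replace_row S_def M_def)
  finally have "det B * Const \<nu> * Const (1 / \<nu>) = Const (c * of_int (e l)) * minor * Const (1 / \<nu>)" by (simp add: S)
  then have "det B = Const (c * of_int (e l)) * minor * Const (1 / \<nu>)"
    using \<nu>(1) by (simp add: mult.assoc flip: Const_mult)
  then have detB: "det B = Const (c * of_int (e l) / \<nu>) * minor"
    by (simp add: mult.commute mult.left_commute flip: Const_mult)
  have vder_row: "vder ((B ** J) $ i) f = (\<Sum>k\<in>UNIV. B $ i $ k * vder (J $ k) f)" for i f
    unfolding vder_def matrix_matrix_mult_def
    by (simp add: sum_distrib_left sum_distrib_right mult.assoc) (rule sum.swap)
  show ?thesis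
  proof (rule free_divisor_Jdet_mult[OF root_not_dvd_M M_gradient_dvd squarefree_Jdet_M])
    show "det (B ** J) = Const (c * of_int (e l) / \<nu>) * (Jdet * minor)"
      by (simp add: det_mul detB Jdet_def mult_ac)
    show "c * of_int (e l) / \<nu> \<noteq> 0" using q(2) \<nu>(1) e_pos[of l] by simp
    show "Jdet dvd vder ((B ** J) $ i) Jdet" for i
      unfolding vder_row by (intro dvd_sum dvd_mult) (simp add: vder_Jdet)
    show "minor dvd vder ((B ** J) $ i) minor" for i
    proof (cases "i = l")
      case True
      have "(\<Sum>k\<in>UNIV. B $ i $ k * vder (J $ k) minor) = vder (J $ q) minor"
        using True by (simp add: B_def axis_def if_distrib if_distribR cong: if_cong)
      then show ?thesis by (simp add: vder_row euler_vder[OF weight_M])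
    next
      case False
      \<comment> \<open>For \<open>i \<noteq> l\<close>, row \<open>i\<close> of
        \<open>B N^T\<close> is row \<open>i\<close> of \<open>K\<close>, whose product with column
        \<open>l\<close> of \<open>M\<close> is an off-diagonal entry of \<open>K M\<close>.\<close>
      have "(\<Sum>k\<in>UNIV. B $ i $ k * (NM k)) = (\<Sum>r\<in>UNIV. (\<Sum>k\<in>UNIV. B $ i $ k * N $ r $ k) * M $ r $ l)"
        unfolding sum_distrib_left sum_distrib_right by (subst sum.swap) (simp only: mult.assoc)
      also have "\<dots> = 0" using False K_mult_M[of i l] by (simp add: BN)
      finally have 0: "(\<Sum>k\<in>UNIV. B $ i $ k * (NM k)) = 0" .
      have "(\<Sum>k\<in>UNIV. B $ i $ k * vder (J $ k) minor)
          = (\<Sum>k\<in>UNIV. B $ i $ k * (2 * tr k)) * minor - 2 * (\<Sum>k\<in>UNIV. B $ i $ k * (NM k))"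
      proof -
        have "(\<Sum>k\<in>UNIV. b k * (2 * t k * m - 2 * X k)) = (\<Sum>k\<in>UNIV. b k * (2 * t k)) * m - 2 * (\<Sum>k\<in>UNIV. b k * X k)"
          for b t X :: "'n \<Rightarrow> 'n cpoly" and m
          by (simp add: sum_distrib_left sum_distrib_right sum_subtractf algebra_simps)
        then show ?thesis unfolding vder_M .
      qed
      then show ?thesis by (simp add: vder_row 0)
    qed
  qed
qed

end

lemma irreducible_trivial_group:
  assumes "irreducible_action {mat 1 :: real^'n::finite^'n}"
  shows "(i :: 'n) = j"
proof (rule ccontr)
  assume "i \<noteq> j"
  define U where "U = {x :: real^'n. x $ j = 0}"
  have "subspace U" by (simp add: U_def subspace_def)
  then have "U = {0} \<or> U = UNIV" using assms unfolding irreducible_action_def by (auto simp: matrix_vector_mul_lid)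
  moreover have "axis i 1 \<in> U" "axis j 1 \<notin> U" "axis i (1 :: real) \<noteq> 0"
    using \<open>i \<noteq> j\<close> by (auto simp: U_def axis_def vec_eq_iff)
  ultimately show False by blast
qed

lemma orthogonal_group_GL:
  fixes W :: "((real, 'n::{finite,linorder}) vec, 'n) vec set"
  assumes fin: "finite W" and sub: "subgroup W GL" and orth: "\<forall>w\<in>W. orthogonal_matrix w"
  shows "orthogonal_group W"
proof
  show "finite W" by (rule fin)
  show "mat 1 \<in> W" using subgroup.one_closed[OF sub] by (simp add: GL_def)
  show "v ** w \<in> W" if "v \<in> W" "w \<in> W" for v w
    using subgroup.m_closed[OF sub that] by (simp add: GL_def)
  show "orthogonal_matrix w" if "w \<in> W" for w using orth that by blast
  show "transpose w \<in> W" if w: "w \<in> W" for w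
  proof -
    have o: "transpose w ** w = mat 1" "w ** transpose w = mat 1"
      using orth w by (auto simp: orthogonal_matrix_def)
    then have "invertible (transpose w)" unfolding invertible_def by blast
    have "inv\<^bsub>GL\<^esub> w = transpose w"
      unfolding m_inv_def
    proof (rule the_equality)
      show "transpose w \<in> carrier GL \<and> w \<otimes>\<^bsub>GL\<^esub> transpose w = \<one>\<^bsub>GL\<^esub> \<and> transpose w \<otimes>\<^bsub>GL\<^esub> w = \<one>\<^bsub>GL\<^esub>"
        using o \<open>invertible (transpose w)\<close> by (simp add: GL_def)
      fix y assume "y \<in> carrier GL \<and> w \<otimes>\<^bsub>GL\<^esub> y = \<one>\<^bsub>GL\<^esub> \<and> y \<otimes>\<^bsub>GL\<^esub> w = \<one>\<^bsub>GL\<^esub>"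
      then have "y ** w = mat 1" by (simp add: GL_def)
      then show "y = transpose w" by (metis matrix_mul_assoc matrix_mul_lid matrix_mul_rid o(2))
    qed
    then show ?thesis using subgroup.m_inv_closed[OF sub w] by simp
  qed
qed

theorem corollary6p6:
  fixes W :: "((real, 'n::{finite,linorder}) vec, 'n) vec set"
    and d :: "'n \<Rightarrow> nat"
    and p :: "'n \<Rightarrow> 'n cpoly"
  assumes "irreducible_reflection_group W"
    and "\<forall>w\<in>W. orthogonal_matrix w"
    and "basic_invariants W d p"
    and "mono d"
  shows "let l = Max (UNIV :: 'n set); M = adjugate (K_matrix p) $ l $ l
         in free_divisor (det (jacobian p) * poly_subst p M)"
proof -
  have W: "finite W" "subgroup W GL" "irreducible_action W"
    using assms(1) by (simp_all add: irreducible_reflection_group_def)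
  interpret orthogonal_group W using W assms(2) by (intro orthogonal_group_GL)
  interpret invariant_basis W d p by unfold_locales (rule assms(3))
  have "free_divisor (Jdet * M $ Max UNIV $ Max UNIV)"
  \<comment> \<open>For the trivial group the lower bound 2 on the degrees fails, and with it the
    existence of a quadratic basic invariant.\<close>
  proof (cases "W = {mat 1}")
    case True
    then show ?thesis
      using W(3) by (intro free_divisor_one_dimensional irreducible_trivial_group) simp_all
  next
    case False
    interpret irreducible_invariants W d p
      using W(3) assms(4) False by unfold_locales
    show ?thesis by (rule free_divisor_Jdet_M)
  qed
  then show ?thesis by (simp add: Let_def poly_subst_K_matrix Jdet_def)
qed

end
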